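(* Let $X=\{X(t):t\ge 0\}$ be any $L_2$-bounded right-continuous martingale, with last term $X(\infty)=\lim_{t\to\infty}X(t)$, and let $$D^+=\sup_{t\ge 0}\Big\{\sup_{0\le s\le t}X(s)-X(t)\Big\}$$ be its maximal drawdown. Then $E[D^+]\le\sqrt{2}\,\sqrt{\mathrm{Var}(X(\infty))}$. Moreover, the bound $\sqrt{2}$ is attained as follows. Let $B$ be standard Brownian Motion with $B(0)=0$, $A(t)=\max_{0\le s\le t}B(s)-B(t)$, and for $d>0$ let $\mathcal{T}_d^+=\inf\{t\ge 0:\sup_{0\le s\le t}A(s)-A(t)\ge d\}$. Then for every $d>0$ the martingale $\{B(t):t\le\mathcal{T}^+_d\}$ (i.e. $t\mapsto B(t\wedge\mathcal{T}^+_d)$) satisfies $$E\Big[\sup_{0\le s\le\mathcal{T}_d^+}A(s)\Big]=\sqrt{2}\,\sqrt{\mathrm{Var}(B(\mathcal{T}^+_d))}.$$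
   Context: An $L_2$-bounded martingale, i.e. one with $\sup_t E[X(t)^2]<\infty$, is uniformly integrable and has a well-defined terminal element (last term) $X(\infty)$, the a.s. and $L_2$ limit of $X(t)$ as $t\to\infty$. Discrete-time martingales are included by extending them to be constant between consecutive integer times (which makes them right-continuous). The quantity $\sup_{0\le s\le\mathcal{T}_d^+}A(s)$ is the maximal drawdown of $t\mapsto B(t\wedge\mathcal{T}^+_d)$. *)

theory Defs
  imports "HOL-Probability.Probability"
begin

section \<open>Martingales indexed by nonnegative real time\<close>

text \<open>
  Processes are indexed by the type \<^typ>\<open>real\<close>; only times \<^prop>\<open>t \<ge> (0::real)\<close> are ever
  constrained or observed. The filtration need not be complete or right-continuous.
\<close>

definition martingale ::
    "'a measure \<Rightarrow> (real \<Rightarrow> 'a measure) \<Rightarrow> (real \<Rightarrow> 'a \<Rightarrow> real) \<Rightarrow> bool" where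
  "martingale M F X \<longleftrightarrow>
     (\<forall>t\<ge>0. subalgebra M (F t)) \<and>
     (\<forall>s t. 0 \<le> s \<and> s \<le> t \<longrightarrow> sets (F s) \<subseteq> sets (F t)) \<and>
     (\<forall>t\<ge>0. X t \<in> borel_measurable (F t)) \<and>
     (\<forall>t\<ge>0. integrable M (X t)) \<and>
     (\<forall>s t. 0 \<le> s \<and> s \<le> t \<longrightarrow> (AE \<omega> in M. real_cond_exp M (F s) (X t) \<omega> = X s \<omega>))"

definition right_continuous_paths :: "'a measure \<Rightarrow> (real \<Rightarrow> 'a \<Rightarrow> real) \<Rightarrow> bool" where
  "right_continuous_paths M X \<longleftrightarrow>
     (\<forall>\<omega>\<in>space M. \<forall>t\<ge>0. continuous (at_right t) (\<lambda>s. X s \<omega>))"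

definition L2_bounded :: "'a measure \<Rightarrow> (real \<Rightarrow> 'a \<Rightarrow> real) \<Rightarrow> bool" where
  "L2_bounded M X \<longleftrightarrow> (SUP t\<in>{0..}. \<integral>\<^sup>+ \<omega>. ennreal ((X t \<omega>)\<^sup>2) \<partial>M) < \<infinity>"

definition last_term :: "(real \<Rightarrow> 'a \<Rightarrow> real) \<Rightarrow> 'a \<Rightarrow> real" where
  "last_term X \<omega> = Lim at_top (\<lambda>t. X t \<omega>)"

definition natural_filtration ::
    "'a measure \<Rightarrow> (real \<Rightarrow> 'a \<Rightarrow> real) \<Rightarrow> real \<Rightarrow> 'a measure" where
  "natural_filtration M X t =
     sigma (space M) (\<Union>s\<in>{0..t}. {X s -` U \<inter> space M | U. U \<in> sets borel})"

section \<open>Drawdowns\<close>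

text \<open>
  The maximal drawdown of a path is extended-real valued, since the path may be unbounded.
  It is nonnegative (take \<open>s = t\<close>).
\<close>

definition max_drawdown :: "(real \<Rightarrow> real) \<Rightarrow> ereal" where
  "max_drawdown x = (SUP t\<in>{0..}. (SUP s\<in>{0..t}. ereal (x s)) - ereal (x t))"

text \<open>
  The real supremum below is meaningful for paths that are bounded on compact intervals,
  and is a maximum for continuous ones.
\<close>

definition drawdown :: "(real \<Rightarrow> real) \<Rightarrow> real \<Rightarrow> real" where
  "drawdown x t = (SUP s\<in>{0..t}. x s) - x t"

text \<open>
  The first time at which the drawdown process has fallen by \<open>d\<close> below its own running
  maximum; it is \<open>\<infinity>\<close> if there is no such time.
\<close>

definition drawdown_fall_time :: "real \<Rightarrow> (real \<Rightarrow> real) \<Rightarrow> ereal" where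
  "drawdown_fall_time d x =
     (INF t\<in>{t. 0 \<le> t \<and> (SUP s\<in>{0..t}. drawdown x s) - drawdown x t \<ge> d}. ereal t)"

definition max_drawdown_until :: "ereal \<Rightarrow> (real \<Rightarrow> real) \<Rightarrow> ereal" where
  "max_drawdown_until T x = (SUP s\<in>{s. 0 \<le> s \<and> ereal s \<le> T}. ereal (drawdown x s))"

definition stopped_process ::
    "(real \<Rightarrow> 'a \<Rightarrow> real) \<Rightarrow> ('a \<Rightarrow> ereal) \<Rightarrow> real \<Rightarrow> 'a \<Rightarrow> real" where
  "stopped_process X T t \<omega> = X (real_of_ereal (min (ereal t) (T \<omega>))) \<omega>"

text \<open>Where \<open>T \<omega> = \<infinity>\<close>, the value below is the irrelevant \<open>X 0 \<omega>\<close>.\<close>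

definition value_at_time :: "(real \<Rightarrow> 'a \<Rightarrow> real) \<Rightarrow> ('a \<Rightarrow> ereal) \<Rightarrow> 'a \<Rightarrow> real" where
  "value_at_time X T \<omega> = X (real_of_ereal (T \<omega>)) \<omega>"

section \<open>Standard Brownian motion\<close>

locale brownian_motion = prob_space M for M :: "'a measure" +
  fixes B :: "real \<Rightarrow> 'a \<Rightarrow> real"
  assumes random_variable_B: "t \<ge> 0 \<Longrightarrow> random_variable borel (B t)"
    and start_zero: "\<omega> \<in> space M \<Longrightarrow> B 0 \<omega> = 0"
    and normal_increments: "0 \<le> s \<Longrightarrow> s < t \<Longrightarrow>
      distributed M lborel (\<lambda>\<omega>. B t \<omega> - B s \<omega>) (normal_density 0 (sqrt (t - s)))"
    and indep_increments: "0 \<le> \<tau> 0 \<Longrightarrow> (\<And>i. i < n \<Longrightarrow> \<tau> i \<le> \<tau> (Suc i)) \<Longrightarrow>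
      indep_vars (\<lambda>_. borel) (\<lambda>i \<omega>. B (\<tau> (Suc i)) \<omega> - B (\<tau> i) \<omega>) {..<n}"
    and continuous_paths: "\<omega> \<in> space M \<Longrightarrow> continuous_on {0..} (\<lambda>t. B t \<omega>)"

end

theory Submission
  imports Defs
begin

text \<open>
  For a martingale \<open>X\<close> started at \<open>X\<^sub>0\<close> let \<open>A\<close> be the current drawdown, \<open>D\<close> the maximal drawdown so
  far and \<open>e > 0\<close>. The function \<open>V(A, D) = max D e + ((A - (D - e)\<^sup>+)\<^sup>+)\<^sup>2 / (2e)\<close> dominates \<open>D\<close>, and
  \<open>V - X\<^sup>2 / (2e)\<close> is a supermartingale, already along every discrete path up to a martingale
  transform. Hence \<open>E[D] \<le> e + E[(X\<^sub>t - X\<^sub>0)\<^sup>2] / (2e)\<close>, first for finitely many times and then for all of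
  them by Fatou's lemma. Applied to \<open>X\<close> and \<open>- X\<close> after a late time, the bound makes the oscillation
  of the tail vanish, which is the martingale convergence theorem. Optimizing over \<open>e\<close> gives
  \<open>\<surd>2 * \<sigma>\<close>.

  Brownian motion does not reach a new maximum between the time when \<open>D\<close> exceeds \<open>d\<close> and the fall
  time of level \<open>d\<close>. So up to that time and for \<open>e = d\<close> all inequalities become equalities, and
  \<open>E[D] \<ge> d + \<sigma>\<^sup>2 / (2d) \<ge> \<surd>2 * \<sigma>\<close> by the inequality of arithmetic and geometric means.
\<close>

section \<open>A pathwise bound for the maximal drawdown of a sequence\<close>

text \<open>The parameter \<open>e\<close> acts as a Lagrange multiplier for the variance. No
  stochastic integral occurs: the expectation identities rest on finite sums of terms
  \<open>H k * (X (g (Suc k)) - X (g k))\<close> with \<open>H k\<close> square integrable and known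
  at time \<open>g k\<close>, which have mean zero. Inequalities then pass to the limit by Fatou,
  identities by dominated convergence.

  The obstacle in the equality case is the quadratic variation in Ito's formula. It is cancelled
  algebraically before any limit: with \<open>R = M - (D - d)^+\<close>, where \<open>M\<close> is
  the running maximum, \<open>(A - (D - d)^+)^2 - X^2 = R^2 - 2 * R * X\<close>. This is linear in
  \<open>X\<close>, and \<open>R\<close> has finite variation, so the Riemann sums of
  \<open>R dX\<close> converge path by path.

  Nothing is known beforehand about the fall time. Square integrability of the stopped motion,
  uniformly in time, is extracted from the drawdown bound itself with the parameter
  \<open>2 * d\<close> in place of \<open>d\<close>. Finiteness of the fall time then follows by
  contradiction: the stopped motion converges, whereas Brownian paths do not.\<close>

text \<open>Reflection at zero gives the maximum of \<open>x 0, ..., x k\<close> minus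
  \<open>x k\<close>. In this form the pair of current and maximal drawdown is updated from the next
  increment alone, as the one-step inequality requires.\<close>

primrec curr_dd :: "(nat \<Rightarrow> real) \<Rightarrow> nat \<Rightarrow> real" where
  "curr_dd x 0 = 0"
| "curr_dd x (Suc k) = max 0 (curr_dd x k - (x (Suc k) - x k))"

primrec run_dd :: "(nat \<Rightarrow> real) \<Rightarrow> nat \<Rightarrow> real" where
  "run_dd x 0 = 0"
| "run_dd x (Suc k) = max (run_dd x k) (curr_dd x (Suc k))"

lemma curr_dd_nonneg: "0 \<le> curr_dd x k"
  by (cases k) auto

lemma curr_dd_le_run_dd: "curr_dd x k \<le> run_dd x k"
  by (cases k) auto

lemma run_dd_nonneg: "0 \<le> run_dd x k"
  using curr_dd_nonneg curr_dd_le_run_dd order_trans by blast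

lemma run_dd_mono: "i \<le> j \<Longrightarrow> run_dd x i \<le> run_dd x j"
  by (induction j rule: dec_induct) auto

lemma curr_dd_ge: "i \<le> j \<Longrightarrow> x i - x j \<le> curr_dd x j"
proof (induction j)
  case (Suc j)
  then show ?case by (cases "i = Suc j") force+
qed simp

lemma run_dd_ge: "i \<le> j \<Longrightarrow> j \<le> n \<Longrightarrow> x i - x j \<le> run_dd x n"
  using curr_dd_ge[of i j x] curr_dd_le_run_dd[of x j] run_dd_mono[of j n x] by linarith

lemma curr_dd_attained: "\<exists>i\<le>j. curr_dd x j = x i - x j"
proof (induction j)
  case (Suc j)
  then obtain i where i: "i \<le> j" "curr_dd x j = x i - x j" by blast
  show ?case
  proof (cases "curr_dd x j - (x (Suc j) - x j) \<le> 0")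
    case True then show ?thesis by (intro exI[of _ "Suc j"]) auto
  next
    case False then show ?thesis using i by (intro exI[of _ i]) auto
  qed
qed simp

lemma run_dd_attained: "\<exists>i j. i \<le> j \<and> j \<le> n \<and> run_dd x n = x i - x j"
proof (induction n)
  case (Suc n)
  show ?case
  proof (cases "run_dd x n \<le> curr_dd x (Suc n)")
    case True
    then have "run_dd x (Suc n) = curr_dd x (Suc n)" by simp
    then show ?thesis using curr_dd_attained[of "Suc n" x] by force
  next
    case False
    then have "run_dd x (Suc n) = run_dd x n" by simp
    then show ?thesis using Suc le_SucI by metis
  qed
qed simp

text \<open>
  The value function of the optimal stopping problem \<open>sup E[D - B\<^sup>2 / (2 * e)]\<close> for Brownian motion
  with current drawdown \<open>a\<close> and maximal drawdown \<open>D\<close>, followed by its derivative in \<open>- a\<close>.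
\<close>

definition dd_potential :: "real \<Rightarrow> real \<Rightarrow> real \<Rightarrow> real" where
  "dd_potential e a D = max D e + (max 0 (a - max 0 (D - e)))\<^sup>2 / (2 * e)"

definition dd_slope :: "real \<Rightarrow> real \<Rightarrow> real \<Rightarrow> real" where
  "dd_slope e a D = - max 0 (a - max 0 (D - e)) / e"

lemma dd_potential_step:
  assumes e: "e > 0" and a: "0 \<le> a" "a \<le> D"
  shows "dd_potential e (max 0 (a - y)) (max D (max 0 (a - y)))
     \<le> dd_potential e a D + y\<^sup>2 / (2 * e) + dd_slope e a D * y"
proof -
  define p where "p = max 0 (a - max 0 (D - e))"
  define a' where "a' = max 0 (a - y)"
  define D' where "D' = max D a'"
  define p' where "p' = max 0 (a' - max 0 (D' - e))"
  \<comment> \<open>The claim multiplied by \<open>2 * e\<close>; completing the square turns the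
    slope term into the cross term of \<open>(p - y)^2\<close>.\<close>
  have "2 * e * max D' e + p'\<^sup>2 \<le> 2 * e * max D e + (p - y)\<^sup>2"
  proof (cases "D' \<le> max D e")
    case True
    \<comment> \<open>The threshold does not move, so only the square changes, and taking positive
      parts does not increase distances.\<close>
    then have m: "max D' e = max D e" "max 0 (D' - e) = max 0 (D - e)" by (auto simp: D'_def)
    have "p' \<le> \<bar>p - y\<bar>" "0 \<le> p'"
      using a e unfolding p'_def p_def m a'_def by auto
    then have "p'\<^sup>2 \<le> (p - y)\<^sup>2" by (metis abs_of_nonneg abs_le_square_iff)
    then show ?thesis using m by simp
  next
    case False
    then have D': "D' = a'" "a' > D" "a' > e" "a' = a - y"
      using a e by (auto simp: D'_def a'_def max_def split: if_splits)
    then have p': "p' = e" using e by (simp add: p'_def)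
    define u where "u = a' - max 0 (D - e)"
    have u: "0 \<le> u" "u \<le> p - y" "a' = u - e + max D e" using D' e by (auto simp: u_def p_def)
    \<comment> \<open>The only loss at a new maximal drawdown. It vanishes for \<open>u = e\<close>,
      that is, if the level \<open>max D e\<close> is not overshot; this is why continuous paths can
      attain the bound.\<close>
    have "0 \<le> (u - e)\<^sup>2" by simp
    then have "2 * e * (a' - max D e) + e\<^sup>2 \<le> u\<^sup>2"
      by (simp add: u(3) power2_eq_square algebra_simps)
    also have "u\<^sup>2 \<le> (p - y)\<^sup>2" using u by (simp add: power_mono)
    finally have "2 * e * (a' - max D e) + e\<^sup>2 \<le> (p - y)\<^sup>2" .
    moreover have "max D' e = a'" using D' by simp
    ultimately show ?thesis using p' by (simp add: right_diff_distrib)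
  qed
  then have "(2 * e * max D' e + p'\<^sup>2) / (2 * e) \<le> (2 * e * max D e + (p - y)\<^sup>2) / (2 * e)"
    using e by (simp add: divide_right_mono)
  then have "max D' e + p'\<^sup>2 / (2 * e) \<le> max D e + (p\<^sup>2 + y\<^sup>2 - 2 * p * y) / (2 * e)"
    using e by (simp add: add_divide_distrib power2_diff)
  also have "\<dots> = max D e + p\<^sup>2 / (2 * e) + y\<^sup>2 / (2 * e) + (- p / e) * y"
    using e by (simp add: field_simps)
  finally show ?thesis
    unfolding dd_potential_def dd_slope_def p_def p'_def D'_def a'_def .
qed

text \<open>The one-step inequality telescopes from the initial value \<open>e\<close> of the
  potential. The slope at \<open>k\<close> depends on \<open>x 0, ..., x k\<close> only, so its
  terms form a martingale transform.\<close>

lemma run_dd_pathwise_bound: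
  assumes e: "e > 0"
  shows "run_dd x n \<le> e + (\<Sum>k<n. (x (Suc k) - x k)\<^sup>2 / (2 * e)
      + dd_slope e (curr_dd x k) (run_dd x k) * (x (Suc k) - x k))"
proof -
  have "dd_potential e (curr_dd x n) (run_dd x n) \<le> e + (\<Sum>k<n. (x (Suc k) - x k)\<^sup>2 / (2 * e)
      + dd_slope e (curr_dd x k) (run_dd x k) * (x (Suc k) - x k))"
  proof (induction n)
    case 0 show ?case using e by (simp add: dd_potential_def)
  next
    case (Suc n)
    show ?case
      using Suc dd_potential_step[OF e curr_dd_nonneg curr_dd_le_run_dd, of x n "x (Suc n) - x n"]
      by simp
  qed
  moreover have "run_dd x n \<le> dd_potential e (curr_dd x n) (run_dd x n)"
    using e by (simp add: dd_potential_def add.commute add_increasing2)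
  ultimately show ?thesis by linarith
qed

section \<open>Square-integrable martingales\<close>

lemma integrable_square_product:
  fixes f g :: "'a \<Rightarrow> real"
  assumes [measurable]: "f \<in> borel_measurable M" "g \<in> borel_measurable M"
    and sq: "integrable M (\<lambda>x. (f x)\<^sup>2)" "integrable M (\<lambda>x. (g x)\<^sup>2)"
  shows "integrable M (\<lambda>x. f x * g x)"
proof (rule Bochner_Integration.integrable_bound[of _ "\<lambda>x. (f x)\<^sup>2 + (g x)\<^sup>2"])
  show "AE x in M. norm (f x * g x) \<le> norm ((f x)\<^sup>2 + (g x)\<^sup>2)"
  proof (intro AE_I2)
    fix x
    have "0 \<le> (\<bar>f x\<bar> - \<bar>g x\<bar>)\<^sup>2" by simp
    then have "2 * \<bar>f x * g x\<bar> \<le> (f x)\<^sup>2 + (g x)\<^sup>2" by (simp add: power2_diff abs_mult)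
    then show "norm (f x * g x) \<le> norm ((f x)\<^sup>2 + (g x)\<^sup>2)" unfolding real_norm_def by linarith
  qed
qed (use sq in auto)

lemma integrable_square_sum:
  fixes f g :: "'a \<Rightarrow> real"
  assumes "f \<in> borel_measurable M" "g \<in> borel_measurable M"
    and "integrable M (\<lambda>x. (f x)\<^sup>2)" "integrable M (\<lambda>x. (g x)\<^sup>2)"
  shows "integrable M (\<lambda>x. (f x + g x)\<^sup>2)"
  using assms integrable_square_product[OF assms]
  by (simp add: power2_sum mult.assoc)

lemma integrable_square_diff:
  fixes f g :: "'a \<Rightarrow> real"
  assumes "f \<in> borel_measurable M" "g \<in> borel_measurable M"
    and "integrable M (\<lambda>x. (f x)\<^sup>2)" "integrable M (\<lambda>x. (g x)\<^sup>2)"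
  shows "integrable M (\<lambda>x. (f x - g x)\<^sup>2)"
  using assms integrable_square_product[OF assms]
  by (simp add: power2_diff mult.assoc)

lemma integrable_square_bound:
  fixes f g :: "'a \<Rightarrow> real"
  assumes "f \<in> borel_measurable M" "integrable M (\<lambda>x. (g x)\<^sup>2)" "\<And>x. \<bar>f x\<bar> \<le> \<bar>g x\<bar>"
  shows "integrable M (\<lambda>x. (f x)\<^sup>2)"
  using assms by (intro Bochner_Integration.integrable_bound[OF assms(2)]) (auto simp: abs_le_square_iff)

lemma measurable_curr_run_dd:
  assumes "\<And>j. j \<le> k \<Longrightarrow> (\<lambda>\<omega>. x j \<omega>) \<in> borel_measurable N"
  shows "(\<lambda>\<omega>. curr_dd (\<lambda>j. x j \<omega>) k) \<in> borel_measurable N"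
    "(\<lambda>\<omega>. run_dd (\<lambda>j. x j \<omega>) k) \<in> borel_measurable N"
proof -
  have "(\<forall>j\<le>k. (\<lambda>\<omega>. x j \<omega>) \<in> borel_measurable N) \<longrightarrow>
    (\<lambda>\<omega>. curr_dd (\<lambda>j. x j \<omega>) k) \<in> borel_measurable N \<and>
    (\<lambda>\<omega>. run_dd (\<lambda>j. x j \<omega>) k) \<in> borel_measurable N"
    by (induction k) (auto intro!: borel_measurable_max borel_measurable_diff)
  then show "(\<lambda>\<omega>. curr_dd (\<lambda>j. x j \<omega>) k) \<in> borel_measurable N"
    "(\<lambda>\<omega>. run_dd (\<lambda>j. x j \<omega>) k) \<in> borel_measurable N" using assms by auto
qed

locale sq_martingale = prob_space M for M :: "'a measure" +
  fixes F :: "real \<Rightarrow> 'a measure" and X :: "real \<Rightarrow> 'a \<Rightarrow> real"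
  assumes mart: "martingale M F X"
    and integrable_sq: "t \<ge> 0 \<Longrightarrow> integrable M (\<lambda>\<omega>. (X t \<omega>)\<^sup>2)"
begin

lemma adapted: "0 \<le> s \<Longrightarrow> s \<le> t \<Longrightarrow> X s \<in> borel_measurable (F t)"
proof -
  assume st: "0 \<le> s" "s \<le> t"
  have "X s \<in> borel_measurable (F s)" "subalgebra M (F s)" "subalgebra M (F t)"
    "sets (F s) \<subseteq> sets (F t)"
    using mart st unfolding martingale_def by auto
  then show ?thesis
    by (intro measurable_from_subalg[of "F t" "F s"]) (auto simp: subalgebra_def)
qed

lemma subalg: "0 \<le> t \<Longrightarrow> subalgebra M (F t)"
  using mart unfolding martingale_def by auto

lemma from_F: "0 \<le> t \<Longrightarrow> f \<in> borel_measurable (F t) \<Longrightarrow> f \<in> borel_measurable M"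
  using measurable_from_subalg[OF subalg] .

lemma meas: "0 \<le> t \<Longrightarrow> X t \<in> borel_measurable M"
  using from_F[OF _ adapted] by blast

lemma integrable_X: "0 \<le> t \<Longrightarrow> integrable M (X t)"
  using mart unfolding martingale_def by auto

lemma integrable_incr_sq: "0 \<le> s \<Longrightarrow> 0 \<le> t \<Longrightarrow> integrable M (\<lambda>\<omega>. (X t \<omega> - X s \<omega>)\<^sup>2)"
  by (intro integrable_square_diff meas integrable_sq)

text \<open>Pulling \<open>H\<close> out of the conditional expectation gives zero. Square
  integrability rather than boundedness is asked of \<open>H\<close> because the integrands below
  are drawdowns and running maxima.\<close>

lemma orthogonal_incr:
  assumes st: "0 \<le> s" "s \<le> t" and H: "H \<in> borel_measurable (F s)"
    and Hsq: "integrable M (\<lambda>\<omega>. (H \<omega>)\<^sup>2)"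
  shows "integrable M (\<lambda>\<omega>. H \<omega> * (X t \<omega> - X s \<omega>))"
    and "(\<integral>\<omega>. H \<omega> * (X t \<omega> - X s \<omega>) \<partial>M) = 0"
proof -
  interpret sa: finite_measure_subalgebra M "F s"
    by unfold_locales (use subalg st in auto)
  have [measurable]: "H \<in> borel_measurable M" "X t \<in> borel_measurable M" "X s \<in> borel_measurable M"
    using from_F[OF _ H] meas st by auto
  have i: "integrable M (\<lambda>\<omega>. H \<omega> * X t \<omega>)" "integrable M (\<lambda>\<omega>. H \<omega> * X s \<omega>)"
    using st by (auto intro!: integrable_square_product integrable_sq Hsq)
  show "integrable M (\<lambda>\<omega>. H \<omega> * (X t \<omega> - X s \<omega>))"
    using i by (simp add: right_diff_distrib)
  have "(\<integral>\<omega>. H \<omega> * X t \<omega> \<partial>M) = (\<integral>\<omega>. H \<omega> * real_cond_exp M (F s) (X t) \<omega> \<partial>M)"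
    using sa.real_cond_exp_intg(2)[OF i(1) H] by simp
  also have "\<dots> = (\<integral>\<omega>. H \<omega> * X s \<omega> \<partial>M)"
  proof (intro integral_cong_AE)
    have "AE \<omega> in M. real_cond_exp M (F s) (X t) \<omega> = X s \<omega>"
      using mart st unfolding martingale_def by auto
    then show "AE \<omega> in M. H \<omega> * real_cond_exp M (F s) (X t) \<omega> = H \<omega> * X s \<omega>"
      by eventually_elim simp
  qed auto
  finally show "(\<integral>\<omega>. H \<omega> * (X t \<omega> - X s \<omega>) \<partial>M) = 0"
    using i by (simp add: right_diff_distrib)
qed

lemma integral_incr_sq_add:
  assumes "0 \<le> r" "r \<le> s" "s \<le> t"
  shows "(\<integral>\<omega>. (X t \<omega> - X r \<omega>)\<^sup>2 \<partial>M) = (\<integral>\<omega>. (X s \<omega> - X r \<omega>)\<^sup>2 \<partial>M) + (\<integral>\<omega>. (X t \<omega> - X s \<omega>)\<^sup>2 \<partial>M)"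
proof -
  have H: "(\<lambda>\<omega>. X s \<omega> - X r \<omega>) \<in> borel_measurable (F s)"
    using assms by (intro borel_measurable_diff adapted) auto
  note o = orthogonal_incr[OF _ assms(3) H integrable_incr_sq]
  have "(\<integral>\<omega>. (X t \<omega> - X r \<omega>)\<^sup>2 \<partial>M) = (\<integral>\<omega>. (X s \<omega> - X r \<omega>)\<^sup>2 + (X t \<omega> - X s \<omega>)\<^sup>2
      + 2 * ((X s \<omega> - X r \<omega>) * (X t \<omega> - X s \<omega>)) \<partial>M)"
    by (intro Bochner_Integration.integral_cong) (auto simp: power2_eq_square algebra_simps)
  also have "\<dots> = (\<integral>\<omega>. (X s \<omega> - X r \<omega>)\<^sup>2 \<partial>M) + (\<integral>\<omega>. (X t \<omega> - X s \<omega>)\<^sup>2 \<partial>M)"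
    using assms o integrable_incr_sq by simp
  finally show ?thesis .
qed

lemma integral_incr_sq:
  assumes "0 \<le> s" "s \<le> t"
  shows "(\<integral>\<omega>. (X t \<omega> - X s \<omega>)\<^sup>2 \<partial>M) = (\<integral>\<omega>. (X t \<omega>)\<^sup>2 \<partial>M) - (\<integral>\<omega>. (X s \<omega>)\<^sup>2 \<partial>M)"
proof -
  note o = orthogonal_incr[OF assms adapted[OF assms(1) order_refl] integrable_sq[OF assms(1)]]
  have "(\<integral>\<omega>. (X t \<omega>)\<^sup>2 \<partial>M) = (\<integral>\<omega>. (X s \<omega>)\<^sup>2 + (X t \<omega> - X s \<omega>)\<^sup>2 + 2 * (X s \<omega> * (X t \<omega> - X s \<omega>)) \<partial>M)"
    by (intro Bochner_Integration.integral_cong) (auto simp: power2_eq_square algebra_simps)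
  also have "\<dots> = (\<integral>\<omega>. (X s \<omega>)\<^sup>2 \<partial>M) + (\<integral>\<omega>. (X t \<omega> - X s \<omega>)\<^sup>2 \<partial>M)"
    using assms o integrable_incr_sq integrable_sq by simp
  finally show ?thesis by simp
qed

lemma integral_sq_mono:
  assumes "0 \<le> s" "s \<le> t"
  shows "(\<integral>\<omega>. (X s \<omega>)\<^sup>2 \<partial>M) \<le> (\<integral>\<omega>. (X t \<omega>)\<^sup>2 \<partial>M)"
proof -
  have "0 \<le> (\<integral>\<omega>. (X t \<omega> - X s \<omega>)\<^sup>2 \<partial>M)" by simp
  then show ?thesis using integral_incr_sq[OF assms] by simp
qed

lemma integral_X:
  assumes "0 \<le> s" "s \<le> t" shows "(\<integral>\<omega>. X t \<omega> \<partial>M) = (\<integral>\<omega>. X s \<omega> \<partial>M)"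
  using orthogonal_incr(2)[OF assms, of "\<lambda>_. 1"] integrable_X assms by simp

lemma curr_run_dd_adapted:
  assumes g: "mono g" "0 \<le> g 0"
  shows "(\<lambda>\<omega>. curr_dd (\<lambda>k. X (g k) \<omega>) k) \<in> borel_measurable (F (g k))"
    "(\<lambda>\<omega>. run_dd (\<lambda>k. X (g k) \<omega>) k) \<in> borel_measurable (F (g k))"
proof -
  have "X (g j) \<in> borel_measurable (F (g k))" if "j \<le> k" for j
    using monoD[OF g(1), of 0 j] monoD[OF g(1) that] g(2) by (intro adapted) auto
  then show "(\<lambda>\<omega>. curr_dd (\<lambda>k. X (g k) \<omega>) k) \<in> borel_measurable (F (g k))"
    "(\<lambda>\<omega>. run_dd (\<lambda>k. X (g k) \<omega>) k) \<in> borel_measurable (F (g k))"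
    by (auto intro: measurable_curr_run_dd)
qed

lemma integrable_curr_dd_sq:
  assumes g: "mono g" "0 \<le> g 0"
  shows "integrable M (\<lambda>\<omega>. (curr_dd (\<lambda>k. X (g k) \<omega>) k)\<^sup>2)"
proof (induction k)
  case (Suc k)
  have g0: "0 \<le> g k" for k using g monoD[of g 0 k] by simp
  have [measurable]: "X (g k) \<in> borel_measurable M" for k using meas g0 by auto
  have [measurable]: "(\<lambda>\<omega>. curr_dd (\<lambda>k. X (g k) \<omega>) k) \<in> borel_measurable M" for k
    by (rule from_F[OF g0 curr_run_dd_adapted(1)[OF g]])
  have "integrable M (\<lambda>\<omega>. (curr_dd (\<lambda>k. X (g k) \<omega>) k - (X (g (Suc k)) \<omega> - X (g k) \<omega>))\<^sup>2)"
    by (rule integrable_square_diff[OF _ _ Suc integrable_incr_sq[OF g0 g0]]) measurable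
  then show ?case
    by (rule integrable_square_bound[OF from_F[OF g0 curr_run_dd_adapted(1)[OF g]]]) simp
qed simp

text \<open>In expectation the transform in the pathwise bound disappears, and by orthogonality the
  squared increments add up to the square of the total increment, whatever the grid. The slope is
  square integrable, being at most the current drawdown over \<open>e\<close>.\<close>

lemma expectation_run_dd:
  assumes e: "e > 0" and g: "mono g" "0 \<le> g 0"
  shows "integrable M (\<lambda>\<omega>. run_dd (\<lambda>k. X (g k) \<omega>) n)"
    "(\<integral>\<omega>. run_dd (\<lambda>k. X (g k) \<omega>) n \<partial>M) \<le> e + (\<integral>\<omega>. (X (g n) \<omega> - X (g 0) \<omega>)\<^sup>2 \<partial>M) / (2 * e)"
proof -
  define a where "a = (\<lambda>k \<omega>. curr_dd (\<lambda>k. X (g k) \<omega>) k)"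
  define D where "D = (\<lambda>k \<omega>. run_dd (\<lambda>k. X (g k) \<omega>) k)"
  define H where "H = (\<lambda>k \<omega>. dd_slope e (a k \<omega>) (D k \<omega>))"
  have g0: "0 \<le> g k" for k using g monoD[of g 0 k] by simp
  have gS: "g k \<le> g (Suc k)" for k using g monoD[of g k "Suc k"] by simp
  have aF: "a k \<in> borel_measurable (F (g k))" and DF: "D k \<in> borel_measurable (F (g k))" for k
    unfolding a_def D_def by (rule curr_run_dd_adapted[OF g])+
  have HF: "H k \<in> borel_measurable (F (g k))" for k
    using aF[of k] DF[of k] unfolding H_def dd_slope_def by measurable
  have aM[measurable]: "a k \<in> borel_measurable M" and DM[measurable]: "D k \<in> borel_measurable M"
    and HM[measurable]: "H k \<in> borel_measurable M" for k
    using from_F g0 aF DF HF by blast+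
  have XM[measurable]: "X (g k) \<in> borel_measurable M" for k using meas g0 by auto
  have a_sq: "integrable M (\<lambda>\<omega>. (a k \<omega>)\<^sup>2)" for k
    unfolding a_def by (rule integrable_curr_dd_sq[OF g])
  have H_sq: "integrable M (\<lambda>\<omega>. (H k \<omega>)\<^sup>2)" for k
  proof (rule integrable_square_bound)
    show "integrable M (\<lambda>\<omega>. (a k \<omega> / e)\<^sup>2)" using a_sq[of k] by (simp add: power_divide)
    fix \<omega>
    have "0 \<le> a k \<omega>" by (simp add: a_def curr_dd_nonneg)
    then show "\<bar>H k \<omega>\<bar> \<le> \<bar>a k \<omega> / e\<bar>"
      using e unfolding H_def dd_slope_def by (auto simp: divide_right_mono)
  qed simp
  note o = orthogonal_incr[OF g0 gS HF H_sq]
  define R where "R = (\<lambda>k \<omega>. (X (g (Suc k)) \<omega> - X (g k) \<omega>)\<^sup>2 / (2 * e) + H k \<omega> * (X (g (Suc k)) \<omega> - X (g k) \<omega>))"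
  have R: "integrable M (R k)"
    "(\<integral>\<omega>. R k \<omega> \<partial>M) = (\<integral>\<omega>. (X (g (Suc k)) \<omega> - X (g k) \<omega>)\<^sup>2 \<partial>M) / (2 * e)" for k
    using o[of k] integrable_incr_sq[OF g0 g0, of "Suc k" k] unfolding R_def by auto
  have sum: "(\<Sum>k<n. (\<integral>\<omega>. (X (g (Suc k)) \<omega> - X (g k) \<omega>)\<^sup>2 \<partial>M)) = (\<integral>\<omega>. (X (g n) \<omega> - X (g 0) \<omega>)\<^sup>2 \<partial>M)"
  proof (induction n)
    case (Suc n)
    then show ?case
      using integral_incr_sq_add[of "g 0" "g n" "g (Suc n)"] g gS monoD[of g 0 n] by simp
  qed simp
  have bnd: "D n \<omega> \<le> e + (\<Sum>k<n. R k \<omega>)" for \<omega>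
    using run_dd_pathwise_bound[OF e, of "\<lambda>k. X (g k) \<omega>" n] unfolding D_def R_def H_def a_def .
  have int: "integrable M (\<lambda>\<omega>. e + (\<Sum>k<n. R k \<omega>))" using R by auto
  have D0: "0 \<le> D n \<omega>" for \<omega> by (simp add: D_def run_dd_nonneg)
  have D_int: "integrable M (D n)"
  proof (rule Bochner_Integration.integrable_bound[OF int DM])
    show "AE \<omega> in M. norm (D n \<omega>) \<le> norm (e + (\<Sum>k<n. R k \<omega>))"
      using bnd D0 by (intro AE_I2) (smt (verit) real_norm_def)
  qed
  then show "integrable M (\<lambda>\<omega>. run_dd (\<lambda>k. X (g k) \<omega>) n)" by (simp add: D_def)
  have "(\<integral>\<omega>. D n \<omega> \<partial>M) \<le> (\<integral>\<omega>. e + (\<Sum>k<n. R k \<omega>) \<partial>M)"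
    using D_int bnd int by (intro integral_mono) auto
  also have "\<dots> = e + (\<Sum>k<n. (\<integral>\<omega>. (X (g (Suc k)) \<omega> - X (g k) \<omega>)\<^sup>2 \<partial>M) / (2 * e))"
    using R by (simp add: prob_space)
  also have "\<dots> = e + (\<integral>\<omega>. (X (g n) \<omega> - X (g 0) \<omega>)\<^sup>2 \<partial>M) / (2 * e)"
    unfolding sum[symmetric] by (simp add: sum_divide_distrib)
  finally show "(\<integral>\<omega>. run_dd (\<lambda>k. X (g k) \<omega>) n \<partial>M) \<le> e + (\<integral>\<omega>. (X (g n) \<omega> - X (g 0) \<omega>)\<^sup>2 \<partial>M) / (2 * e)"
    unfolding D_def .
qed

end

section \<open>Right-continuous paths sampled on grids\<close>

text \<open>With mesh \<open>1 / (N + 1)\<close> and \<open>(N + 1)^2\<close> steps the grid becomes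
  finer and longer together. Successive grids are not nested, so lower limits will replace monotone
  convergence.\<close>

definition dd_grid :: "(real \<Rightarrow> real) \<Rightarrow> real \<Rightarrow> nat \<Rightarrow> real" where
  "dd_grid x s N = run_dd (\<lambda>k. x (s + real k / real (Suc N))) ((Suc N)\<^sup>2)"

lemma dd_grid_nonneg: "0 \<le> dd_grid x s N"
  by (simp add: dd_grid_def run_dd_nonneg)

lemma dd_grid_attained: "\<exists>u v. s \<le> u \<and> u \<le> v \<and> dd_grid x s N = x u - x v"
proof -
  obtain i j where "i \<le> j" "run_dd (\<lambda>k. x (s + real k / real (Suc N))) ((Suc N)\<^sup>2)
      = x (s + real i / real (Suc N)) - x (s + real j / real (Suc N))"
    using run_dd_attained by blast
  then show ?thesis unfolding dd_grid_def
    by (intro exI[of _ "s + real i / real (Suc N)"] exI[of _ "s + real j / real (Suc N)"])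
       (auto simp: divide_right_mono)
qed

text \<open>Rounding is upwards: a right-continuous path can be approximated from the right
  only.\<close>

definition grid_index :: "real \<Rightarrow> nat \<Rightarrow> real \<Rightarrow> nat" where
  "grid_index s N u = nat \<lceil>(u - s) * real (Suc N)\<rceil>"

lemma grid_index_mono: "u \<le> v \<Longrightarrow> grid_index s N u \<le> grid_index s N v"
  unfolding grid_index_def by (intro nat_mono ceiling_mono mult_right_mono) auto

lemma grid_index_bounds:
  assumes "s \<le> u"
  shows "u \<le> s + real (grid_index s N u) / real (Suc N)"
    "s + real (grid_index s N u) / real (Suc N) \<le> u + 1 / real (Suc N)"
proof -
  have nn: "0 \<le> (u - s) * real (Suc N)" using assms by simp
  have *: "(u - s) * real (Suc N) \<le> real (grid_index s N u)" "real (grid_index s N u) \<le> (u - s) * real (Suc N) + 1"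
    unfolding grid_index_def by linarith (use nn in linarith)
  have p: "real (Suc N) > 0" by simp
  show "u \<le> s + real (grid_index s N u) / real (Suc N)"
    using *(1) pos_le_divide_eq[OF p, of "u - s" "real (grid_index s N u)"] by linarith
  have "real (grid_index s N u) / real (Suc N) \<le> ((u - s) * real (Suc N) + 1) / real (Suc N)"
    using *(2) p by (intro divide_right_mono) auto
  also have "\<dots> = (u - s) + 1 / real (Suc N)" using p by (simp add: add_divide_distrib del: of_nat_Suc)
  finally show "s + real (grid_index s N u) / real (Suc N) \<le> u + 1 / real (Suc N)" by linarith
qed

lemma grid_index_le:
  assumes "u - s \<le> real N" shows "grid_index s N u \<le> (Suc N)\<^sup>2"
proof -
  have "(u - s) * real (Suc N) \<le> real (Suc N) * real (Suc N)"
    using assms by (intro mult_right_mono) auto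
  then have "(u - s) * real (Suc N) \<le> real_of_int (int ((Suc N)\<^sup>2))"
    by (simp add: power2_eq_square algebra_simps)
  then have "\<lceil>(u - s) * real (Suc N)\<rceil> \<le> int ((Suc N)\<^sup>2)" by (simp only: ceiling_le_iff)
  then show ?thesis unfolding grid_index_def by linarith
qed

lemma right_continuous_tendsto_grid:
  fixes x :: "real \<Rightarrow> real"
  assumes rc: "continuous (at_right u) x" and "s \<le> u"
  shows "(\<lambda>N. x (s + real (grid_index s N u) / real (Suc N))) \<longlonglongrightarrow> x u"
proof -
  \<comment> \<open>A grid point may coincide with \<open>u\<close>, so continuity is needed within
    \<open>{u..}\<close>; deleting \<open>u\<close> shows that the filter is the same.\<close>
  have "{u..} - {u} = {u<..} - {u}" by auto
  then have "continuous (at u within {u..}) x"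
    using rc unfolding at_within_def by simp
  moreover have "(\<lambda>N. s + real (grid_index s N u) / real (Suc N)) \<longlonglongrightarrow> u"
  proof (rule real_tendsto_sandwich[where f = "\<lambda>_. u" and h = "\<lambda>N. u + 1 / real (Suc N)"])
    show "(\<lambda>N. u + 1 / real (Suc N)) \<longlonglongrightarrow> u"
      using tendsto_add[OF tendsto_const[of u] LIMSEQ_Suc[OF lim_1_over_n]] by simp
  qed (use grid_index_bounds[OF assms(2)] in auto)
  moreover have "s + real (grid_index s N u) / real (Suc N) \<in> {u..}" for N
    using grid_index_bounds(1)[OF assms(2)] by simp
  ultimately have "(x \<circ> (\<lambda>N. s + real (grid_index s N u) / real (Suc N))) \<longlonglongrightarrow> x u"
    unfolding continuous_within_sequentially by simp
  then show ?thesis by (simp add: comp_def)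
qed

text \<open>Rounding preserves the order of \<open>u\<close> and \<open>v\<close>, and the grid
  eventually reaches \<open>v\<close>. Truncating negative differences to zero in
  \<open>ennreal\<close> is harmless, since grid drawdowns are nonnegative.\<close>

lemma ennreal_diff_le_liminf_dd_grid:
  fixes x :: "real \<Rightarrow> real"
  assumes rc: "\<And>t. 0 \<le> t \<Longrightarrow> continuous (at_right t) x" and suv: "0 \<le> s" "s \<le> u" "u \<le> v"
  shows "ennreal (x u - x v) \<le> liminf (\<lambda>N. ennreal (dd_grid x s N))"
proof -
  let ?p = "\<lambda>N t. s + real (grid_index s N t) / real (Suc N)"
  have "(\<lambda>N. ennreal (x (?p N u) - x (?p N v))) \<longlonglongrightarrow> ennreal (x u - x v)"
    using suv by (intro tendsto_ennrealI tendsto_diff right_continuous_tendsto_grid rc) auto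
  then have "ennreal (x u - x v) = liminf (\<lambda>N. ennreal (x (?p N u) - x (?p N v)))"
    by (rule lim_imp_Liminf[OF sequentially_bot, symmetric])
  also have "\<dots> \<le> liminf (\<lambda>N. ennreal (dd_grid x s N))"
  proof (rule Liminf_mono, rule eventually_sequentiallyI)
    fix N assume "nat \<lceil>v - s\<rceil> \<le> N"
    then have "v - s \<le> real N" by linarith
    then show "ennreal (x (?p N u) - x (?p N v)) \<le> ennreal (dd_grid x s N)"
      unfolding dd_grid_def
      by (intro ennreal_leI run_dd_ge[where x = "\<lambda>k. x (s + real k / real (Suc N))"]
          grid_index_mono grid_index_le suv)
  qed
  finally show ?thesis .
qed

lemma ereal_le_enn2ereal_ennreal: "ereal r \<le> enn2ereal (ennreal r)"
proof (cases "0 \<le> r")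
  case False
  then have "ereal r \<le> 0" by simp
  then show ?thesis by (rule order_trans) (rule enn2ereal_nonneg)
qed (simp add: enn2ereal_ennreal)

text \<open>Replaces the nested suprema by ordered pairs of times; the finite value
  \<open>ereal (x t)\<close> may be moved across the inequality.\<close>

lemma max_drawdown_le_iff:
  "max_drawdown x \<le> c \<longleftrightarrow> (\<forall>s t. 0 \<le> s \<longrightarrow> s \<le> t \<longrightarrow> ereal (x s - x t) \<le> c)"
proof -
  have "(SUP s\<in>{0..t}. ereal (x s)) - ereal (x t) \<le> c \<longleftrightarrow> (\<forall>s\<in>{0..t}. ereal (x s - x t) \<le> c)" for t
    by (simp add: ereal_minus_le_iff SUP_le_iff) (simp add: ereal_minus_le_iff flip: ereal_minus(1))
  moreover have "max_drawdown x \<le> c \<longleftrightarrow> (\<forall>t\<in>{0..}. (SUP s\<in>{0..t}. ereal (x s)) - ereal (x t) \<le> c)"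
    unfolding max_drawdown_def SUP_le_iff ..
  ultimately show ?thesis by force
qed

lemma max_drawdown_ge: "0 \<le> s \<Longrightarrow> s \<le> t \<Longrightarrow> ereal (x s - x t) \<le> max_drawdown x"
  using max_drawdown_le_iff[of x "max_drawdown x"] by auto

text \<open>A countable supremum, which yields measurability.\<close>

lemma max_drawdown_eq_SUP_dd_grid:
  assumes rc: "\<And>t. 0 \<le> t \<Longrightarrow> continuous (at_right t) x"
  shows "max_drawdown x = (SUP N. ereal (dd_grid x 0 N))"
proof (rule antisym)
  show "(SUP N. ereal (dd_grid x 0 N)) \<le> max_drawdown x"
  proof (rule SUP_least)
    fix N
    obtain u v where "0 \<le> u" "u \<le> v" "dd_grid x 0 N = x u - x v" using dd_grid_attained by blast
    then show "ereal (dd_grid x 0 N) \<le> max_drawdown x" using max_drawdown_ge by metis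
  qed
  show "max_drawdown x \<le> (SUP N. ereal (dd_grid x 0 N))"
    unfolding max_drawdown_le_iff
  proof (intro allI impI)
    fix s t :: real assume st: "0 \<le> s" "s \<le> t"
    have "ennreal (x s - x t) \<le> liminf (\<lambda>N. ennreal (dd_grid x 0 N))"
      by (rule ennreal_diff_le_liminf_dd_grid[OF rc]) (use st in auto)
    also have "\<dots> \<le> (SUP N. ennreal (dd_grid x 0 N))"
      by (intro Liminf_le always_eventually allI SUP_upper) auto
    also have "\<dots> \<le> e2ennreal (SUP N. ereal (dd_grid x 0 N))"
      unfolding e2ennreal_ereal[symmetric] by (intro SUP_least e2ennreal_mono SUP_upper) auto
    finally have "enn2ereal (ennreal (x s - x t)) \<le> enn2ereal (e2ennreal (SUP N. ereal (dd_grid x 0 N)))"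
      by (simp add: less_eq_ennreal.rep_eq)
    also have "\<dots> = (SUP N. ereal (dd_grid x 0 N))"
      by (rule enn2ereal_e2ennreal, rule SUP_upper2[of 0]) (auto simp: dd_grid_nonneg)
    finally show "ereal (x s - x t) \<le> (SUP N. ereal (dd_grid x 0 N))"
      by (rule order_trans[OF ereal_le_enn2ereal_ennreal])
  qed
qed

text \<open>With a lower limit in place of the supremum, Fatou's lemma transfers the bounds on the
  individual grids.\<close>

lemma e2ennreal_max_drawdown_le:
  assumes rc: "\<And>t. 0 \<le> t \<Longrightarrow> continuous (at_right t) x"
  shows "e2ennreal (max_drawdown x) \<le> liminf (\<lambda>N. ennreal (dd_grid x 0 N))"
proof -
  have "max_drawdown x \<le> enn2ereal (liminf (\<lambda>N. ennreal (dd_grid x 0 N)))"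
    unfolding max_drawdown_le_iff
  proof (intro allI impI)
    fix s t :: real assume st: "0 \<le> s" "s \<le> t"
    have "ereal (x s - x t) \<le> enn2ereal (ennreal (x s - x t))"
      by (rule ereal_le_enn2ereal_ennreal)
    also have "\<dots> \<le> enn2ereal (liminf (\<lambda>N. ennreal (dd_grid x 0 N)))"
      unfolding less_eq_ennreal.rep_eq[symmetric]
      by (rule ennreal_diff_le_liminf_dd_grid[OF rc]) (use st in auto)
    finally show "ereal (x s - x t) \<le> enn2ereal (liminf (\<lambda>N. ennreal (dd_grid x 0 N)))" .
  qed
  from e2ennreal_mono[OF this] show ?thesis by simp
qed

context sq_martingale begin

lemma measurable_dd_grid[measurable]:
  assumes "0 \<le> s" shows "(\<lambda>\<omega>. dd_grid (\<lambda>t. X t \<omega>) s N) \<in> borel_measurable M"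
  unfolding dd_grid_def using assms by (intro measurable_curr_run_dd(2) meas) auto

lemma nn_integral_liminf_dd_grid:
  assumes e: "e > 0" and s: "0 \<le> s" and C: "\<And>t. s \<le> t \<Longrightarrow> (\<integral>\<omega>. (X t \<omega> - X s \<omega>)\<^sup>2 \<partial>M) \<le> C"
  shows "(\<integral>\<^sup>+\<omega>. liminf (\<lambda>N. ennreal (dd_grid (\<lambda>t. X t \<omega>) s N)) \<partial>M) \<le> ennreal (e + C / (2 * e))"
proof -
  have "(\<integral>\<^sup>+\<omega>. ennreal (dd_grid (\<lambda>t. X t \<omega>) s N) \<partial>M) \<le> ennreal (e + C / (2 * e))" for N
  proof -
    define g where "g = (\<lambda>k. s + real k / real (Suc N))"
    have "mono g" unfolding g_def by (intro monoI) (simp add: divide_right_mono)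
    moreover have "0 \<le> g 0" using s by (simp add: g_def)
    ultimately have *: "integrable M (\<lambda>\<omega>. run_dd (\<lambda>k. X (g k) \<omega>) ((Suc N)\<^sup>2))"
      "(\<integral>\<omega>. run_dd (\<lambda>k. X (g k) \<omega>) ((Suc N)\<^sup>2) \<partial>M)
        \<le> e + (\<integral>\<omega>. (X (g ((Suc N)\<^sup>2)) \<omega> - X (g 0) \<omega>)\<^sup>2 \<partial>M) / (2 * e)"
      using expectation_run_dd[OF e] by blast+
    have "(\<integral>\<omega>. (X (g ((Suc N)\<^sup>2)) \<omega> - X (g 0) \<omega>)\<^sup>2 \<partial>M) \<le> C"
      using C[of "g ((Suc N)\<^sup>2)"] by (simp add: g_def)
    then have "(\<integral>\<omega>. (X (g ((Suc N)\<^sup>2)) \<omega> - X (g 0) \<omega>)\<^sup>2 \<partial>M) / (2 * e) \<le> C / (2 * e)"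
      using e by (intro divide_right_mono) auto
    then have "(\<integral>\<omega>. run_dd (\<lambda>k. X (g k) \<omega>) ((Suc N)\<^sup>2) \<partial>M) \<le> e + C / (2 * e)"
      using *(2) by linarith
    then show ?thesis unfolding dd_grid_def g_def[symmetric]
      using *(1) by (subst nn_integral_eq_integral) (auto simp: run_dd_nonneg ennreal_leI g_def)
  qed
  then have "liminf (\<lambda>N. \<integral>\<^sup>+\<omega>. ennreal (dd_grid (\<lambda>t. X t \<omega>) s N) \<partial>M) \<le> liminf (\<lambda>N. ennreal (e + C / (2 * e)))"
    by (intro Liminf_mono always_eventually) auto
  also have "\<dots> = ennreal (e + C / (2 * e))" by (simp add: Liminf_const)
  finally show ?thesis
    using s by (intro order_trans[OF nn_integral_liminf]) (auto)
qed

end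

section \<open>Convergence of \<open>L\<^sub>2\<close>-bounded martingales\<close>

lemma (in sq_martingale) sq_martingale_uminus: "sq_martingale M F (\<lambda>t \<omega>. - X t \<omega>)"
proof unfold_locales
  show "martingale M F (\<lambda>t \<omega>. - X t \<omega>)"
    unfolding martingale_def
  proof (intro conjI allI impI)
    fix s t :: real assume st: "0 \<le> s \<and> s \<le> t"
    interpret sa: finite_measure_subalgebra M "F s"
      by unfold_locales (use subalg st in auto)
    have "AE \<omega> in M. real_cond_exp M (F s) (X t) \<omega> = X s \<omega>"
      using mart st unfolding martingale_def by auto
    moreover have "AE \<omega> in M. real_cond_exp M (F s) (\<lambda>\<omega>. -1 * X t \<omega>) \<omega> = -1 * real_cond_exp M (F s) (X t) \<omega>"
      by (rule sa.real_cond_exp_cmult) (use integrable_X st in auto)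
    ultimately show "AE \<omega> in M. real_cond_exp M (F s) (\<lambda>\<omega>. - X t \<omega>) \<omega> = - X s \<omega>"
      by eventually_elim simp
  qed (use mart in \<open>auto simp: martingale_def\<close>)
qed (use integrable_sq in simp)

text \<open>Grid drawdowns of \<open>x\<close> and of \<open>- x\<close> control downward and upward
  moves after time \<open>n\<close>. Lower limits over grids keep the quantity measurable and
  accessible to Fatou.\<close>

definition tail_osc :: "(real \<Rightarrow> real) \<Rightarrow> nat \<Rightarrow> ennreal" where
  "tail_osc x n = liminf (\<lambda>N. ennreal (dd_grid x (real n) N)) + liminf (\<lambda>N. ennreal (dd_grid (\<lambda>t. - x t) (real n) N))"

lemma tail_osc_ge:
  assumes rc: "\<And>t. 0 \<le> t \<Longrightarrow> continuous (at_right t) x" and uv: "real n \<le> u" "real n \<le> v"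
  shows "ennreal \<bar>x u - x v\<bar> \<le> tail_osc x n"
proof -
  have rc': "continuous (at_right t) (\<lambda>t. - x t)" if "0 \<le> t" for t
    using rc[OF that] by (intro continuous_minus)
  have *: "ennreal (x p - x q) \<le> tail_osc x n" "ennreal (x q - x p) \<le> tail_osc x n"
    if "real n \<le> p" "p \<le> q" for p q
  proof -
    have "ennreal (x p - x q) \<le> liminf (\<lambda>N. ennreal (dd_grid x (real n) N))"
      by (rule ennreal_diff_le_liminf_dd_grid[OF rc]) (use that in auto)
    then show "ennreal (x p - x q) \<le> tail_osc x n"
      unfolding tail_osc_def by (rule order_trans) simp
    have "ennreal (- x p - - x q) \<le> liminf (\<lambda>N. ennreal (dd_grid (\<lambda>t. - x t) (real n) N))"
      by (rule ennreal_diff_le_liminf_dd_grid[OF rc']) (use that in auto)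
    then have "ennreal (x q - x p) \<le> liminf (\<lambda>N. ennreal (dd_grid (\<lambda>t. - x t) (real n) N))"
      by simp
    then show "ennreal (x q - x p) \<le> tail_osc x n"
      unfolding tail_osc_def by (rule order_trans) simp
  qed
  have "ennreal (x u - x v) \<le> tail_osc x n" "ennreal (x v - x u) \<le> tail_osc x n"
    using *[of u v] *[of v u] uv by (cases "u \<le> v"; simp)+
  then show ?thesis by (cases "x v \<le> x u") auto
qed

lemma dd_grid_le:
  assumes "\<And>u. s \<le> u \<Longrightarrow> \<bar>x u - l\<bar> \<le> e"
  shows "dd_grid x s N \<le> 2 * e" "dd_grid (\<lambda>t. - x t) s N \<le> 2 * e"
proof -
  obtain u v where "s \<le> u" "u \<le> v" "dd_grid x s N = x u - x v"
    using dd_grid_attained by blast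
  then show "dd_grid x s N \<le> 2 * e" using assms[of u] assms[of v] by linarith
  obtain u v where "s \<le> u" "u \<le> v" "dd_grid (\<lambda>t. - x t) s N = - x u - - x v"
    using dd_grid_attained[of s "\<lambda>t. - x t" N] by blast
  then show "dd_grid (\<lambda>t. - x t) s N \<le> 2 * e" using assms[of u] assms[of v] by linarith
qed

text \<open>Both directions are needed: one produces the limit, the other recognizes divergent paths
  by a measurable quantity, so that the last term is measurable on them too.\<close>

lemma convergent_iff_tail_osc:
  assumes rc: "\<And>t. 0 \<le> t \<Longrightarrow> continuous (at_right t) x"
  shows "(INF n. tail_osc x n) = 0 \<longleftrightarrow> (\<exists>l. (x \<longlongrightarrow> l) at_top)"
proof
  assume 0: "(INF n. tail_osc x n) = 0"
  have ev: "\<exists>n. \<forall>u v. real n \<le> u \<longrightarrow> real n \<le> v \<longrightarrow> \<bar>x u - x v\<bar> < e" if "0 < e" for e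
  proof -
    have "(INF n. tail_osc x n) < ennreal e" using that 0 by simp
    then obtain n where "tail_osc x n < ennreal e" unfolding INF_less_iff by auto
    then have "ennreal \<bar>x u - x v\<bar> < ennreal e" if "real n \<le> u" "real n \<le> v" for u v
      using tail_osc_ge[OF rc that] by (simp add: order.strict_trans1)
    then show ?thesis using that by (auto simp: ennreal_less_iff)
  qed
  have "Cauchy (\<lambda>n. x (real n))"
  proof (rule metric_CauchyI)
    fix e :: real assume "0 < e"
    from ev[OF this] obtain n where "\<forall>u v. real n \<le> u \<longrightarrow> real n \<le> v \<longrightarrow> \<bar>x u - x v\<bar> < e" by blast
    then show "\<exists>M. \<forall>m\<ge>M. \<forall>n\<ge>M. dist (x (real m)) (x (real n)) < e"
      by (intro exI[of _ n]) (simp add: dist_real_def)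
  qed
  then obtain l where l: "(\<lambda>n. x (real n)) \<longlonglongrightarrow> l" by (auto simp: Cauchy_convergent_iff convergent_def)
  have "(x \<longlongrightarrow> l) at_top"
  proof (rule tendstoI)
    fix e :: real assume "0 < e"
    then have "0 < e / 2" by simp
    from ev[OF this] obtain n where n: "\<forall>u v. real n \<le> u \<longrightarrow> real n \<le> v \<longrightarrow> \<bar>x u - x v\<bar> < e / 2" by blast
    have "\<forall>\<^sub>F k in sequentially. dist (x (real k)) l < e / 2 \<and> n \<le> k"
      using tendstoD[OF l \<open>0 < e / 2\<close>] eventually_ge_at_top by (rule eventually_conj)
    then obtain k where k: "dist (x (real k)) l < e / 2" "n \<le> k"
      using eventually_happens'[OF sequentially_bot] by blast
    show "\<forall>\<^sub>F t in at_top. dist (x t) l < e"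
    proof (rule eventually_at_top_linorderI[of "real n"])
      fix t assume "real n \<le> t"
      then have "\<bar>x t - x (real k)\<bar> < e / 2" using n k(2) by auto
      then show "dist (x t) l < e" using k(1) unfolding dist_real_def by linarith
    qed
  qed
  then show "\<exists>l. (x \<longlongrightarrow> l) at_top" by blast
next
  assume "\<exists>l. (x \<longlongrightarrow> l) at_top"
  then obtain l where l: "(x \<longlongrightarrow> l) at_top" by blast
  have "(INF n. tail_osc x n) \<le> 0 + ennreal e" if "0 < e" for e
  proof -
    have "\<forall>\<^sub>F t in at_top. dist (x t) l < e / 4" using tendstoD[OF l, of "e / 4"] that by simp
    then obtain T where "\<forall>t\<ge>T. dist (x t) l < e / 4" unfolding eventually_at_top_linorder by blast
    moreover obtain n where "T \<le> real n" using real_arch_simple by blast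
    ultimately have n: "\<And>t. real n \<le> t \<Longrightarrow> \<bar>x t - l\<bar> \<le> e / 4"
      by (force simp: dist_real_def intro: less_imp_le)
    have "tail_osc x n \<le> ennreal (2 * (e / 4)) + ennreal (2 * (e / 4))"
      unfolding tail_osc_def
      by (intro add_mono Liminf_le always_eventually allI ennreal_leI dd_grid_le[OF n]) auto
    also have "\<dots> = ennreal e" using that by (simp flip: ennreal_plus)
    finally show ?thesis by (simp add: INF_lower2)
  qed
  then have "(INF n. tail_osc x n) \<le> 0"
    by - (rule ennreal_le_epsilon, blast)
  then show "(INF n. tail_osc x n) = 0" by simp
qed

locale L2_martingale = prob_space M for M :: "'a measure" +
  fixes F :: "real \<Rightarrow> 'a measure" and X :: "real \<Rightarrow> 'a \<Rightarrow> real"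
  assumes mart: "martingale M F X"
    and rc: "right_continuous_paths M X"
    and L2: "L2_bounded M X"
begin

lemma meas0: "0 \<le> t \<Longrightarrow> X t \<in> borel_measurable M"
  using mart unfolding martingale_def by (auto intro: borel_measurable_integrable)

lemma bounded_sq:
  "\<exists>K. \<forall>t\<ge>0. integrable M (\<lambda>\<omega>. (X t \<omega>)\<^sup>2) \<and> (\<integral>\<omega>. (X t \<omega>)\<^sup>2 \<partial>M) \<le> K"
proof -
  let ?S = "SUP t\<in>{0..}. \<integral>\<^sup>+ \<omega>. ennreal ((X t \<omega>)\<^sup>2) \<partial>M"
  obtain K where K: "?S = ennreal K" "0 \<le> K"
    using L2 unfolding L2_bounded_def by (cases ?S) auto
  have le: "(\<integral>\<^sup>+ \<omega>. ennreal ((X t \<omega>)\<^sup>2) \<partial>M) \<le> ennreal K" if "0 \<le> t" for t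
    unfolding K(1)[symmetric] by (intro SUP_upper) (use that in auto)
  have i: "integrable M (\<lambda>\<omega>. (X t \<omega>)\<^sup>2)" if t: "0 \<le> t" for t
    using meas0[OF t] le[OF t] by (intro integrableI_bounded) (auto simp: order.strict_trans1)
  have "(\<integral>\<omega>. (X t \<omega>)\<^sup>2 \<partial>M) \<le> K" if "0 \<le> t" for t
    using le[OF that] K(2) i[OF that] by (simp add: nn_integral_eq_integral)
  with i show ?thesis by blast
qed

sublocale sq_martingale M F X
proof unfold_locales
  show "integrable M (\<lambda>\<omega>. (X t \<omega>)\<^sup>2)" if "0 \<le> t" for t
    using bounded_sq that by blast
qed (rule mart)

lemma path_right_continuous: "\<omega> \<in> space M \<Longrightarrow> 0 \<le> t \<Longrightarrow> continuous (at_right t) (\<lambda>t. X t \<omega>)"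
  using rc unfolding right_continuous_paths_def by auto

text \<open>Second moments increase to a finite supremum, and by orthogonality the second moment of
  an increment is their difference.\<close>

lemma small_tail_incr:
  assumes "0 < \<delta>"
  obtains n where "\<And>t. real n \<le> t \<Longrightarrow> (\<integral>\<omega>. (X t \<omega> - X (real n) \<omega>)\<^sup>2 \<partial>M) \<le> \<delta>"
proof -
  obtain K where K: "\<And>t. 0 \<le> t \<Longrightarrow> (\<integral>\<omega>. (X t \<omega>)\<^sup>2 \<partial>M) \<le> K" using bounded_sq by blast
  define L where "L = (SUP t\<in>{0..}. (\<integral>\<omega>. (X t \<omega>)\<^sup>2 \<partial>M))"
  have bdd: "bdd_above ((\<lambda>t. \<integral>\<omega>. (X t \<omega>)\<^sup>2 \<partial>M) ` {0..})" using K by (intro bdd_aboveI[of _ K]) auto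
  obtain t0 where t0: "0 \<le> t0" "L - \<delta> < (\<integral>\<omega>. (X t0 \<omega>)\<^sup>2 \<partial>M)"
    using less_cSUP_iff[OF _ bdd, of "L - \<delta>"] assms unfolding L_def[symmetric] by auto
  obtain n where n: "t0 \<le> real n" using real_arch_simple by blast
  have "(\<integral>\<omega>. (X t \<omega> - X (real n) \<omega>)\<^sup>2 \<partial>M) \<le> \<delta>" if t: "real n \<le> t" for t
  proof -
    have "(\<integral>\<omega>. (X t \<omega>)\<^sup>2 \<partial>M) \<le> L" unfolding L_def by (intro cSUP_upper[OF _ bdd]) (use t in auto)
    moreover have "(\<integral>\<omega>. (X t0 \<omega>)\<^sup>2 \<partial>M) \<le> (\<integral>\<omega>. (X (real n) \<omega>)\<^sup>2 \<partial>M)"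
      using integral_sq_mono t0 n by blast
    ultimately show ?thesis using integral_incr_sq[OF _ t] t0 by auto
  qed
  then show ?thesis using that by blast
qed

section \<open>Almost sure convergence and measurability of the last term\<close>

definition osc where "osc \<omega> = (INF n. tail_osc (\<lambda>t. X t \<omega>) n)"

lemma measurable_tail_osc[measurable]: "(\<lambda>\<omega>. tail_osc (\<lambda>t. X t \<omega>) n) \<in> borel_measurable M"
proof -
  interpret neg: sq_martingale M F "\<lambda>t \<omega>. - X t \<omega>" by (rule sq_martingale_uminus)
  show ?thesis unfolding tail_osc_def
    by (intro borel_measurable_add borel_measurable_liminf measurable_compose[OF _ measurable_ennreal]
        measurable_dd_grid neg.measurable_dd_grid) auto
qed

lemma measurable_osc[measurable]: "osc \<in> borel_measurable M"
  unfolding osc_def by measurable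

lemma AE_osc: "AE \<omega> in M. osc \<omega> = 0"
proof -
  interpret neg: sq_martingale M F "\<lambda>t \<omega>. - X t \<omega>" by (rule sq_martingale_uminus)
  have "(\<integral>\<^sup>+\<omega>. osc \<omega> \<partial>M) \<le> 0 + ennreal \<epsilon>" if "0 < \<epsilon>" for \<epsilon>
  proof -
    \<comment> \<open>A tail second moment of at most \<open>2 * e^2\<close> turns the drawdown
      bound into \<open>e + e\<close>, so \<open>X\<close> and \<open>- X\<close> contribute half of
      \<open>\<epsilon>\<close> each.\<close>
    define e where "e = \<epsilon> / 4"
    have e: "0 < e" "0 < 2 * e\<^sup>2" using that by (auto simp: e_def)
    obtain n where n: "\<And>t. real n \<le> t \<Longrightarrow> (\<integral>\<omega>. (X t \<omega> - X (real n) \<omega>)\<^sup>2 \<partial>M) \<le> 2 * e\<^sup>2"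
      using small_tail_incr[OF e(2)] by blast
    have n': "(\<integral>\<omega>. (- X t \<omega> - - X (real n) \<omega>)\<^sup>2 \<partial>M) \<le> 2 * e\<^sup>2" if "real n \<le> t" for t
      using n[OF that] by (simp add: power2_commute)
    have c: "e + 2 * e\<^sup>2 / (2 * e) = \<epsilon> / 2" using e by (simp add: e_def power2_eq_square)
    have "(\<integral>\<^sup>+\<omega>. osc \<omega> \<partial>M) \<le> (\<integral>\<^sup>+\<omega>. tail_osc (\<lambda>t. X t \<omega>) n \<partial>M)"
      unfolding osc_def by (intro nn_integral_mono INF_lower) simp
    also have "\<dots> = (\<integral>\<^sup>+\<omega>. liminf (\<lambda>N. ennreal (dd_grid (\<lambda>t. X t \<omega>) (real n) N)) \<partial>M)
        + (\<integral>\<^sup>+\<omega>. liminf (\<lambda>N. ennreal (dd_grid (\<lambda>t. - X t \<omega>) (real n) N)) \<partial>M)"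
      unfolding tail_osc_def
      by (intro nn_integral_add borel_measurable_liminf measurable_compose[OF _ measurable_ennreal]
        measurable_dd_grid neg.measurable_dd_grid) auto
    also have "\<dots> \<le> ennreal (\<epsilon> / 2) + ennreal (\<epsilon> / 2)"
      unfolding c[symmetric]
      by (intro add_mono nn_integral_liminf_dd_grid neg.nn_integral_liminf_dd_grid e n n') auto
    also have "\<dots> = ennreal \<epsilon>" using that by (simp flip: ennreal_plus)
    finally show ?thesis by simp
  qed
  then have "(\<integral>\<^sup>+\<omega>. osc \<omega> \<partial>M) \<le> 0" by - (rule ennreal_le_epsilon, blast)
  then show ?thesis using nn_integral_0_iff_AE[OF measurable_osc] by simp
qed

lemma tendsto_last_term:
  assumes "\<omega> \<in> space M" "osc \<omega> = 0"
  shows "((\<lambda>t. X t \<omega>) \<longlongrightarrow> last_term X \<omega>) at_top"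
proof -
  obtain l where "((\<lambda>t. X t \<omega>) \<longlongrightarrow> l) at_top"
    using convergent_iff_tail_osc[OF path_right_continuous[OF assms(1)]] assms(2) unfolding osc_def by blast
  then show ?thesis unfolding last_term_def using tendsto_Lim[OF trivial_limit_at_top_linorder] by metis
qed

lemma AE_tendsto_last_term: "AE \<omega> in M. ((\<lambda>t. X t \<omega>) \<longlongrightarrow> last_term X \<omega>) at_top"
  using AE_osc AE_space by eventually_elim (rule tendsto_last_term)

lemma AE_LIMSEQ_last_term: "AE \<omega> in M. (\<lambda>n. X (real n) \<omega>) \<longlonglongrightarrow> last_term X \<omega>"
  using AE_tendsto_last_term
  by eventually_elim (rule filterlim_compose[OF _ filterlim_real_sequentially])

text \<open>
  \<open>Lim\<close> takes one and the same junk value on all divergent paths, so \<open>last_term X\<close> is measurable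
  everywhere and not only up to a null set.
\<close>

lemma measurable_last_term[measurable]: "last_term X \<in> borel_measurable M"
proof -
  define c :: real where "c = (THE l. False)"
  have "last_term X \<omega> = lim (\<lambda>n. if osc \<omega> = 0 then X (real n) \<omega> else c)" if "\<omega> \<in> space M" for \<omega>
  proof (cases "osc \<omega> = 0")
    case True
    have "(\<lambda>n. X (real n) \<omega>) \<longlonglongrightarrow> last_term X \<omega>"
      by (rule filterlim_compose[OF tendsto_last_term[OF that True] filterlim_real_sequentially])
    then show ?thesis using True by (simp add: limI)
  next
    case False
    then have "\<not> (\<exists>l. ((\<lambda>t. X t \<omega>) \<longlongrightarrow> l) at_top)"
      using convergent_iff_tail_osc[OF path_right_continuous[OF that]] unfolding osc_def by blast
    then show ?thesis using False by (simp add: last_term_def Topological_Spaces.Lim_def c_def lim_def tendsto_const_iff)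
  qed
  moreover have "(\<lambda>\<omega>. lim (\<lambda>n. if osc \<omega> = 0 then X (real n) \<omega> else c)) \<in> borel_measurable M"
  proof -
    have [measurable]: "X (real n) \<in> borel_measurable M" for n by (rule meas) simp
    show ?thesis by (intro borel_measurable_lim_metric) measurable
  qed
  ultimately show ?thesis by (subst measurable_cong)
qed

section \<open>Moments of the last term\<close>

text \<open>Fatou along integer times carries the uniform bound on increments after \<open>n\<close>
  over to the limit.\<close>

lemma last_term_L2:
  assumes n: "\<And>t. real n \<le> t \<Longrightarrow> (\<integral>\<omega>. (X t \<omega> - X (real n) \<omega>)\<^sup>2 \<partial>M) \<le> \<delta>" and \<delta>: "0 \<le> \<delta>"
  shows "integrable M (\<lambda>\<omega>. (last_term X \<omega> - X (real n) \<omega>)\<^sup>2)"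
    "(\<integral>\<omega>. (last_term X \<omega> - X (real n) \<omega>)\<^sup>2 \<partial>M) \<le> \<delta>"
    "integrable M (\<lambda>\<omega>. (last_term X \<omega>)\<^sup>2)"
proof -
  have [measurable]: "X (real k) \<in> borel_measurable M" for k by (rule meas) simp
  have "(\<integral>\<^sup>+\<omega>. ennreal ((last_term X \<omega> - X (real n) \<omega>)\<^sup>2) \<partial>M)
     = (\<integral>\<^sup>+\<omega>. liminf (\<lambda>m. ennreal ((X (real m) \<omega> - X (real n) \<omega>)\<^sup>2)) \<partial>M)"
  proof (rule nn_integral_cong_AE)
    show "AE \<omega> in M. ennreal ((last_term X \<omega> - X (real n) \<omega>)\<^sup>2)
        = liminf (\<lambda>m. ennreal ((X (real m) \<omega> - X (real n) \<omega>)\<^sup>2))"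
      using AE_LIMSEQ_last_term
    proof eventually_elim
      case (elim \<omega>)
      then have "(\<lambda>m. ennreal ((X (real m) \<omega> - X (real n) \<omega>)\<^sup>2)) \<longlonglongrightarrow> ennreal ((last_term X \<omega> - X (real n) \<omega>)\<^sup>2)"
        by (intro tendsto_ennrealI tendsto_power tendsto_diff tendsto_const)
      then show ?case by (rule lim_imp_Liminf[OF sequentially_bot, symmetric])
    qed
  qed
  also have "\<dots> \<le> liminf (\<lambda>m. \<integral>\<^sup>+\<omega>. ennreal ((X (real m) \<omega> - X (real n) \<omega>)\<^sup>2) \<partial>M)"
    by (intro nn_integral_liminf) measurable
  also have "\<dots> \<le> ennreal \<delta>"
  proof (rule Liminf_le[OF sequentially_bot], rule eventually_sequentiallyI)
    fix m assume "n \<le> m"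
    then show "(\<integral>\<^sup>+\<omega>. ennreal ((X (real m) \<omega> - X (real n) \<omega>)\<^sup>2) \<partial>M) \<le> ennreal \<delta>"
      using n[of "real m"] integrable_incr_sq[of "real n" "real m"]
      by (subst nn_integral_eq_integral) (auto intro: ennreal_leI)
  qed
  finally have *: "(\<integral>\<^sup>+\<omega>. ennreal ((last_term X \<omega> - X (real n) \<omega>)\<^sup>2) \<partial>M) \<le> ennreal \<delta>" .
  then show i: "integrable M (\<lambda>\<omega>. (last_term X \<omega> - X (real n) \<omega>)\<^sup>2)"
    by (intro integrableI_bounded) (auto simp: order.strict_trans1)
  then show "(\<integral>\<omega>. (last_term X \<omega> - X (real n) \<omega>)\<^sup>2 \<partial>M) \<le> \<delta>"
    using * \<delta> by (simp add: nn_integral_eq_integral)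
  have "integrable M (\<lambda>\<omega>. (last_term X \<omega> - X (real n) \<omega> + X (real n) \<omega>)\<^sup>2)"
    by (intro integrable_square_sum i integrable_sq) auto
  then show "integrable M (\<lambda>\<omega>. (last_term X \<omega>)\<^sup>2)" by simp
qed

lemma integrable_last_term_sq: "integrable M (\<lambda>\<omega>. (last_term X \<omega>)\<^sup>2)"
  using small_tail_incr[of 1] last_term_L2(3)[of _ 1] by (metis zero_less_one zero_le_one)

lemma integrable_last_term: "integrable M (last_term X)"
  by (rule square_integrable_imp_integrable[OF measurable_last_term integrable_last_term_sq])

text \<open>The squared mean of \<open>last_term X - X n\<close> is at most its second moment, which
  is small for large \<open>n\<close>, while \<open>X n\<close> and \<open>X 0\<close> have equal
  means.\<close>

lemma expectation_last_term: "expectation (last_term X) = expectation (X 0)"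
proof -
  have "(expectation (last_term X) - expectation (X 0))\<^sup>2 \<le> 0"
  proof (rule field_le_epsilon)
    fix \<delta> :: real assume \<delta>: "0 < \<delta>"
    obtain n where n: "\<And>t. real n \<le> t \<Longrightarrow> (\<integral>\<omega>. (X t \<omega> - X (real n) \<omega>)\<^sup>2 \<partial>M) \<le> \<delta>"
      using small_tail_incr[OF \<delta>] by blast
    note L = last_term_L2[OF n less_imp_le[OF \<delta>]]
    have iY: "integrable M (\<lambda>\<omega>. last_term X \<omega> - X (real n) \<omega>)"
      using integrable_last_term integrable_X by simp
    have "0 \<le> variance (\<lambda>\<omega>. last_term X \<omega> - X (real n) \<omega>)" by simp
    then have "(expectation (\<lambda>\<omega>. last_term X \<omega> - X (real n) \<omega>))\<^sup>2 \<le> \<delta>"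
      using L(2) by (simp add: variance_eq[OF iY L(1)])
    moreover have "expectation (\<lambda>\<omega>. last_term X \<omega> - X (real n) \<omega>) = expectation (last_term X) - expectation (X 0)"
      using integral_X[of 0 "real n"] integrable_last_term integrable_X by simp
    ultimately show "(expectation (last_term X) - expectation (X 0))\<^sup>2 \<le> 0 + \<delta>" by simp
  qed
  then show ?thesis by simp
qed

text \<open>Fatou would give the opposite inequality, so the \<open>L2\<close> convergence is used
  through Young's inequality with weight \<open>\<eta>\<close>. A tail of size
  \<open>\<eta>^2\<close> leaves the remainder
  \<open>(1 + 1 / \<eta>) * \<eta>^2 = \<eta>^2 + \<eta>\<close>, which vanishes.\<close>

lemma integral_sq_le_last_term:
  assumes t: "0 \<le> t"
  shows "(\<integral>\<omega>. (X t \<omega>)\<^sup>2 \<partial>M) \<le> (\<integral>\<omega>. (last_term X \<omega>)\<^sup>2 \<partial>M)"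
proof -
  have bnd: "(\<integral>\<omega>. (X t \<omega>)\<^sup>2 \<partial>M) \<le> (1 + \<eta>) * (\<integral>\<omega>. (last_term X \<omega>)\<^sup>2 \<partial>M) + (1 + 1 / \<eta>) * \<eta>\<^sup>2"
    if \<eta>: "0 < \<eta>" for \<eta>
  proof -
    have \<eta>2: "0 < \<eta>\<^sup>2" using \<eta> by simp
    obtain n where n: "\<And>t. real n \<le> t \<Longrightarrow> (\<integral>\<omega>. (X t \<omega> - X (real n) \<omega>)\<^sup>2 \<partial>M) \<le> \<eta>\<^sup>2"
      using small_tail_incr[OF \<eta>2] by blast
    \<comment> \<open>Beyond \<open>t\<close>, for the monotonicity of second moments, and beyond
      \<open>n\<close>, for the tail bound.\<close>
    obtain m where m: "max t (real n) \<le> real m" using real_arch_simple by blast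
    have m': "(\<integral>\<omega>. (X u \<omega> - X (real m) \<omega>)\<^sup>2 \<partial>M) \<le> \<eta>\<^sup>2" if "real m \<le> u" for u
    proof -
      have "0 \<le> (\<integral>\<omega>. (X (real m) \<omega> - X (real n) \<omega>)\<^sup>2 \<partial>M)" by simp
      moreover have "(\<integral>\<omega>. (X u \<omega> - X (real n) \<omega>)\<^sup>2 \<partial>M) \<le> \<eta>\<^sup>2" using n[of u] m that by simp
      moreover have "(\<integral>\<omega>. (X u \<omega> - X (real n) \<omega>)\<^sup>2 \<partial>M) = (\<integral>\<omega>. (X (real m) \<omega> - X (real n) \<omega>)\<^sup>2 \<partial>M)
          + (\<integral>\<omega>. (X u \<omega> - X (real m) \<omega>)\<^sup>2 \<partial>M)"
        by (rule integral_incr_sq_add) (use m that in auto)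
      ultimately show ?thesis by linarith
    qed
    note L = last_term_L2[OF m' less_imp_le[OF \<eta>2]]
    have pt: "(a::real)\<^sup>2 \<le> (1 + \<eta>) * b\<^sup>2 + (1 + 1 / \<eta>) * (b - a)\<^sup>2" for a b
    proof -
      have "0 \<le> (\<eta> * b + (b - a))\<^sup>2 / \<eta>" using \<eta> by simp
      also have "\<dots> = (1 + \<eta>) * b\<^sup>2 + (1 + 1 / \<eta>) * (b - a)\<^sup>2 - a\<^sup>2"
        using \<eta> by (simp add: field_simps power2_eq_square)
      finally show ?thesis by simp
    qed
    have "(\<integral>\<omega>. (X t \<omega>)\<^sup>2 \<partial>M) \<le> (\<integral>\<omega>. (X (real m) \<omega>)\<^sup>2 \<partial>M)"
      using integral_sq_mono t m by auto
    also have "\<dots> \<le> (\<integral>\<omega>. (1 + \<eta>) * (last_term X \<omega>)\<^sup>2 + (1 + 1 / \<eta>) * (last_term X \<omega> - X (real m) \<omega>)\<^sup>2 \<partial>M)"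
      using L integrable_sq pt by (intro integral_mono) auto
    also have "\<dots> = (1 + \<eta>) * (\<integral>\<omega>. (last_term X \<omega>)\<^sup>2 \<partial>M) + (1 + 1 / \<eta>) * (\<integral>\<omega>. (last_term X \<omega> - X (real m) \<omega>)\<^sup>2 \<partial>M)"
      using L by simp
    also have "\<dots> \<le> (1 + \<eta>) * (\<integral>\<omega>. (last_term X \<omega>)\<^sup>2 \<partial>M) + (1 + 1 / \<eta>) * \<eta>\<^sup>2"
      using L(2) \<eta> by (intro add_left_mono mult_left_mono) auto
    finally show ?thesis .
  qed
  let ?V = "\<integral>\<omega>. (last_term X \<omega>)\<^sup>2 \<partial>M"
  have "((\<lambda>\<eta>. (1 + \<eta>) * ?V + (\<eta>\<^sup>2 + \<eta>)) \<longlongrightarrow> (1 + 0) * ?V + (0\<^sup>2 + 0)) (at_right 0)"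
    by (intro tendsto_intros)
  moreover have "\<forall>\<^sub>F \<eta> in at_right 0. (\<integral>\<omega>. (X t \<omega>)\<^sup>2 \<partial>M) \<le> (1 + \<eta>) * ?V + (\<eta>\<^sup>2 + \<eta>)"
  proof (rule eventually_at_rightI[of 0 1])
    fix \<eta> :: real assume "\<eta> \<in> {0<..<1}"
    then have "0 < \<eta>" by simp
    from bnd[OF this] \<open>0 < \<eta>\<close> show "(\<integral>\<omega>. (X t \<omega>)\<^sup>2 \<partial>M) \<le> (1 + \<eta>) * ?V + (\<eta>\<^sup>2 + \<eta>)"
      by (simp add: power2_eq_square algebra_simps)
  qed simp
  ultimately have "(\<integral>\<omega>. (X t \<omega>)\<^sup>2 \<partial>M) \<le> (1 + 0) * ?V + (0\<^sup>2 + 0)"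
    by (rule tendsto_lowerbound) simp
  then show ?thesis by simp
qed

text \<open>The left side is the difference of the second moments of \<open>X t\<close> and
  \<open>X 0\<close>. For the subtracted one, the second moment of \<open>X 0\<close> is at least
  the square of its mean, which is also the mean of the last term.\<close>

lemma incr_sq_le_variance:
  assumes t: "0 \<le> t"
  shows "(\<integral>\<omega>. (X t \<omega> - X 0 \<omega>)\<^sup>2 \<partial>M) \<le> variance (last_term X)"
proof -
  have "0 \<le> variance (X 0)" by simp
  then have "(expectation (X 0))\<^sup>2 \<le> (\<integral>\<omega>. (X 0 \<omega>)\<^sup>2 \<partial>M)"
    using integrable_X[of 0] integrable_sq[of 0] by (simp add: variance_eq)
  moreover have "variance (last_term X) = (\<integral>\<omega>. (last_term X \<omega>)\<^sup>2 \<partial>M) - (expectation (X 0))\<^sup>2"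
    using variance_eq[OF integrable_last_term integrable_last_term_sq] by (simp add: expectation_last_term)
  ultimately show ?thesis
    using integral_incr_sq[OF order_refl t] integral_sq_le_last_term[OF t] by simp
qed

lemma max_drawdown_measurable:
  "(\<lambda>\<omega>. max_drawdown (\<lambda>t. X t \<omega>)) \<in> borel_measurable M"
proof -
  have "(\<lambda>\<omega>. SUP N. ereal (dd_grid (\<lambda>t. X t \<omega>) 0 N)) \<in> borel_measurable M"
    by (intro borel_measurable_SUP borel_measurable_ereal measurable_dd_grid) auto
  then show ?thesis
    using max_drawdown_eq_SUP_dd_grid[OF path_right_continuous] by (subst measurable_cong)
qed

lemma expectation_max_drawdown_le:
  "(\<integral>\<^sup>+ \<omega>. e2ennreal (max_drawdown (\<lambda>t. X t \<omega>)) \<partial>M)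
    \<le> ennreal (sqrt 2 * sqrt (variance (last_term X)))"
proof -
  let ?V = "variance (last_term X)"
  let ?I = "\<integral>\<^sup>+ \<omega>. e2ennreal (max_drawdown (\<lambda>t. X t \<omega>)) \<partial>M"
  have V: "0 \<le> ?V" by simp
  have bnd: "?I \<le> ennreal (e + ?V / (2 * e))" if e: "0 < e" for e
  proof -
    have "?I \<le> (\<integral>\<^sup>+\<omega>. liminf (\<lambda>N. ennreal (dd_grid (\<lambda>t. X t \<omega>) 0 N)) \<partial>M)"
      by (intro nn_integral_mono e2ennreal_max_drawdown_le path_right_continuous) auto
    also have "\<dots> \<le> ennreal (e + ?V / (2 * e))"
      by (rule nn_integral_liminf_dd_grid[OF e order_refl incr_sq_le_variance])
    finally show ?thesis .
  qed
  show ?thesis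
  \<comment> \<open>For variance zero the optimal \<open>e\<close> would be the excluded value 0,
    which is approached instead.\<close>
  proof (cases "?V = 0")
    case True
    have "?I \<le> 0 + ennreal e" if "0 < e" for e using bnd[OF that] True by simp
    then have "?I \<le> 0" by - (rule ennreal_le_epsilon, blast)
    then show ?thesis by simp
  next
    case False
    \<comment> \<open>The minimizer: it makes both summands of the bound equal.\<close>
    define e where "e = sqrt ?V / sqrt 2"
    have "0 < ?V" using False V by linarith
    then have e: "0 < e" unfolding e_def by (intro divide_pos_pos) auto
    have "?V = 2 * e\<^sup>2" using V by (simp add: e_def power_divide)
    then have "e + ?V / (2 * e) = 2 * e" using e by (simp add: power2_eq_square)
    moreover have "2 * e = sqrt 2 * sqrt ?V" unfolding e_def by (simp add: field_simps)
    ultimately show ?thesis using bnd[OF e] by simp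
  qed
qed

end

section \<open>Drawdowns of continuous paths\<close>

definition running_sup :: "(real \<Rightarrow> real) \<Rightarrow> real \<Rightarrow> real" where
  "running_sup x t = (SUP s\<in>{0..t}. x s)"

lemma drawdown_eq: "drawdown x t = running_sup x t - x t"
  by (simp add: drawdown_def running_sup_def)

context
  fixes x :: "real \<Rightarrow> real"
  assumes x: "continuous_on {0..} x"
begin

lemma running_sup_bdd_above: "bdd_above (x ` {0..t})"
  by (intro compact_imp_bounded[THEN bounded_imp_bdd_above] compact_continuous_image
      continuous_on_subset[OF x]) auto

lemma running_sup_ge: "0 \<le> s \<Longrightarrow> s \<le> t \<Longrightarrow> x s \<le> running_sup x t"
  unfolding running_sup_def by (intro cSUP_upper running_sup_bdd_above) auto

lemma running_sup_attained:
  assumes "0 \<le> t" obtains s where "0 \<le> s" "s \<le> t" "running_sup x t = x s"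
proof -
  obtain s where s: "s \<in> {0..t}" "\<forall>u\<in>{0..t}. x u \<le> x s"
    using continuous_attains_sup[of "{0..t}" x] assms continuous_on_subset[OF x, of "{0..t}"] by auto
  have "running_sup x t = x s" unfolding running_sup_def
    by (rule cSup_eq_maximum) (use s in auto)
  then show ?thesis using that s by auto
qed

lemma running_sup_mono: "0 \<le> s \<Longrightarrow> s \<le> t \<Longrightarrow> running_sup x s \<le> running_sup x t"
  by (metis running_sup_attained running_sup_ge order_trans)

lemma running_sup_le_iff: "0 \<le> t \<Longrightarrow> running_sup x t \<le> c \<longleftrightarrow> (\<forall>s\<in>{0..t}. x s \<le> c)"
  unfolding running_sup_def by (subst cSUP_le_iff) (auto intro: running_sup_bdd_above)

lemma running_sup_0: "running_sup x 0 = x 0"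
  by (simp add: running_sup_def)

lemma running_sup_increase:
  assumes "0 \<le> s" "s \<le> t" "running_sup x s < running_sup x t"
  obtains u where "s \<le> u" "u \<le> t" "running_sup x t = x u"
proof -
  obtain u where u: "0 \<le> u" "u \<le> t" "running_sup x t = x u"
    using running_sup_attained[of t] assms by auto
  then have "s \<le> u" using running_sup_ge[of u s] assms(3) by (cases "s \<le> u") auto
  then show ?thesis using that u by auto
qed

text \<open>Where the running supremum grows, its new value is taken by the path inside the
  interval, so its increments are bounded by the oscillation of the path.\<close>

lemma continuous_on_running_sup: "continuous_on {0..} (running_sup x)"
  unfolding continuous_on_iff
proof (intro ballI allI impI)
  fix t e :: real assume t: "t \<in> {0..}" and e: "0 < e"
  have "\<exists>\<delta>>0. \<forall>s\<in>{0..}. dist s t < \<delta> \<longrightarrow> dist (x s) (x t) < e / 2"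
    using x t half_gt_zero[OF e] unfolding continuous_on_iff by blast
  then obtain \<delta> where \<delta>: "0 < \<delta>" "\<And>s. 0 \<le> s \<Longrightarrow> \<bar>s - t\<bar> < \<delta> \<Longrightarrow> \<bar>x s - x t\<bar> < e / 2"
    by (auto simp: dist_real_def)
  have *: "running_sup x b - running_sup x a < e" if ab: "0 \<le> a" "a \<le> b" "\<bar>a - t\<bar> < \<delta>" "\<bar>b - t\<bar> < \<delta>" for a b
  proof (cases "running_sup x a < running_sup x b")
    case True
    then obtain u where u: "a \<le> u" "u \<le> b" "running_sup x b = x u"
      using running_sup_increase ab by blast
    have "\<bar>u - t\<bar> < \<delta>" using u ab by linarith
    then show ?thesis
      using \<delta>(2)[of u] \<delta>(2)[of a] running_sup_ge[of a a] u ab by linarith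
  qed (use e in simp)
  have "dist (running_sup x s) (running_sup x t) < e" if s: "0 \<le> s" "\<bar>s - t\<bar> < \<delta>" for s
    using *[of s t] *[of t s] running_sup_mono[of s t] running_sup_mono[of t s] s t \<delta>(1)
    by (cases "s \<le> t") (auto simp: dist_real_def)
  then show "\<exists>\<delta>>0. \<forall>s\<in>{0..}. dist s t < \<delta> \<longrightarrow> dist (running_sup x s) (running_sup x t) < e"
    using \<delta>(1) by (intro exI[of _ \<delta>]) (auto simp: dist_real_def)
qed

lemma continuous_on_drawdown: "continuous_on {0..} (drawdown x)"
  unfolding drawdown_eq by (intro continuous_intros x continuous_on_running_sup)

lemma drawdown_nonneg: "0 \<le> t \<Longrightarrow> 0 \<le> drawdown x t"
  using running_sup_ge[of t t] by (simp add: drawdown_eq)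

lemma drawdown_0: "drawdown x 0 = 0"
  by (simp add: drawdown_eq running_sup_0)

end

section \<open>The pathwise form of Ito's formula up to the fall time\<close>

definition drawdown_excess :: "real \<Rightarrow> (real \<Rightarrow> real) \<Rightarrow> real \<Rightarrow> real" where
  "drawdown_excess d x t = max 0 (running_sup (drawdown x) t - d)"

text \<open>Here \<open>reduced_sup - x\<close> equals \<open>drawdown - excess\<close>, which
  divided by \<open>- d\<close> is the optimal slope for \<open>e = d\<close> before the fall time.
  This is the finite-variation part of that slope.\<close>

definition reduced_sup :: "real \<Rightarrow> (real \<Rightarrow> real) \<Rightarrow> real \<Rightarrow> real" where
  "reduced_sup d x t = running_sup x t - drawdown_excess d x t"

text \<open>
  The expression without the sum is the limit of the Riemann sums of \<open>- \<integral> reduced_sup d x dx\<close> if \<open>x\<close>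
  has not passed its fall time.
\<close>

definition riemann_error :: "real \<Rightarrow> (real \<Rightarrow> real) \<Rightarrow> real \<Rightarrow> nat \<Rightarrow> real" where
  "riemann_error d x h N = d * drawdown_excess d x h + (reduced_sup d x h)\<^sup>2 / 2 - reduced_sup d x h * x h
    + (\<Sum>k<Suc N. reduced_sup d x (h * real k / real (Suc N)) *
        (x (h * real (Suc k) / real (Suc N)) - x (h * real k / real (Suc N))))"

text \<open>
  Since \<open>drawdown (drawdown x) t\<close> is the amount by which the drawdown lies below its running
  maximum, the hypothesis \<open>fall\<close> below says that the fall time of level \<open>d\<close> has not been passed.
\<close>

locale fall_path =
  fixes x :: "real \<Rightarrow> real" and d h :: real
  assumes cont: "continuous_on {0..} x" and x0: "x 0 = 0" and d: "0 < d" and h: "0 \<le> h"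
    and fall: "\<And>t. 0 \<le> t \<Longrightarrow> t \<le> h \<Longrightarrow> drawdown (drawdown x) t \<le> d"
begin

abbreviation "M \<equiv> running_sup x"
abbreviation "A \<equiv> drawdown x"
abbreviation "D \<equiv> running_sup (drawdown x)"

abbreviation "excess \<equiv> drawdown_excess d x"
abbreviation "rsup \<equiv> reduced_sup d x"

lemma contA: "continuous_on {0..} A" by (rule continuous_on_drawdown[OF cont])

lemma excess_0: "excess 0 = 0"
  using running_sup_0[OF contA] drawdown_0[OF cont] d by (simp add: drawdown_excess_def)

lemma M_0: "M 0 = 0" using running_sup_0[OF cont] x0 by simp

lemma excess_mono: "0 \<le> s \<Longrightarrow> s \<le> t \<Longrightarrow> excess s \<le> excess t"
  using running_sup_mono[OF contA, of s t] by (auto simp: drawdown_excess_def)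

text \<open>The lower bound expresses that the drawdown has not fallen by more than
  \<open>d\<close>; the upper one, that it is at most its running maximum.\<close>

lemma gap_bounds:
  assumes "0 \<le> t" "t \<le> h" shows "0 \<le> A t - excess t" "A t - excess t \<le> d"
  using fall[OF assms] drawdown_nonneg[OF cont assms(1)] running_sup_ge[OF contA assms(1) order_refl] d
  unfolding drawdown_excess_def drawdown_eq[of "drawdown x"] by auto

text \<open>
  The running maximum grows only where the drawdown vanishes, and there the excess vanishes too;
  the excess grows only where the drawdown exceeds it by exactly \<open>d\<close>. Hence on a short interval both
  increments carry the right coefficient up to the oscillation \<open>w\<close> of the path.
\<close>

lemma step_bound:
  assumes st: "0 \<le> s" "s \<le> t" "t \<le> h"
    and w: "\<And>u v. s \<le> u \<Longrightarrow> u \<le> t \<Longrightarrow> s \<le> v \<Longrightarrow> v \<le> t \<Longrightarrow> \<bar>x u - x v\<bar> \<le> w"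
  defines "V \<equiv> \<lambda>t. d * excess t + (rsup t)\<^sup>2 / 2 - rsup t * x t"
  shows "\<bar>V t - V s + rsup s * (x t - x s)\<bar> \<le> 3 * w * ((M t - M s) + (excess t - excess s))"
proof -
  \<comment> \<open>The difference of the squares of \<open>rsup\<close> factors through its
    midpoint. This gives the exact identity \<open>eq\<close>, so it remains to bound
    \<open>q\<close> where \<open>M\<close> grows and \<open>d - q\<close> where the excess
    grows.\<close>
  define q where "q = (rsup t + rsup s) / 2 - x t"
  have w0: "0 \<le> w" using w[of s s] st by simp
  have Mge: "x u \<le> M u" if "0 \<le> u" for u using running_sup_ge[OF cont that] by simp
  have Dge: "A u \<le> D u" if "0 \<le> u" for u using running_sup_ge[OF contA that] by simp
  have Mm: "M u \<le> M v" if "0 \<le> u" "u \<le> v" for u v using running_sup_mono[OF cont] that by blast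
  have Dm: "D u \<le> D v" if "0 \<le> u" "u \<le> v" for u v using running_sup_mono[OF contA] that by blast
  have Minc: "M v - M u \<le> w" if uv: "s \<le> u" "u \<le> v" "v \<le> t" for u v
  proof (cases "M u < M v")
    case True
    then obtain r where "u \<le> r" "r \<le> v" "M v = x r"
      using running_sup_increase[OF cont, of u v] uv st by auto
    then show ?thesis using w[of r u] Mge[of u] uv st by auto
  qed (use w0 in simp)
  have eq: "V t - V s + rsup s * (x t - x s)
      = q * (M t - M s) + (d - q) * (excess t - excess s)"
    unfolding V_def q_def reduced_sup_def by (simp add: power2_eq_square field_simps)
  have qM: "\<bar>q\<bar> * (M t - M s) \<le> 3 * w * (M t - M s)"
  proof (cases "M s < M t")
    case True
    then obtain u where u: "s \<le> u" "u \<le> t" "M t = x u"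
      using running_sup_increase[OF cont, of s t] st by auto
    have "M u = x u" using Mge[of u] Mm[of u t] u st by auto
    then have "A u = 0" by (simp add: drawdown_eq)
    \<comment> \<open>A new maximum of the path has drawdown zero, hence the fall hypothesis forces
      the maximal drawdown to be at most \<open>d\<close> at that time.\<close>
    then have Du: "D u \<le> d" using fall[of u] u st by (simp add: drawdown_eq[of "drawdown x"])
    have "D s \<le> d" using Du Dm[of s u] u st by auto
    then have es: "excess s = 0" by (simp add: drawdown_excess_def)
    have "D t \<le> d + w"
    proof -
      have "A v \<le> d + w" if v: "v \<in> {0..t}" for v
      proof (cases "v \<le> u")
        case True
        then show ?thesis using running_sup_ge[OF contA, of v u] Du v w0 by auto
      next
        case False
        then have "A v \<le> x u - x v" using Mm[of v t] u(3) v by (simp add: drawdown_eq)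
        also have "\<dots> \<le> w" using w[of u v] False v u by auto
        finally show ?thesis using d by simp
      qed
      then show ?thesis using running_sup_le_iff[OF contA, of t "d + w"] st by auto
    qed
    then have et: "0 \<le> excess t" "excess t \<le> w" using w0 by (auto simp: drawdown_excess_def)
    have "\<bar>x u - x t\<bar> \<le> w" using w u st by auto
    moreover have "M t - w \<le> M s" "M s \<le> M t" using Minc[of s t] Mm[of s t] st by auto
    ultimately have "\<bar>q\<bar> \<le> 3 * w"
      using et unfolding q_def reduced_sup_def es u(3) by (auto simp: field_simps)
    then show ?thesis using True by (intro mult_right_mono) auto
  qed (use Mm[of s t] st in auto)
  have qE: "\<bar>d - q\<bar> * (excess t - excess s) \<le> 3 * w * (excess t - excess s)"
  proof (cases "excess s < excess t")
    case True
    then have Dt: "D t = excess t + d" and "D s < D t" by (auto simp: drawdown_excess_def max_def split: if_splits)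
    then obtain u where u: "s \<le> u" "u \<le> t" "D t = A u"
      using running_sup_increase[OF contA, of s t] st by auto
    have Au: "M u - x u = excess t + d" using u(3) Dt by (simp add: drawdown_eq)
    have "A u - A s \<le> 2 * w"
      using Minc[of s u] w[of s u] u st by (simp add: drawdown_eq)
    then have "D t \<le> D s + 2 * w" using u(3) Dge[of s] st by linarith
    then have e: "excess s \<le> excess t" "excess t - 2 * w \<le> excess s"
      using True w0 unfolding drawdown_excess_def by (auto simp: max_def split: if_splits)
    have "M t - M u \<le> w" "M u \<le> M t" "M u - M s \<le> w" "M s \<le> M u"
      using Minc[of u t] Minc[of s u] Mm[of u t] Mm[of s u] u st by auto
    moreover have "\<bar>x u - x t\<bar> \<le> w" using w u st by auto
    ultimately have "\<bar>d - q\<bar> \<le> 3 * w"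
      using Au e unfolding q_def reduced_sup_def by (auto simp: field_simps)
    then show ?thesis using True by (intro mult_right_mono) auto
  qed (use excess_mono[of s t] st in auto)
  have "\<bar>q * (M t - M s) + (d - q) * (excess t - excess s)\<bar>
      \<le> \<bar>q\<bar> * (M t - M s) + \<bar>d - q\<bar> * (excess t - excess s)"
    using Mm[of s t] excess_mono[of s t] st
    by (intro order_trans[OF abs_triangle_ineq]) (auto simp: abs_mult)
  then show ?thesis using qM qE unfolding eq by (simp add: algebra_simps)
qed

text \<open>The step bounds add up, since \<open>M\<close> and the excess are monotone and start at
  0: their total variation is their final value.\<close>

lemma riemann_error_bound:
  assumes w: "\<And>u v. 0 \<le> u \<Longrightarrow> u \<le> h \<Longrightarrow> 0 \<le> v \<Longrightarrow> v \<le> h \<Longrightarrow> \<bar>u - v\<bar> \<le> h / real (Suc N) \<Longrightarrow> \<bar>x u - x v\<bar> \<le> w"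
  shows "\<bar>riemann_error d x h N\<bar> \<le> 3 * w * (M h + excess h)"
proof -
  define g where "g = (\<lambda>k. h * real k / real (Suc N))"
  define V where "V = (\<lambda>t. d * excess t + (rsup t)\<^sup>2 / 2 - rsup t * x t)"
  have gS: "g (Suc k) - g k = h / real (Suc N)" for k
    unfolding g_def by (simp add: diff_divide_distrib[symmetric] right_diff_distrib[symmetric])
  have g: "0 \<le> g k" "g k \<le> g (Suc k)" for k unfolding g_def using h by (auto intro!: divide_right_mono mult_left_mono)
  have gh: "g k \<le> h" if "k \<le> Suc N" for k
  proof -
    have "h * real k \<le> h * real (Suc N)" using that h by (intro mult_left_mono) auto
    then show ?thesis unfolding g_def by (simp add: divide_le_eq)
  qed
  have "\<bar>V (g n) + (\<Sum>k<n. rsup (g k) * (x (g (Suc k)) - x (g k)))\<bar> \<le> 3 * w * (M (g n) + excess (g n))"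
    if "n \<le> Suc N" for n using that
  proof (induction n)
    case 0
    then show ?case by (simp add: g_def V_def excess_0 M_0 reduced_sup_def x0)
  next
    case (Suc n)
    have "\<bar>V (g (Suc n)) - V (g n) + rsup (g n) * (x (g (Suc n)) - x (g n))\<bar>
        \<le> 3 * w * ((M (g (Suc n)) - M (g n)) + (excess (g (Suc n)) - excess (g n)))"
      unfolding V_def
    proof (rule step_bound)
      fix u v assume uv: "g n \<le> u" "u \<le> g (Suc n)" "g n \<le> v" "v \<le> g (Suc n)"
      then have "\<bar>u - v\<bar> \<le> h / real (Suc N)" using gS[of n] by linarith
      then show "\<bar>x u - x v\<bar> \<le> w"
        using uv g[of n] gh[OF Suc.prems] by (intro w) linarith+
    qed (use g gh Suc.prems in auto)
    moreover have "\<bar>V (g n) + (\<Sum>k<n. rsup (g k) * (x (g (Suc k)) - x (g k)))\<bar>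
        \<le> 3 * w * (M (g n) + excess (g n))" using Suc by simp
    ultimately show ?case by (simp add: algebra_simps)
  qed
  from this[of "Suc N"] have "\<bar>V h + (\<Sum>k<Suc N. rsup (g k) * (x (g (Suc k)) - x (g k)))\<bar>
      \<le> 3 * w * (M h + excess h)"
    by (simp add: g_def)
  then show ?thesis unfolding riemann_error_def V_def g_def by simp
qed

lemma M_nonneg: "0 \<le> t \<Longrightarrow> 0 \<le> M t"
  using running_sup_ge[OF cont, of 0 t] x0 by simp

lemma riemann_error_tendsto: "riemann_error d x h \<longlonglongrightarrow> 0"
proof (rule LIMSEQ_I)
  fix r :: real assume r: "0 < r"
  define C where "C = 3 * (M h + excess h) + 1"
  have C: "0 < C" "3 * (M h + excess h) < C" using M_nonneg[OF h] by (auto simp: C_def drawdown_excess_def intro!: add_nonneg_pos)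
  have "uniformly_continuous_on {0..h} x"
    by (intro compact_uniformly_continuous continuous_on_subset[OF cont]) auto
  then obtain \<delta> where \<delta>: "0 < \<delta>" "\<And>u v. u \<in> {0..h} \<Longrightarrow> v \<in> {0..h} \<Longrightarrow> dist u v < \<delta> \<Longrightarrow> dist (x u) (x v) < r / C"
    using r C unfolding uniformly_continuous_on_def by (metis divide_pos_pos)
  have "(\<lambda>N. h * (1 / real (Suc N))) \<longlonglongrightarrow> h * 0"
    by (intro tendsto_mult tendsto_const LIMSEQ_Suc[OF lim_1_over_n])
  then have "\<forall>\<^sub>F N in sequentially. h * (1 / real (Suc N)) < \<delta>"
    using order_tendstoD(2)[of _ "h * 0" sequentially \<delta>] \<delta>(1) by simp
  then obtain N0 where N0: "\<And>N. N0 \<le> N \<Longrightarrow> h / real (Suc N) < \<delta>"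
    unfolding eventually_sequentially by auto
  have "norm (riemann_error d x h N - 0) < r" if "N0 \<le> N" for N
  proof -
    have "\<bar>riemann_error d x h N\<bar> \<le> 3 * (r / C) * (M h + excess h)"
    proof (rule riemann_error_bound)
      fix u v assume "0 \<le> u" "u \<le> h" "0 \<le> v" "v \<le> h" "\<bar>u - v\<bar> \<le> h / real (Suc N)"
      then have "dist (x u) (x v) < r / C" using N0[OF that] by (intro \<delta>(2)) (auto simp: dist_real_def)
      then show "\<bar>x u - x v\<bar> \<le> r / C" by (simp add: dist_real_def)
    qed
    also have "\<dots> = r * (3 * (M h + excess h)) / C" by simp
    also have "\<dots> < r * C / C" using r C by (intro divide_strict_right_mono mult_strict_left_mono) auto
    finally show ?thesis using C by simp
  qed
  then show "\<exists>N0. \<forall>N\<ge>N0. norm (riemann_error d x h N - 0) < r" by blast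
qed

lemma sup_bounds:
  assumes S: "\<And>u. 0 \<le> u \<Longrightarrow> u \<le> h \<Longrightarrow> \<bar>x u\<bar> \<le> S" and t: "0 \<le> t" "t \<le> h"
  shows "M t \<le> S" "D t \<le> 2 * S" "0 \<le> excess t" "excess t \<le> 2 * S" "\<bar>rsup t\<bar> \<le> 2 * S"
proof -
  have M: "M u \<le> S" if "0 \<le> u" "u \<le> h" for u
    using running_sup_le_iff[OF cont that(1), of S] S that by force
  then show "M t \<le> S" using t by blast
  have "A u \<le> 2 * S" if "0 \<le> u" "u \<le> h" for u
    using M[OF that] S[OF that] by (simp add: drawdown_eq)
  then show D: "D t \<le> 2 * S"
    using running_sup_le_iff[OF contA t(1), of "2 * S"] t by force
  have S0: "0 \<le> S" using S[OF order_refl h] by linarith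
  show e: "0 \<le> excess t" "excess t \<le> 2 * S" using D S0 d by (auto simp: drawdown_excess_def)
  show "\<bar>rsup t\<bar> \<le> 2 * S"
    unfolding reduced_sup_def using e M[OF t] M_nonneg[OF t(1)] by linarith
qed

text \<open>The crude oscillation \<open>2 * S\<close> gives \<open>3 * 2 * S * (S + 2 * S)\<close>.
  The bound does not depend on the grid and supplies the dominating function.\<close>

lemma riemann_error_dominated:
  assumes S: "\<And>u. 0 \<le> u \<Longrightarrow> u \<le> h \<Longrightarrow> \<bar>x u\<bar> \<le> S"
  shows "\<bar>riemann_error d x h N\<bar> \<le> 18 * S\<^sup>2"
proof -
  have "\<bar>riemann_error d x h N\<bar> \<le> 3 * (2 * S) * (M h + excess h)"
  proof (rule riemann_error_bound)
    fix u v assume "0 \<le> u" "u \<le> h" "0 \<le> v" "v \<le> h"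
    then show "\<bar>x u - x v\<bar> \<le> 2 * S" using S[of u] S[of v] by linarith
  qed
  also have "\<dots> \<le> 3 * (2 * S) * (3 * S)"
    using sup_bounds[OF S h order_refl] S[OF order_refl h] by (intro mult_left_mono) auto
  finally show ?thesis by (simp add: power2_eq_square)
qed

end

section \<open>Brownian motion as a martingale\<close>

lemma space_natural_filtration[simp]: "space (natural_filtration M X t) = space M"
  unfolding natural_filtration_def by (rule space_measure_of) auto

lemma sets_natural_filtration:
  "sets (natural_filtration M X t)
    = sigma_sets (space M) (\<Union>s\<in>{0..t}. {X s -` U \<inter> space M | U. U \<in> sets borel})"
  unfolding natural_filtration_def by (rule sets_measure_of) auto

lemma sets_natural_filtration_mono:
  "s \<le> t \<Longrightarrow> sets (natural_filtration M X s) \<subseteq> sets (natural_filtration M X t)"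
  unfolding sets_natural_filtration by (intro sigma_sets_mono' UN_mono) auto

lemma measurable_natural_filtration:
  "0 \<le> s \<Longrightarrow> s \<le> t \<Longrightarrow> X s \<in> borel_measurable (natural_filtration M X t)"
  by (rule measurableI) (simp, unfold sets_natural_filtration space_natural_filtration,
      rule sigma_sets.Basic, rule UN_I[of s], auto)

lemma subalgebra_natural_filtration:
  assumes "\<And>s. 0 \<le> s \<Longrightarrow> X s \<in> borel_measurable M"
  shows "subalgebra M (natural_filtration M X t)"
  unfolding subalgebra_def sets_natural_filtration
  by (auto intro!: sets.sigma_sets_subset measurable_sets[OF assms])

lemma (in prob_space) martingaleI:
  fixes X :: "real \<Rightarrow> 'a \<Rightarrow> real"
  assumes sub: "\<And>t. 0 \<le> t \<Longrightarrow> subalgebra M (F t)"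
    and mono: "\<And>s t. 0 \<le> s \<Longrightarrow> s \<le> t \<Longrightarrow> sets (F s) \<subseteq> sets (F t)"
    and adapted: "\<And>t. 0 \<le> t \<Longrightarrow> X t \<in> borel_measurable (F t)"
    and int: "\<And>t. 0 \<le> t \<Longrightarrow> integrable M (X t)"
    and incr: "\<And>s t A. 0 \<le> s \<Longrightarrow> s \<le> t \<Longrightarrow> A \<in> sets (F s) \<Longrightarrow>
      (\<integral>\<omega>. indicator A \<omega> * (X t \<omega> - X s \<omega>) \<partial>M) = 0"
  shows "martingale M F X"
  unfolding martingale_def
proof (intro conjI allI impI)
  fix s t :: real assume st: "0 \<le> s \<and> s \<le> t"
  then have s: "0 \<le> s" and t: "0 \<le> t" by auto
  interpret sa: finite_measure_subalgebra M "F s"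
    by unfold_locales (rule sub[OF s])
  show "AE \<omega> in M. real_cond_exp M (F s) (X t) \<omega> = X s \<omega>"
  proof (rule sa.real_cond_exp_charact[OF _ int[OF t] int[OF s] adapted[OF s]])
    fix A assume A: "A \<in> sets (F s)"
    then have AM: "A \<in> sets M" using sub[OF s] by (auto simp: subalgebra_def)
    have "integrable M (\<lambda>\<omega>. indicator A \<omega> * X t \<omega>)" "integrable M (\<lambda>\<omega>. indicator A \<omega> * X s \<omega>)"
      using integrable_mult_indicator[OF AM int[OF t]] integrable_mult_indicator[OF AM int[OF s]] by auto
    then show "(\<integral>\<omega>\<in>A. X t \<omega> \<partial>M) = (\<integral>\<omega>\<in>A. X s \<omega> \<partial>M)"
      using incr[OF s _ A, of t] st by (simp add: set_lebesgue_integral_def right_diff_distrib)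
  qed
qed (use sub mono adapted int in auto)

context brownian_motion begin

abbreviation "\<F> \<equiv> natural_filtration M B"

lemma increment:
  assumes "0 \<le> s" "s \<le> t"
  shows "integrable M (\<lambda>\<omega>. B t \<omega> - B s \<omega>)" "integrable M (\<lambda>\<omega>. (B t \<omega> - B s \<omega>)\<^sup>2)"
    "(\<integral>\<omega>. B t \<omega> - B s \<omega> \<partial>M) = 0"
proof -
  have "integrable M (\<lambda>\<omega>. B t \<omega> - B s \<omega>) \<and> integrable M (\<lambda>\<omega>. (B t \<omega> - B s \<omega>)\<^sup>2) \<and>
    (\<integral>\<omega>. B t \<omega> - B s \<omega> \<partial>M) = 0"
  proof (cases "s = t")
    case False
    then have st: "0 \<le> s" "s < t" using assms by auto
    note D = normal_increments[OF st]
    have pos: "0 < sqrt (t - s)" using st by simp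
    have "integrable M (\<lambda>\<omega>. (B t \<omega> - B s \<omega>) ^ k)" for k
      using integrable_normal_moment[OF pos, of 0 k] distributed_integrable[OF D, of "\<lambda>x. x ^ k"]
      by simp
    from this[of 1] this[of 2] show ?thesis
      using normal_distributed_expectation[OF pos D] by simp
  qed simp
  then show "integrable M (\<lambda>\<omega>. B t \<omega> - B s \<omega>)" "integrable M (\<lambda>\<omega>. (B t \<omega> - B s \<omega>)\<^sup>2)"
    "(\<integral>\<omega>. B t \<omega> - B s \<omega> \<partial>M) = 0" by auto
qed

lemma integrable_B: "0 \<le> t \<Longrightarrow> integrable M (B t)"
  using increment(1)[of 0 t] start_zero
  by (subst Bochner_Integration.integrable_cong[of M M _ "\<lambda>\<omega>. B t \<omega> - B 0 \<omega>"]) auto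

lemma integrable_B_sq: "0 \<le> t \<Longrightarrow> integrable M (\<lambda>\<omega>. (B t \<omega>)\<^sup>2)"
  using increment(2)[of 0 t] start_zero
  by (subst Bochner_Integration.integrable_cong[of M M _ "\<lambda>\<omega>. (B t \<omega> - B 0 \<omega>)\<^sup>2"]) auto

text \<open>Once 0 and \<open>s\<close> are added to the times, the observed values are partial sums
  of the first \<open>m\<close> increments, so the cylinder is an event of these. The increment from
  \<open>s\<close> to \<open>t\<close> has index \<open>m\<close> and is independent of them, with
  mean zero.\<close>

lemma cylinder_increment:
  assumes st: "0 \<le> s" "s \<le> t" and I: "finite I" "I \<subseteq> {0..s}" and U: "\<And>u. u \<in> I \<Longrightarrow> U u \<in> sets borel"
  defines "C \<equiv> {\<omega>\<in>space M. \<forall>u\<in>I. B u \<omega> \<in> U u}"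
  shows "C \<in> sets M" "(\<integral>\<omega>. indicator C \<omega> * (B t \<omega> - B s \<omega>) \<partial>M) = 0"
proof -
  have Bm: "B u \<in> borel_measurable M" if "u \<in> I" for u
    using random_variable_B[of u] I that by auto
  show C: "C \<in> sets M"
    unfolding C_def using I(1)
  proof (rule sets.sets_Collect_finite_All[rotated])
    fix u assume u: "u \<in> I"
    have "B u -` U u \<inter> space M \<in> sets M" by (rule measurable_sets[OF Bm[OF u] U[OF u]])
    moreover have "B u -` U u \<inter> space M = {\<omega>\<in>space M. B u \<omega> \<in> U u}" by auto
    ultimately show "{\<omega>\<in>space M. B u \<omega> \<in> U u} \<in> sets M" by simp
  qed
  define J where "J = insert 0 (insert s I)"
  define L where "L = sorted_list_of_set J"
  define m where "m = length L - 1"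
  define V where "V = (\<lambda>u. if u \<in> I then U u else UNIV)"
  have J: "finite J" "J \<subseteq> {0..s}" "0 \<in> J" "s \<in> J" using I st by (auto simp: J_def)
  have L: "sorted L" "set L = J" "L \<noteq> []" using J by (auto simp: L_def)
  then have len: "length L = Suc m" by (cases L) (auto simp: m_def)
  have Ln: "L ! i \<le> L ! j" if "i \<le> j" "j \<le> m" for i j
    using L(1) that len by (auto intro: sorted_nth_mono)
  have Lin: "L ! i \<in> {0..s}" if "i \<le> m" for i
    using L(2) J(2) that len nth_mem[of i L] by auto
  have L0: "L ! 0 = 0"
  proof -
    obtain i where "i \<le> m" "L ! i = 0" using L(2) J(3) len by (metis in_set_conv_nth less_Suc_eq_le)
    then show ?thesis using Ln[of 0 i] Lin[of 0] by auto
  qed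
  have Lm: "L ! m = s"
  proof -
    obtain i where "i \<le> m" "L ! i = s" using L(2) J(4) len by (metis in_set_conv_nth less_Suc_eq_le)
    then show ?thesis using Ln[of i m] Lin[of m] by auto
  qed
  define \<tau> where "\<tau> i = (if i \<le> m then L ! i else t)" for i
  define Y where "Y i \<omega> = B (\<tau> (Suc i)) \<omega> - B (\<tau> i) \<omega>" for i \<omega>
  have \<tau>m: "\<tau> i \<le> \<tau> (Suc i)" if "i < Suc m" for i
    using that Ln[of i "Suc i"] Lm st by (auto simp: \<tau>_def less_Suc_eq)
  have "indep_vars (\<lambda>_. borel) (\<lambda>i \<omega>. B (\<tau> (Suc i)) \<omega> - B (\<tau> i) \<omega>) {..<Suc m}"
    by (rule indep_increments) (use \<tau>m L0 in \<open>auto simp: \<tau>_def\<close>)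
  then have ind: "indep_vars (\<lambda>_. borel) Y {..<Suc m}" by (simp add: Y_def[abs_def])
  have ind2: "indep_var (PiM {..<m} (\<lambda>_. borel)) (\<lambda>\<omega>. restrict (\<lambda>i. Y i \<omega>) {..<m})
      (PiM {m} (\<lambda>_. borel)) (\<lambda>\<omega>. restrict (\<lambda>i. Y i \<omega>) {m})"
    by (rule indep_var_restrict[OF ind]) auto
  define f :: "(nat \<Rightarrow> real) \<Rightarrow> real" where
    "f y = (if \<forall>j\<in>{..m}. (\<Sum>i<j. y i) \<in> V (L ! j) then 1 else 0)" for y
  have Vb: "V u \<in> sets borel" for u using U by (auto simp: V_def)
  have fm: "f \<in> borel_measurable (PiM {..<m} (\<lambda>_. borel))"
  proof -
    have "Measurable.pred (PiM {..<m} (\<lambda>_. borel)) (\<lambda>y. \<forall>j\<in>{..m}. (\<Sum>i<j. y i) \<in> V (L ! j))"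
    proof (intro pred_intros_finite)
      fix j assume j: "j \<in> {..m}"
      have "(\<lambda>y. \<Sum>i<j. y i) \<in> borel_measurable (PiM {..<m} (\<lambda>_. borel :: real measure))"
        using j by (intro borel_measurable_sum measurable_component_singleton) auto
      then show "Measurable.pred (PiM {..<m} (\<lambda>_. borel)) (\<lambda>y. (\<Sum>i<j. y i) \<in> V (L ! j))"
        by (rule pred_sets2[OF Vb])
    qed simp
    then show ?thesis unfolding f_def by measurable
  qed
  have ind3: "indep_var borel (f \<circ> (\<lambda>\<omega>. restrict (\<lambda>i. Y i \<omega>) {..<m})) borel ((\<lambda>y. y m) \<circ> (\<lambda>\<omega>. restrict (\<lambda>i. Y i \<omega>) {m}))"
    by (rule indep_var_compose[OF ind2 fm]) (auto intro: measurable_component_singleton)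
  have Bsum: "B (L ! j) \<omega> = (\<Sum>i<j. Y i \<omega>)" if "\<omega> \<in> space M" "j \<le> m" for j \<omega>
    using that(2)
  proof (induction j)
    case 0 then show ?case using L0 start_zero[OF that(1)] by simp
  next
    case (Suc j) then show ?case by (simp add: Y_def \<tau>_def)
  qed
  have fC: "(f \<circ> (\<lambda>\<omega>. restrict (\<lambda>i. Y i \<omega>) {..<m})) \<omega> = indicator C \<omega>" if w: "\<omega> \<in> space M" for \<omega>
  proof -
    have "(\<forall>j\<in>{..m}. (\<Sum>i<j. restrict (\<lambda>i. Y i \<omega>) {..<m} i) \<in> V (L ! j)) \<longleftrightarrow> (\<forall>j\<in>{..m}. B (L ! j) \<omega> \<in> V (L ! j))"
      using Bsum[OF w] by (intro ball_cong refl) (auto intro!: arg_cong[where f = "\<lambda>r. r \<in> V _"] sum.cong)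
    also have "\<dots> \<longleftrightarrow> (\<forall>u\<in>set L. B u \<omega> \<in> V u)"
      unfolding all_set_conv_all_nth len by (auto simp: less_Suc_eq_le)
    also have "\<dots> \<longleftrightarrow> \<omega> \<in> C"
      unfolding L(2) C_def V_def J_def using w by auto
    finally show ?thesis by (simp add: f_def indicator_def)
  qed
  have gY: "((\<lambda>y. y m) \<circ> (\<lambda>\<omega>. restrict (\<lambda>i. Y i \<omega>) {m})) \<omega> = B t \<omega> - B s \<omega>" for \<omega>
    by (simp add: Y_def \<tau>_def Lm)
  have i1: "integrable M (f \<circ> (\<lambda>\<omega>. restrict (\<lambda>i. Y i \<omega>) {..<m}))"
    using C by (subst Bochner_Integration.integrable_cong[OF refl fC])
      (auto intro!: integrable_real_indicator simp: emeasure_eq_measure)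
  have i2: "integrable M ((\<lambda>y. y m) \<circ> (\<lambda>\<omega>. restrict (\<lambda>i. Y i \<omega>) {m}))"
    using increment(1)[OF st] by (subst Bochner_Integration.integrable_cong[OF refl gY])
  have "(\<integral>\<omega>. indicator C \<omega> * (B t \<omega> - B s \<omega>) \<partial>M)
    = (\<integral>\<omega>. (f \<circ> (\<lambda>\<omega>. restrict (\<lambda>i. Y i \<omega>) {..<m})) \<omega> * ((\<lambda>y. y m) \<circ> (\<lambda>\<omega>. restrict (\<lambda>i. Y i \<omega>) {m})) \<omega> \<partial>M)"
    using fC gY by (intro Bochner_Integration.integral_cong) auto
  also have "\<dots> = (\<integral>\<omega>. (f \<circ> (\<lambda>\<omega>. restrict (\<lambda>i. Y i \<omega>) {..<m})) \<omega> \<partial>M) * (\<integral>\<omega>. B t \<omega> - B s \<omega> \<partial>M)"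
    using indep_var_lebesgue_integral[OF ind3 i1 i2] unfolding gY by (simp add: comp_def)
  also have "\<dots> = 0" using increment(3)[OF st] by simp
  finally show "(\<integral>\<omega>. indicator C \<omega> * (B t \<omega> - B s \<omega>) \<partial>M) = 0" .
qed

text \<open>Dynkin's argument: cylinders are closed under intersection, generate the natural
  filtration, and the vanishing of the integral passes to complements and countable disjoint
  unions.\<close>

lemma indicator_increment:
  assumes st: "0 \<le> s" "s \<le> t" and A: "A \<in> sets (\<F> s)"
  shows "(\<integral>\<omega>. indicator A \<omega> * (B t \<omega> - B s \<omega>) \<partial>M) = 0"
proof -
  define G where "G = {{\<omega>\<in>space M. \<forall>u\<in>I. B u \<omega> \<in> U u} | I U. finite I \<and> I \<subseteq> {0..s} \<and> (\<forall>u\<in>I. U u \<in> sets borel)}"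
  have GM: "G \<subseteq> sets M"
    using cylinder_increment(1)[OF st] unfolding G_def by blast
  have int: "integrable M (\<lambda>\<omega>. indicator E \<omega> * (B t \<omega> - B s \<omega>))" if "E \<in> sets M" for E
    using integrable_mult_indicator[OF that increment(1)[OF st]] by simp
  have "Int_stable G"
  proof (rule Int_stableI)
    fix a b assume "a \<in> G" "b \<in> G"
    then obtain I U I' U' where
      a: "a = {\<omega>\<in>space M. \<forall>u\<in>I. B u \<omega> \<in> U u}" "finite I" "I \<subseteq> {0..s}" "\<forall>u\<in>I. U u \<in> sets borel" and
      b: "b = {\<omega>\<in>space M. \<forall>u\<in>I'. B u \<omega> \<in> U' u}" "finite I'" "I' \<subseteq> {0..s}" "\<forall>u\<in>I'. U' u \<in> sets borel"
      unfolding G_def by auto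
    define W where "W u = (if u \<in> I then U u else UNIV) \<inter> (if u \<in> I' then U' u else UNIV)" for u
    have "a \<inter> b = {\<omega>\<in>space M. \<forall>u\<in>I\<union>I'. B u \<omega> \<in> W u}"
      unfolding a(1) b(1) W_def by auto
    moreover have "\<forall>u\<in>I \<union> I'. W u \<in> sets borel" using a b unfolding W_def by auto
    ultimately show "a \<inter> b \<in> G" 
      unfolding G_def using a(2,3) b(2,3) by (intro CollectI exI[of _ "I \<union> I'"] exI[of _ W]) simp
  qed
  moreover have "G \<subseteq> Pow (space M)" using GM sets.sets_into_space by blast
  moreover have "A \<in> sigma_sets (space M) G"
  proof -
    have "(\<Union>u\<in>{0..s}. {B u -` U \<inter> space M | U. U \<in> sets borel}) \<subseteq> G"
    proof clarify
      fix u and U :: "real set" assume "u \<in> {0..s}" "U \<in> sets borel"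
      then show "B u -` U \<inter> space M \<in> G"
        unfolding G_def by (intro CollectI exI[of _ "{u}"] exI[of _ "\<lambda>_. U"]) auto
    qed
    from sigma_sets_mono'[OF this] show ?thesis using A unfolding sets_natural_filtration by blast
  qed
  ultimately show ?thesis
  proof (induction rule: sigma_sets_induct_disjoint)
    case (basic A)
    then obtain I U where "A = {\<omega>\<in>space M. \<forall>u\<in>I. B u \<omega> \<in> U u}" "finite I" "I \<subseteq> {0..s}" "\<forall>u\<in>I. U u \<in> sets borel"
      unfolding G_def by auto
    then show ?case using cylinder_increment(2)[OF st, of I U] by auto
  next
    case (compl A)
    then have AM: "A \<in> sets M" using sets.sigma_sets_subset[OF GM] by blast
    have "(\<integral>\<omega>. indicator (space M - A) \<omega> * (B t \<omega> - B s \<omega>) \<partial>M)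
        = (\<integral>\<omega>. (B t \<omega> - B s \<omega>) - indicator A \<omega> * (B t \<omega> - B s \<omega>) \<partial>M)"
      by (intro Bochner_Integration.integral_cong) (auto simp: indicator_def)
    then show ?case
      using compl(2) Bochner_Integration.integral_diff[OF increment(1)[OF st] int[OF AM]] increment(3)[OF st]
      by simp
  next
    case (union A)
    then have AM: "A i \<in> sets M" for i using sets.sigma_sets_subset[OF GM] by blast
    have "(LINT \<omega>:(\<Union>i. A i)|M. B t \<omega> - B s \<omega>) = (\<Sum>i. (LINT \<omega>:(A i)|M. B t \<omega> - B s \<omega>))"
    proof (rule lebesgue_integral_countable_add[OF AM])
      show "A i \<inter> A j = {}" if "i \<noteq> j" for i j using union(1) that by (auto simp: disjoint_family_on_def)
      show "set_integrable M (\<Union>i. A i) (\<lambda>\<omega>. B t \<omega> - B s \<omega>)"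
        unfolding set_integrable_def using int[of "\<Union>i. A i"] AM by auto
    qed
    then show ?case using union(3) by (simp add: set_lebesgue_integral_def)
  qed simp
qed

lemma martingale_B: "martingale M \<F> B"
proof (rule martingaleI)
  show "subalgebra M (\<F> t)" for t by (rule subalgebra_natural_filtration[OF random_variable_B])
  show "B t \<in> borel_measurable (\<F> t)" if "0 \<le> t" for t
    by (rule measurable_natural_filtration[OF that order_refl])
qed (use sets_natural_filtration_mono integrable_B indicator_increment in blast)+

sublocale sq_martingale M \<F> B
  by unfold_locales (auto intro: martingale_B integrable_B_sq)

text \<open>Along a convergent path the increments over unit times tend to 0. The standard normal
  density is at most 1, so already the first increment after \<open>n\<close> lies in
  \<open>{-e..e}\<close> with probability at most \<open>2 * e\<close>, uniformly in
  \<open>n\<close>.\<close>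

lemma AE_not_convergent: "AE \<omega> in M. \<not> (\<exists>l. ((\<lambda>t. B t \<omega>) \<longlongrightarrow> l) at_top)"
proof -
  define P where "P e n = {\<omega>\<in>space M. \<forall>k\<ge>n. \<bar>B (real (Suc k)) \<omega> - B (real k) \<omega>\<bar> \<le> e}" for e n
  have [measurable]: "B (real n) \<in> borel_measurable M" for n by (rule meas) simp
  have Pm[measurable]: "P e n \<in> sets M" for e n unfolding P_def by measurable
  have Pe: "prob (P e n) \<le> 2 * e" if e: "0 < e" for e n
  proof -
    have st: "0 \<le> real n" "real n < real (Suc n)" by auto
    note D = normal_increments[OF st]
    have "prob (P e n) \<le> prob {\<omega>\<in>space M. B (real (Suc n)) \<omega> - B (real n) \<omega> \<in> {-e..e}}"
    proof (rule finite_measure_mono)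
      show "{\<omega>\<in>space M. B (real (Suc n)) \<omega> - B (real n) \<omega> \<in> {-e..e}} \<in> sets M" by measurable
      show "P e n \<subseteq> {\<omega>\<in>space M. B (real (Suc n)) \<omega> - B (real n) \<omega> \<in> {-e..e}}"
        unfolding P_def by (force simp: abs_le_iff)
    qed
    also have "\<dots> = prob ((\<lambda>\<omega>. B (real (Suc n)) \<omega> - B (real n) \<omega>) -` {-e..e} \<inter> space M)"
      by (intro arg_cong[where f = prob]) auto
    finally have 1: "emeasure M (P e n) \<le> emeasure M ((\<lambda>\<omega>. B (real (Suc n)) \<omega> - B (real n) \<omega>) -` {-e..e} \<inter> space M)"
      by (simp add: emeasure_eq_measure)
    have "emeasure M ((\<lambda>\<omega>. B (real (Suc n)) \<omega> - B (real n) \<omega>) -` {-e..e} \<inter> space M)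
      = (\<integral>\<^sup>+x. ennreal (normal_density 0 (sqrt (real (Suc n) - real n)) x) * indicator {-e..e} x \<partial>lborel)"
      by (rule distributed_emeasure[OF D]) auto
    also have "\<dots> \<le> (\<integral>\<^sup>+x. indicator {-e..e} x \<partial>lborel)"
    proof (intro nn_integral_mono)
      fix x :: real
      have "1 / sqrt (2 * pi) \<le> 1" using pi_ge_two by (simp add: real_le_rsqrt)
      then have "normal_density 0 1 x \<le> 1"
        unfolding normal_density_def by (intro mult_le_one) auto
      then have "ennreal (normal_density 0 1 x) \<le> 1" using ennreal_leI by fastforce
      then show "ennreal (normal_density 0 (sqrt (real (Suc n) - real n)) x) * indicator {-e..e} x \<le> indicator {-e..e} x"
        by (auto simp: indicator_def)
    qed
    also have "\<dots> = ennreal (2 * e)" using e by simp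
    finally show ?thesis using 1 e by (simp add: emeasure_eq_measure)
  qed
  have null: "emeasure M (\<Inter>k. \<Union>n. P (1 / real (Suc k)) n) = 0"
  proof -
    have "emeasure M (\<Inter>k. \<Union>n. P (1 / real (Suc k)) n) \<le> 0 + ennreal \<epsilon>" if "0 < \<epsilon>" for \<epsilon>
    proof -
      obtain k where k: "inverse (real (Suc k)) < \<epsilon> / 2" using reals_Archimedean[OF half_gt_zero[OF \<open>0 < \<epsilon>\<close>]] by blast
      have "emeasure M (\<Inter>k. \<Union>n. P (1 / real (Suc k)) n) \<le> emeasure M (\<Union>n. P (1 / real (Suc k)) n)"
        by (intro emeasure_mono) auto
      also have "\<dots> = (SUP n. emeasure M (P (1 / real (Suc k)) n))"
        by (rule SUP_emeasure_incseq[symmetric], use Pm in blast, force simp: incseq_def P_def)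
      also have "\<dots> \<le> ennreal (2 * (1 / real (Suc k)))"
        using Pe[of "1 / real (Suc k)"] by (intro SUP_least) (simp add: emeasure_eq_measure ennreal_leI)
      also have "\<dots> \<le> ennreal \<epsilon>" using k by (intro ennreal_leI) (simp add: field_simps)
      finally show ?thesis by simp
    qed
    then have "emeasure M (\<Inter>k. \<Union>n. P (1 / real (Suc k)) n) \<le> 0" by - (rule ennreal_le_epsilon, blast)
    then show ?thesis by simp
  qed
  show ?thesis
  proof (rule AE_I[OF _ null])
    show "{\<omega> \<in> space M. \<not> \<not> (\<exists>l. ((\<lambda>t. B t \<omega>) \<longlongrightarrow> l) at_top)} \<subseteq> (\<Inter>k. \<Union>n. P (1 / real (Suc k)) n)"
    proof (intro subsetI INT_I)
      fix \<omega> k assume "\<omega> \<in> {\<omega> \<in> space M. \<not> \<not> (\<exists>l. ((\<lambda>t. B t \<omega>) \<longlongrightarrow> l) at_top)}"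
      then obtain l where w: "\<omega> \<in> space M" and l: "((\<lambda>t. B t \<omega>) \<longlongrightarrow> l) at_top" by blast
      have s: "(\<lambda>n. B (real n) \<omega>) \<longlonglongrightarrow> l" by (rule filterlim_compose[OF l filterlim_real_sequentially])
      have "(\<lambda>n. B (real (Suc n)) \<omega> - B (real n) \<omega>) \<longlonglongrightarrow> l - l"
        by (intro tendsto_diff s LIMSEQ_Suc[OF s])
      then have "\<forall>\<^sub>F n in sequentially. dist (B (real (Suc n)) \<omega> - B (real n) \<omega>) (l - l) < 1 / real (Suc k)"
        by (rule tendstoD) simp
      then obtain n where "\<And>m. n \<le> m \<Longrightarrow> \<bar>B (real (Suc m)) \<omega> - B (real m) \<omega>\<bar> < 1 / real (Suc k)"
        unfolding eventually_sequentially by (auto simp: dist_real_def)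
      then show "\<omega> \<in> (\<Union>n. P (1 / real (Suc k)) n)"
        using w unfolding P_def by (auto intro: less_imp_le)
    qed
  qed measurable
qed

end

section \<open>Continuous martingales\<close>

text \<open>Rounding down keeps every sampled time within \<open>{0..h}\<close>; continuous paths
  permit it. For \<open>h = 0\<close> the convention \<open>r / 0 = 0\<close> makes the index
  0.\<close>

lemma floor_grid:
  assumes "0 \<le> r" "r \<le> h"
  defines "j \<equiv> \<lambda>N. nat \<lfloor>r / h * real (Suc N)\<rfloor>"
  shows "j N \<le> Suc N" "h * real (j N) / real (Suc N) \<le> r"
    "(\<lambda>N. h * real (j N) / real (Suc N)) \<longlonglongrightarrow> r"
proof -
  have q: "0 \<le> r / h" "r / h \<le> 1" "h * (r / h) = r" using assms by (auto simp: divide_le_eq_1)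
  have key: "h * (r / h * real (Suc N)) / real (Suc N) = r" for N
    using assms by (cases "h = 0") auto
  have jle: "real (j N) \<le> r / h * real (Suc N)" for N
    unfolding j_def using q by (intro of_nat_floor mult_nonneg_nonneg) auto
  have jge: "r / h * real (Suc N) \<le> real (j N) + 1" for N unfolding j_def by linarith
  have "r / h * real (Suc N) \<le> 1 * real (Suc N)" using q by (intro mult_right_mono) auto
  then show "j N \<le> Suc N" using jle[of N] by simp
  have up: "h * real (j N) / real (Suc N) \<le> r" for N
  proof -
    have "h * real (j N) / real (Suc N) \<le> h * (r / h * real (Suc N)) / real (Suc N)"
      using jle[of N] assms by (intro divide_right_mono mult_left_mono) auto
    then show ?thesis unfolding key .
  qed
  then show "h * real (j N) / real (Suc N) \<le> r" .
  have lo: "r - h / real (Suc N) \<le> h * real (j N) / real (Suc N)" for N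
  proof -
    have "r = h * (r / h * real (Suc N)) / real (Suc N)" unfolding key ..
    also have "\<dots> \<le> h * (real (j N) + 1) / real (Suc N)"
      using jge[of N] assms by (intro divide_right_mono mult_left_mono) auto
    also have "\<dots> = h * real (j N) / real (Suc N) + h / real (Suc N)"
      by (simp add: distrib_left add_divide_distrib)
    finally show ?thesis by simp
  qed
  show "(\<lambda>N. h * real (j N) / real (Suc N)) \<longlonglongrightarrow> r"
  proof (rule real_tendsto_sandwich[where f = "\<lambda>N. r - h / real (Suc N)" and h = "\<lambda>_. r"])
    have "(\<lambda>N. r - h * (1 / real (Suc N))) \<longlonglongrightarrow> r - h * 0"
      by (intro tendsto_intros LIMSEQ_Suc[OF lim_1_over_n])
    then show "(\<lambda>N. r - h / real (Suc N)) \<longlonglongrightarrow> r" by simp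
  qed (use lo up in auto)
qed

lemma tendsto_floor_grid:
  assumes x: "continuous_on {0..} x" and r: "0 \<le> r" "r \<le> h"
  shows "(\<lambda>N. x (h * real (nat \<lfloor>r / h * real (Suc N)\<rfloor>) / real (Suc N))) \<longlonglongrightarrow> x r"
  using continuous_on_tendsto_compose[OF x floor_grid(3)[OF r]] r by auto

text \<open>Rational fractions of \<open>h\<close> are used: every sampled time is then at most
  \<open>h\<close>, so the supremum is measurable at time \<open>h\<close>, and \<open>h\<close>
  itself is included even if irrational.\<close>

lemma running_sup_eq_countable:
  assumes x: "continuous_on {0..} x" and h: "0 \<le> h"
  shows "running_sup x h = (SUP q\<in>{0..1} \<inter> \<rat>. x (h * q))"
proof (rule antisym)
  have sub: "(\<lambda>q. x (h * q)) ` ({0..1} \<inter> \<rat>) \<subseteq> x ` {0..h}"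
  proof clarify
    fix q :: real assume "q \<in> {0..1}"
    then show "x (h * q) \<in> x ` {0..h}" using h by (auto intro!: imageI mult_left_le)
  qed
  have bdd: "bdd_above ((\<lambda>q. x (h * q)) ` ({0..1} \<inter> \<rat>))"
    by (rule bdd_above_mono[OF running_sup_bdd_above[OF x] sub])
  show "running_sup x h \<le> (SUP q\<in>{0..1} \<inter> \<rat>. x (h * q))"
    unfolding running_sup_le_iff[OF x h]
  proof
    fix r assume r: "r \<in> {0..h}"
    show "x r \<le> (SUP q\<in>{0..1} \<inter> \<rat>. x (h * q))"
    proof (rule LIMSEQ_le_const2[OF tendsto_floor_grid[OF x]])
      have "x (h * real (nat \<lfloor>r / h * real (Suc N)\<rfloor>) / real (Suc N)) \<le> (SUP q\<in>{0..1} \<inter> \<rat>. x (h * q))" for N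
      proof -
        have q: "real (nat \<lfloor>r / h * real (Suc N)\<rfloor>) / real (Suc N) \<in> {0..1} \<inter> \<rat>"
          using floor_grid(1)[of r h N] r by (auto simp del: of_nat_Suc intro!: Rats_divide)
        show ?thesis using cSUP_upper[OF q bdd] by simp
      qed
      then show "\<exists>N0. \<forall>N\<ge>N0. x (h * real (nat \<lfloor>r / h * real (Suc N)\<rfloor>) / real (Suc N))
          \<le> (SUP q\<in>{0..1} \<inter> \<rat>. x (h * q))" by blast
    qed (use r in auto)
  qed
  show "(SUP q\<in>{0..1} \<inter> \<rat>. x (h * q)) \<le> running_sup x h"
  proof (rule cSUP_least)
    fix q :: real assume "q \<in> {0..1} \<inter> \<rat>"
    then show "x (h * q) \<le> running_sup x h" using h by (intro running_sup_ge[OF x]) (auto intro: mult_left_le)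
  qed (use Rats_0 in force)
qed

lemma measurable_running_sup:
  assumes "\<And>u. 0 \<le> u \<Longrightarrow> u \<le> h \<Longrightarrow> Y u \<in> borel_measurable N" and h: "0 \<le> h"
    and c: "\<And>\<omega>. \<omega> \<in> space N \<Longrightarrow> continuous_on {0..} (\<lambda>u. Y u \<omega>)"
  shows "(\<lambda>\<omega>. running_sup (\<lambda>u. Y u \<omega>) h) \<in> borel_measurable N"
proof -
  have "(\<lambda>\<omega>. SUP q\<in>{0..1} \<inter> \<rat>. Y (h * q) \<omega>) \<in> borel_measurable N"
  proof (rule borel_measurable_cSUP)
    show "countable ({0..1} \<inter> \<rat> :: real set)" by (intro countable_Int2 countable_rat)
    show "Y (h * q) \<in> borel_measurable N" if "q \<in> {0..1} \<inter> \<rat>" for q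
      using that h by (intro assms) (auto intro: mult_left_le)
    fix \<omega> assume w: "\<omega> \<in> space N"
    have "(\<lambda>q. Y (h * q) \<omega>) ` ({0..1} \<inter> \<rat>) \<subseteq> (\<lambda>u. Y u \<omega>) ` {0..h}"
    proof clarify
      fix q :: real assume "q \<in> {0..1}"
      then show "Y (h * q) \<omega> \<in> (\<lambda>u. Y u \<omega>) ` {0..h}" using h by (auto intro!: imageI mult_left_le)
    qed
    then show "bdd_above ((\<lambda>q. Y (h * q) \<omega>) ` ({0..1} \<inter> \<rat>))"
      by (rule bdd_above_mono[OF running_sup_bdd_above[OF c[OF w]]])
  qed
  then show ?thesis using running_sup_eq_countable[OF c h] by (subst measurable_cong)
qed

text \<open>Here \<open>curr_dd x k + x k\<close> is the maximum of \<open>x 0, \<dots>, x k\<close>.\<close>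

lemma doob_pathwise:
  assumes "x 0 = 0"
  shows "(curr_dd x n + x n)\<^sup>2
    \<le> 4 * (x n)\<^sup>2 - 4 * (\<Sum>k<n. (curr_dd x k + x k) * (x (Suc k) - x k))"
proof -
  define m where "m k = curr_dd x k + x k" for k
  have mS: "m (Suc k) = max (x (Suc k)) (m k)" for k by (simp add: m_def max_def)
  \<comment> \<open>Summation by parts. The maximum grows only when it equals \<open>x\<close>, so
    in continuous time this would be an equality; the jumps of a sequence make it an
    inequality.\<close>
  have "(m n)\<^sup>2 \<le> 2 * m n * x n - 2 * (\<Sum>k<n. m k * (x (Suc k) - x k))"
  proof (induction n)
    case 0 then show ?case using assms by (simp add: m_def)
  next
    case (Suc n)
    show ?case
    proof (cases "x (Suc n) \<le> m n")
      case True
      then show ?thesis using Suc mS[of n] by (simp add: algebra_simps)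
    next
      case False
      then have m: "m (Suc n) = x (Suc n)" using mS[of n] by simp
      have "0 \<le> (x (Suc n) - m n)\<^sup>2" by simp
      then show ?thesis using Suc unfolding m by (simp add: power2_eq_square algebra_simps)
    qed
  qed
  \<comment> \<open>Origin of Doob's constant 4: after doubling, the cross term
    \<open>4 * m n * x n\<close> is absorbed by \<open>(m n)^2 + 4 * (x n)^2\<close>.\<close>
  moreover have "0 \<le> (m n - 2 * x n)\<^sup>2" by simp
  ultimately have "(m n)\<^sup>2 \<le> 4 * (x n)\<^sup>2 - 4 * (\<Sum>k<n. m k * (x (Suc k) - x k))"
    by (simp add: power2_eq_square algebra_simps)
  then show ?thesis by (simp add: m_def)
qed

locale continuous_martingale = sq_martingale +
  assumes continuous: "\<omega> \<in> space M \<Longrightarrow> continuous_on {0..} (\<lambda>t. X t \<omega>)"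
    and zero: "\<omega> \<in> space M \<Longrightarrow> X 0 \<omega> = 0"
begin

lemma uminus: "continuous_martingale M F (\<lambda>t \<omega>. - X t \<omega>)"
proof -
  interpret neg: sq_martingale M F "\<lambda>t \<omega>. - X t \<omega>" by (rule sq_martingale_uminus)
  show ?thesis by unfold_locales (auto intro: continuous_on_minus continuous simp: zero)
qed

lemma space_F: "0 \<le> t \<Longrightarrow> space (F t) = space M"
  using subalg by (auto simp: subalgebra_def)

lemma measurable_running_sup_F:
  "0 \<le> h \<Longrightarrow> (\<lambda>\<omega>. running_sup (\<lambda>u. X u \<omega>) h) \<in> borel_measurable (F h)"
  by (rule measurable_running_sup) (auto intro: adapted continuous simp: space_F)

lemma measurable_drawdown_F:
  assumes "0 \<le> u" "u \<le> h" shows "(\<lambda>\<omega>. drawdown (\<lambda>u. X u \<omega>) u) \<in> borel_measurable (F h)"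
  unfolding drawdown_eq using assms
  by (intro borel_measurable_diff measurable_running_sup adapted) (auto intro: adapted continuous simp: space_F)

lemma measurable_max_drawdown_F:
  assumes "0 \<le> u" "u \<le> h" shows "(\<lambda>\<omega>. running_sup (drawdown (\<lambda>u. X u \<omega>)) u) \<in> borel_measurable (F h)"
  using assms
  by (intro measurable_running_sup measurable_drawdown_F)
     (auto intro: continuous_on_drawdown continuous simp: space_F)

lemma mono_grid: "0 \<le> h \<Longrightarrow> mono (\<lambda>k. h * real k / real (Suc N))"
  by (intro monoI divide_right_mono mult_left_mono) auto

section \<open>Square-integrable suprema\<close>

lemma expectation_grid_max_sq:
  assumes g: "mono g" "g 0 = 0"
  shows "integrable M (\<lambda>\<omega>. (curr_dd (\<lambda>k. X (g k) \<omega>) n + X (g n) \<omega>)\<^sup>2)"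
    "(\<integral>\<omega>. (curr_dd (\<lambda>k. X (g k) \<omega>) n + X (g n) \<omega>)\<^sup>2 \<partial>M) \<le> 4 * (\<integral>\<omega>. (X (g n) \<omega>)\<^sup>2 \<partial>M)"
proof -
  define m where "m = (\<lambda>k \<omega>. curr_dd (\<lambda>k. X (g k) \<omega>) k + X (g k) \<omega>)"
  have g': "0 \<le> g 0" using g by simp
  have g0: "0 \<le> g k" for k using g monoD[of g 0 k] by simp
  have gS: "g k \<le> g (Suc k)" for k using g monoD[of g k "Suc k"] by simp
  have mF: "m k \<in> borel_measurable (F (g k))" for k
    unfolding m_def by (intro borel_measurable_add curr_run_dd_adapted[OF g(1) g'] adapted g0 order_refl)
  have i: "integrable M (\<lambda>\<omega>. (m k \<omega>)\<^sup>2)" for k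
    unfolding m_def
    by (intro integrable_square_sum integrable_curr_dd_sq[OF g(1) g'] integrable_sq g0 meas
        from_F[OF g0 curr_run_dd_adapted(1)[OF g(1) g']])
  then show "integrable M (\<lambda>\<omega>. (curr_dd (\<lambda>k. X (g k) \<omega>) n + X (g n) \<omega>)\<^sup>2)" by (simp add: m_def)
  note o = orthogonal_incr[OF g0 gS mF i]
  have "(\<integral>\<omega>. (m n \<omega>)\<^sup>2 \<partial>M) \<le> (\<integral>\<omega>. 4 * (X (g n) \<omega>)\<^sup>2 - 4 * (\<Sum>k<n. m k \<omega> * (X (g (Suc k)) \<omega> - X (g k) \<omega>)) \<partial>M)"
  proof (rule integral_mono[OF i])
    show "integrable M (\<lambda>\<omega>. 4 * (X (g n) \<omega>)\<^sup>2 - 4 * (\<Sum>k<n. m k \<omega> * (X (g (Suc k)) \<omega> - X (g k) \<omega>)))"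
      using o(1) integrable_sq[OF g0] by simp
    fix \<omega> assume "\<omega> \<in> space M"
    then show "(m n \<omega>)\<^sup>2 \<le> 4 * (X (g n) \<omega>)\<^sup>2 - 4 * (\<Sum>k<n. m k \<omega> * (X (g (Suc k)) \<omega> - X (g k) \<omega>))"
      using doob_pathwise[of "\<lambda>k. X (g k) \<omega>" n] g zero by (simp add: m_def)
  qed
  also have "\<dots> = 4 * (\<integral>\<omega>. (X (g n) \<omega>)\<^sup>2 \<partial>M)"
    using o integrable_sq[OF g0] by simp
  finally show "(\<integral>\<omega>. (curr_dd (\<lambda>k. X (g k) \<omega>) n + X (g n) \<omega>)\<^sup>2 \<partial>M) \<le> 4 * (\<integral>\<omega>. (X (g n) \<omega>)\<^sup>2 \<partial>M)"
    by (simp add: m_def)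
qed

text \<open>Doob's inequality on grids and Fatou. It supplies the dominating functions for Ito's
  formula and for optional stopping.\<close>

lemma integrable_running_sup_sq:
  assumes h: "0 \<le> h"
  shows "integrable M (\<lambda>\<omega>. (running_sup (\<lambda>u. X u \<omega>) h)\<^sup>2)"
proof -
  define g where "g N k = h * real k / real (Suc N)" for N k
  define m where "m N \<omega> = curr_dd (\<lambda>k. X (g N k) \<omega>) (Suc N) + X (g N (Suc N)) \<omega>" for N \<omega>
  have g: "mono (g N)" "g N 0 = 0" "g N (Suc N) = h" for N
    using mono_grid[OF h, of N] by (auto simp: g_def[abs_def])
  have Rm[measurable]: "(\<lambda>\<omega>. running_sup (\<lambda>u. X u \<omega>) h) \<in> borel_measurable M"
    by (rule from_F[OF h measurable_running_sup_F[OF h]])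
  note e = expectation_grid_max_sq[OF g(1,2), where n = "Suc _"]
  have m1: "integrable M (\<lambda>\<omega>. (m N \<omega>)\<^sup>2)" "(\<integral>\<omega>. (m N \<omega>)\<^sup>2 \<partial>M) \<le> 4 * (\<integral>\<omega>. (X h \<omega>)\<^sup>2 \<partial>M)" for N
    using e[of N N] unfolding m_def g(3) by auto
  have "(\<integral>\<^sup>+\<omega>. ennreal ((running_sup (\<lambda>u. X u \<omega>) h)\<^sup>2) \<partial>M)
      \<le> (\<integral>\<^sup>+\<omega>. liminf (\<lambda>N. ennreal ((m N \<omega>)\<^sup>2)) \<partial>M)"
  proof (rule nn_integral_mono)
    fix \<omega> assume w: "\<omega> \<in> space M"
    let ?x = "\<lambda>u. X u \<omega>"
    obtain u where u: "0 \<le> u" "u \<le> h" "running_sup ?x h = ?x u"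
      using running_sup_attained[OF continuous[OF w] h] by blast
    have R0: "0 \<le> running_sup ?x h" using running_sup_ge[OF continuous[OF w], of 0 h] h zero[OF w] by simp
    let ?p = "\<lambda>N. h * real (nat \<lfloor>u / h * real (Suc N)\<rfloor>) / real (Suc N)"
    \<comment> \<open>The path starts at 0, so truncating at 0 does not change its supremum; it
      makes squaring monotone.\<close>
    have "(\<lambda>N. ennreal ((max 0 (?x (?p N)))\<^sup>2)) \<longlonglongrightarrow> ennreal ((max 0 (?x u))\<^sup>2)"
      by (intro tendsto_ennrealI tendsto_power tendsto_max tendsto_const tendsto_floor_grid[OF continuous[OF w]] u)
    moreover have "running_sup ?x h = max 0 (?x u)" using R0 u(3) by simp
    ultimately have "ennreal ((running_sup ?x h)\<^sup>2) = liminf (\<lambda>N. ennreal ((max 0 (?x (?p N)))\<^sup>2))"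
      by (simp only: lim_imp_Liminf[OF sequentially_bot])
    also have "\<dots> \<le> liminf (\<lambda>N. ennreal ((m N \<omega>)\<^sup>2))"
    proof (intro Liminf_mono always_eventually allI ennreal_leI power_mono)
      fix N
      have "X (g N (nat \<lfloor>u / h * real (Suc N)\<rfloor>)) \<omega> \<le> m N \<omega>"
        using curr_dd_ge[OF floor_grid(1)[OF u(1,2)], of "\<lambda>k. X (g N k) \<omega>" N] by (simp add: m_def)
      moreover have "X (g N 0) \<omega> \<le> m N \<omega>"
        using curr_dd_ge[of 0 "Suc N" "\<lambda>k. X (g N k) \<omega>"] by (simp add: m_def)
      ultimately show "max 0 (?x (?p N)) \<le> m N \<omega>"
        using zero[OF w] g(2)[of N] by (simp add: g_def)
    qed simp
    finally show "ennreal ((running_sup ?x h)\<^sup>2) \<le> liminf (\<lambda>N. ennreal ((m N \<omega>)\<^sup>2))" .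
  qed
  also have "\<dots> \<le> liminf (\<lambda>N. \<integral>\<^sup>+\<omega>. ennreal ((m N \<omega>)\<^sup>2) \<partial>M)"
    using m1(1) by (intro nn_integral_liminf measurable_compose[OF borel_measurable_integrable measurable_ennreal]) auto
  also have "\<dots> \<le> ennreal (4 * (\<integral>\<omega>. (X h \<omega>)\<^sup>2 \<partial>M))"
    using m1 by (intro Liminf_le always_eventually allI) (auto simp: nn_integral_eq_integral intro: ennreal_leI)
  finally show ?thesis by (intro integrableI_bounded) (auto simp: order.strict_trans1)
qed

text \<open>Both summands are nonnegative because \<open>X 0 = 0\<close>, so their sum dominates the
  absolute values, and it is square integrable by the result for \<open>X\<close> and for
  \<open>- X\<close>.\<close>

definition sup_abs where
  "sup_abs h \<omega> = running_sup (\<lambda>u. X u \<omega>) h + running_sup (\<lambda>u. - X u \<omega>) h"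

lemma abs_le_sup_abs:
  assumes "\<omega> \<in> space M" "0 \<le> u" "u \<le> h" shows "\<bar>X u \<omega>\<bar> \<le> sup_abs h \<omega>"
proof -
  have c: "continuous_on {0..} (\<lambda>u. X u \<omega>)" "continuous_on {0..} (\<lambda>u. - X u \<omega>)"
    using continuous[OF assms(1)] by (auto intro: continuous_on_minus)
  have "0 \<le> h" using assms by simp
  then show ?thesis
    using running_sup_ge[OF c(1), of u h] running_sup_ge[OF c(2), of u h]
      running_sup_ge[OF c(1), of 0 h] running_sup_ge[OF c(2), of 0 h] zero[OF assms(1)] assms
    unfolding sup_abs_def by auto
qed

lemma sup_abs_L2:
  assumes "0 \<le> h"
  shows "sup_abs h \<in> borel_measurable M" "integrable M (\<lambda>\<omega>. (sup_abs h \<omega>)\<^sup>2)"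
proof -
  interpret neg: continuous_martingale M F "\<lambda>t \<omega>. - X t \<omega>" by (rule uminus)
  have m: "(\<lambda>\<omega>. running_sup (\<lambda>u. X u \<omega>) h) \<in> borel_measurable M"
      "(\<lambda>\<omega>. running_sup (\<lambda>u. - X u \<omega>) h) \<in> borel_measurable M"
    using from_F[OF assms] measurable_running_sup_F[OF assms] neg.measurable_running_sup_F[OF assms] by auto
  show "sup_abs h \<in> borel_measurable M" unfolding sup_abs_def[abs_def] using m by simp
  show "integrable M (\<lambda>\<omega>. (sup_abs h \<omega>)\<^sup>2)"
    unfolding sup_abs_def
    by (intro integrable_square_sum m integrable_running_sup_sq neg.integrable_running_sup_sq assms)
qed

text \<open>The drawdown bound at a finite horizon, usable before boundedness of the second moments
  in time is known.\<close>

lemma expectation_max_drawdown_until: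
  assumes h: "0 \<le> h" and e: "0 < e"
  shows "(\<integral>\<^sup>+\<omega>. ennreal (running_sup (drawdown (\<lambda>u. X u \<omega>)) h) \<partial>M) \<le> ennreal (e + (\<integral>\<omega>. (X h \<omega>)\<^sup>2 \<partial>M) / (2 * e))"
proof -
  define g where "g N k = h * real k / real (Suc N)" for N k
  have g: "mono (g N)" "g N 0 = 0" "g N (Suc N) = h" for N
    using mono_grid[OF h, of N] by (auto simp: g_def[abs_def])
  define D where "D N \<omega> = run_dd (\<lambda>k. X (g N k) \<omega>) (Suc N)" for N \<omega>
  have "(\<integral>\<omega>. (X h \<omega> - X 0 \<omega>)\<^sup>2 \<partial>M) = (\<integral>\<omega>. (X h \<omega>)\<^sup>2 \<partial>M)"
    using zero by (intro Bochner_Integration.integral_cong) auto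
  then have D: "integrable M (D N)" "(\<integral>\<omega>. D N \<omega> \<partial>M) \<le> e + (\<integral>\<omega>. (X h \<omega>)\<^sup>2 \<partial>M) / (2 * e)" for N
    using expectation_run_dd[OF e g(1), of N "Suc N"] unfolding D_def[abs_def] g by auto
  have "(\<integral>\<^sup>+\<omega>. ennreal (running_sup (drawdown (\<lambda>u. X u \<omega>)) h) \<partial>M) \<le> (\<integral>\<^sup>+\<omega>. liminf (\<lambda>N. ennreal (D N \<omega>)) \<partial>M)"
  proof (rule nn_integral_mono)
    fix \<omega> assume w: "\<omega> \<in> space M"
    let ?x = "\<lambda>u. X u \<omega>"
    obtain v where v: "0 \<le> v" "v \<le> h" "running_sup (drawdown ?x) h = drawdown ?x v"
      using running_sup_attained[OF continuous_on_drawdown[OF continuous[OF w]] h] by blast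
    obtain u where u: "0 \<le> u" "u \<le> v" "running_sup ?x v = ?x u"
      using running_sup_attained[OF continuous[OF w] v(1)] by blast
    let ?i = "\<lambda>N r. nat \<lfloor>r / h * real (Suc N)\<rfloor>"
    have "(\<lambda>N. ennreal (?x (g N (?i N u)) - ?x (g N (?i N v)))) \<longlonglongrightarrow> ennreal (?x u - ?x v)"
      unfolding g_def using u v
      by (intro tendsto_ennrealI tendsto_diff tendsto_floor_grid[OF continuous[OF w]]) auto
    moreover have "running_sup (drawdown ?x) h = ?x u - ?x v" using u(3) v(3) by (simp add: drawdown_eq)
    ultimately have "ennreal (running_sup (drawdown ?x) h) = liminf (\<lambda>N. ennreal (?x (g N (?i N u)) - ?x (g N (?i N v))))"
      by (simp only: lim_imp_Liminf[OF sequentially_bot])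
    also have "\<dots> \<le> liminf (\<lambda>N. ennreal (D N \<omega>))"
    proof (intro Liminf_mono always_eventually allI ennreal_leI)
      fix N
      have "?i N u \<le> ?i N v"
        using u h by (intro nat_mono floor_mono mult_right_mono divide_right_mono) auto
      then show "?x (g N (?i N u)) - ?x (g N (?i N v)) \<le> D N \<omega>"
        unfolding D_def by (rule run_dd_ge[OF _ floor_grid(1)[OF v(1,2)]])
    qed
    finally show "ennreal (running_sup (drawdown ?x) h) \<le> liminf (\<lambda>N. ennreal (D N \<omega>))" .
  qed
  also have "\<dots> \<le> liminf (\<lambda>N. \<integral>\<^sup>+\<omega>. ennreal (D N \<omega>) \<partial>M)"
    using D(1) by (intro nn_integral_liminf measurable_compose[OF borel_measurable_integrable measurable_ennreal]) auto
  also have "\<dots> \<le> ennreal (e + (\<integral>\<omega>. (X h \<omega>)\<^sup>2 \<partial>M) / (2 * e))"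
  proof (intro Liminf_le always_eventually allI)
    fix N
    have "0 \<le> D N \<omega>" for \<omega> unfolding D_def by (rule run_dd_nonneg)
    then show "(\<integral>\<^sup>+\<omega>. ennreal (D N \<omega>) \<partial>M) \<le> ennreal (e + (\<integral>\<omega>. (X h \<omega>)\<^sup>2 \<partial>M) / (2 * e))"
      using D[of N] by (simp add: nn_integral_eq_integral ennreal_leI)
  qed simp
  finally show ?thesis .
qed

text \<open>Ito's formula for \<open>d * excess + (drawdown - excess)\<^sup>2 / 2 - X\<^sup>2 / 2\<close>, in expectation.\<close>

lemma excess_identity:
  assumes d: "0 < d" and h: "0 \<le> h"
    and fall: "\<And>\<omega> t. \<omega> \<in> space M \<Longrightarrow> 0 \<le> t \<Longrightarrow> drawdown (drawdown (\<lambda>u. X u \<omega>)) t \<le> d"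
  defines "b \<equiv> \<lambda>\<omega>. drawdown_excess d (\<lambda>u. X u \<omega>) h"
  shows "integrable M b"
    "(\<integral>\<omega>. (X h \<omega>)\<^sup>2 \<partial>M) = 2 * d * (\<integral>\<omega>. b \<omega> \<partial>M) + (\<integral>\<omega>. (drawdown (\<lambda>u. X u \<omega>) h - b \<omega>)\<^sup>2 \<partial>M)"
proof -
  have fp: "fall_path (\<lambda>u. X u \<omega>) d h" if "\<omega> \<in> space M" for \<omega>
    using that continuous zero d h fall by unfold_locales auto
  have S: "\<bar>X u \<omega>\<bar> \<le> sup_abs h \<omega>" if "\<omega> \<in> space M" "0 \<le> u" "u \<le> h" for u \<omega>
    using abs_le_sup_abs that by blast
  note S2 = sup_abs_L2[OF h]
  have S1: "integrable M (sup_abs h)" by (rule square_integrable_imp_integrable[OF S2])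
  define Z where "Z t \<omega> = reduced_sup d (\<lambda>u. X u \<omega>) t" for t \<omega>
  have ZF: "Z t \<in> borel_measurable (F t)" if "0 \<le> t" for t
    unfolding Z_def[abs_def] reduced_sup_def drawdown_excess_def
    using that by (intro borel_measurable_diff borel_measurable_max borel_measurable_const
        measurable_running_sup_F measurable_max_drawdown_F) auto
  have Zm: "Z t \<in> borel_measurable M" if "0 \<le> t" for t using from_F[OF that ZF[OF that]] .
  have bm: "b \<in> borel_measurable M"
    unfolding b_def drawdown_excess_def
    by (intro from_F[OF h] borel_measurable_diff borel_measurable_max borel_measurable_const
        measurable_max_drawdown_F h order_refl)
  note bnd = fall_path.sup_bounds[OF fp, where S = "sup_abs h _", OF _ S]
  have Zsq: "integrable M (\<lambda>\<omega>. (Z t \<omega>)\<^sup>2)" if t: "0 \<le> t" "t \<le> h" for t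
  proof (rule Bochner_Integration.integrable_bound[of M "\<lambda>\<omega>. (2 * sup_abs h \<omega>)\<^sup>2"])
    show "integrable M (\<lambda>\<omega>. (2 * sup_abs h \<omega>)\<^sup>2)" using S2(2) by (simp add: power_mult_distrib)
    show "AE \<omega> in M. norm ((Z t \<omega>)\<^sup>2) \<le> norm ((2 * sup_abs h \<omega>)\<^sup>2)"
    proof (intro AE_I2)
      fix \<omega> assume w: "\<omega> \<in> space M"
      have "\<bar>Z t \<omega>\<bar> \<le> 2 * sup_abs h \<omega>" using bnd(5)[OF w w _ _ t] unfolding Z_def by blast
      then have "(Z t \<omega>)\<^sup>2 \<le> (2 * sup_abs h \<omega>)\<^sup>2" by (metis abs_le_square_iff abs_ge_self order_trans)
      then show "norm ((Z t \<omega>)\<^sup>2) \<le> norm ((2 * sup_abs h \<omega>)\<^sup>2)" by simp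
    qed
  qed (use Zm[OF t(1)] in simp)
  show bi: "integrable M b"
  proof (rule Bochner_Integration.integrable_bound[of M "\<lambda>\<omega>. 2 * sup_abs h \<omega>"])
    show "AE \<omega> in M. norm (b \<omega>) \<le> norm (2 * sup_abs h \<omega>)"
    proof (intro AE_I2)
      fix \<omega> assume w: "\<omega> \<in> space M"
      show "norm (b \<omega>) \<le> norm (2 * sup_abs h \<omega>)"
        using bnd(3,4)[OF w w _ _ h order_refl] unfolding b_def by fastforce
    qed
  qed (use S1 bm in auto)
  define g where "g N k = h * real k / real (Suc N)" for N k
  have g0: "0 \<le> g N k" and gS: "g N k \<le> g N (Suc k)" for N k
    unfolding g_def using h by (auto intro!: divide_right_mono mult_left_mono)
  have gh: "g N k \<le> h" if "k < Suc N" for N k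
  proof -
    have "h * real k \<le> h * real (Suc N)" using that h by (intro mult_left_mono) auto
    then show ?thesis unfolding g_def by (simp add: divide_le_eq)
  qed
  define V where "V \<omega> = d * b \<omega> + (Z h \<omega>)\<^sup>2 / 2 - Z h \<omega> * X h \<omega>" for \<omega>
  define E where "E N \<omega> = riemann_error d (\<lambda>u. X u \<omega>) h N" for N \<omega>
  have E_eq: "E N \<omega> = V \<omega> + (\<Sum>k<Suc N. Z (g N k) \<omega> * (X (g N (Suc k)) \<omega> - X (g N k) \<omega>))" for N \<omega>
    unfolding E_def riemann_error_def V_def Z_def g_def b_def ..
  have ZX: "integrable M (\<lambda>\<omega>. Z h \<omega> * X h \<omega>)"
    by (intro integrable_square_product Zm meas Zsq integrable_sq h order_refl)
  have Vi: "integrable M V"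
    unfolding V_def[abs_def] using bi Zsq[OF h order_refl] ZX by simp
  note o = orthogonal_incr[OF g0 gS ZF[OF g0] Zsq[OF g0 gh]]
  have Ei: "integrable M (E N)" and EE: "(\<integral>\<omega>. E N \<omega> \<partial>M) = (\<integral>\<omega>. V \<omega> \<partial>M)" for N
  proof -
    have i: "integrable M (\<lambda>\<omega>. \<Sum>k<Suc N. Z (g N k) \<omega> * (X (g N (Suc k)) \<omega> - X (g N k) \<omega>))"
      by (intro Bochner_Integration.integrable_sum o(1)) auto
    have "(\<integral>\<omega>. (\<Sum>k<Suc N. Z (g N k) \<omega> * (X (g N (Suc k)) \<omega> - X (g N k) \<omega>)) \<partial>M)
      = (\<Sum>k<Suc N. \<integral>\<omega>. Z (g N k) \<omega> * (X (g N (Suc k)) \<omega> - X (g N k) \<omega>) \<partial>M)"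
      by (intro Bochner_Integration.integral_sum o(1)) auto
    also have "\<dots> = 0" by (intro sum.neutral ballI o(2)) auto
    finally show "(\<integral>\<omega>. E N \<omega> \<partial>M) = (\<integral>\<omega>. V \<omega> \<partial>M)" unfolding E_eq using Vi i by simp
    show "integrable M (E N)" unfolding E_eq[abs_def] using Vi i by simp
  qed
  \<comment> \<open>Every \<open>E N\<close> has the mean of \<open>V\<close>, because the grid sum
    is a martingale transform; on the other hand \<open>E N\<close> tends to 0 pathwise. So
    \<open>V\<close> has mean zero.\<close>
  have "(\<lambda>N. \<integral>\<omega>. E N \<omega> \<partial>M) \<longlonglongrightarrow> (\<integral>\<omega>. 0 \<partial>M)"
  proof (rule integral_dominated_convergence[where w = "\<lambda>\<omega>. 18 * (sup_abs h \<omega>)\<^sup>2"])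
    show "AE \<omega> in M. (\<lambda>N. E N \<omega>) \<longlonglongrightarrow> 0"
      unfolding E_def by (intro AE_I2 fall_path.riemann_error_tendsto fp)
    show "AE \<omega> in M. norm (E N \<omega>) \<le> 18 * (sup_abs h \<omega>)\<^sup>2" for N
    proof (intro AE_I2)
      fix \<omega> assume w: "\<omega> \<in> space M"
      show "norm (E N \<omega>) \<le> 18 * (sup_abs h \<omega>)\<^sup>2"
        unfolding E_def real_norm_def by (rule fall_path.riemann_error_dominated[OF fp[OF w] S[OF w]])
    qed
  qed (use Ei S2 in auto)
  then have V0: "(\<integral>\<omega>. V \<omega> \<partial>M) = 0" unfolding EE by (simp add: LIMSEQ_const_iff)
  have sq: "(drawdown (\<lambda>u. X u \<omega>) h - b \<omega>)\<^sup>2 = 2 * (V \<omega> - d * b \<omega>) + (X h \<omega>)\<^sup>2" for \<omega>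
    unfolding V_def Z_def reduced_sup_def b_def drawdown_eq by (simp add: power2_eq_square field_simps)
  have "(\<integral>\<omega>. (drawdown (\<lambda>u. X u \<omega>) h - b \<omega>)\<^sup>2 \<partial>M) = - 2 * d * (\<integral>\<omega>. b \<omega> \<partial>M) + (\<integral>\<omega>. (X h \<omega>)\<^sup>2 \<partial>M)"
    unfolding sq using Vi bi integrable_sq[OF h] V0 by simp
  then show "(\<integral>\<omega>. (X h \<omega>)\<^sup>2 \<partial>M) = 2 * d * (\<integral>\<omega>. b \<omega> \<partial>M) + (\<integral>\<omega>. (drawdown (\<lambda>u. X u \<omega>) h - b \<omega>)\<^sup>2 \<partial>M)"
    by simp
qed

end

section \<open>Optional stopping\<close>

text \<open>The time change behind stopping, for a single path. Stopped drawdowns thereby reduce to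
  drawdowns of the original path at the clipped time.\<close>

definition clip :: "ereal \<Rightarrow> real \<Rightarrow> real" where
  "clip \<tau> t = real_of_ereal (min (ereal t) \<tau>)"

lemma stopped_process_eq: "stopped_process X T t \<omega> = X (clip (T \<omega>) t) \<omega>"
  by (simp add: stopped_process_def clip_def)

lemma clip_below: "ereal t \<le> \<tau> \<Longrightarrow> clip \<tau> t = t"
  by (simp add: clip_def min_absorb1)

lemma clip_above: "0 \<le> \<tau> \<Longrightarrow> \<tau> \<le> ereal t \<Longrightarrow> ereal (clip \<tau> t) = \<tau>"
  by (cases \<tau>) (auto simp: clip_def)

lemma clip_bounds:
  assumes "0 \<le> \<tau>" "0 \<le> t"
  shows "0 \<le> clip \<tau> t" "clip \<tau> t \<le> t" "ereal (clip \<tau> t) \<le> \<tau>"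
  using assms by (cases \<tau>; auto simp: clip_def min_def)+

lemma clip_mono: "0 \<le> \<tau> \<Longrightarrow> s \<le> t \<Longrightarrow> clip \<tau> s \<le> clip \<tau> t"
  by (cases \<tau>) (auto simp: clip_def min_def)

lemma clip_id: "0 \<le> \<tau> \<Longrightarrow> 0 \<le> t \<Longrightarrow> s \<le> clip \<tau> t \<Longrightarrow> clip \<tau> s = s"
  using clip_bounds(3)[of \<tau> t] by (intro clip_below) (meson ereal_less_eq(3) order_trans)

lemma continuous_on_clip: "0 \<le> \<tau> \<Longrightarrow> continuous_on {0..} (clip \<tau>)"
proof (cases \<tau>)
  case (real r)
  then have "clip \<tau> = (\<lambda>t. min t r)" by (auto simp: clip_def min_def)
  then show ?thesis by (auto intro: continuous_intros)
qed (auto simp: clip_def[abs_def])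

lemma clip_image: "0 \<le> \<tau> \<Longrightarrow> 0 \<le> t \<Longrightarrow> clip \<tau> ` {0..t} = {0..clip \<tau> t}"
proof safe
  fix u assume a: "0 \<le> \<tau>" "0 \<le> t" "u \<in> {0..t}"
  then show "clip \<tau> u \<in> {0..clip \<tau> t}" using clip_bounds[of \<tau> u] clip_mono[of \<tau> u t] by auto
next
  fix u assume a: "0 \<le> \<tau>" "0 \<le> t" "u \<in> {0..clip \<tau> t}"
  then show "u \<in> clip \<tau> ` {0..t}"
    using clip_id[of \<tau> t u] clip_bounds[of \<tau> t] by (intro image_eqI[of _ _ u]) auto
qed

context
  fixes \<tau> :: ereal and x :: "real \<Rightarrow> real"
  assumes \<tau>: "0 \<le> \<tau>"
begin

lemma running_sup_clip: "0 \<le> t \<Longrightarrow> running_sup (\<lambda>u. x (clip \<tau> u)) t = running_sup x (clip \<tau> t)"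
  using clip_image[OF \<tau>, of t] unfolding running_sup_def by (metis image_image)

lemma drawdown_clip: "0 \<le> t \<Longrightarrow> drawdown (\<lambda>u. x (clip \<tau> u)) t = drawdown x (clip \<tau> t)"
  by (simp add: drawdown_eq running_sup_clip)

end

lemma running_sup_drawdown_clip:
  assumes "0 \<le> \<tau>" "0 \<le> t"
  shows "running_sup (drawdown (\<lambda>u. x (clip \<tau> u))) t = running_sup (drawdown x) (clip \<tau> t)"
proof -
  have "running_sup (drawdown (\<lambda>u. x (clip \<tau> u))) t = running_sup (\<lambda>u. drawdown x (clip \<tau> u)) t"
    unfolding running_sup_def using assms by (intro SUP_cong refl drawdown_clip) auto
  then show ?thesis using running_sup_clip[OF assms] by simp
qed

lemma max_drawdown_clip:
  assumes \<tau>: "0 \<le> \<tau>" and x: "continuous_on {0..} x"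
  shows "max_drawdown (\<lambda>t. x (clip \<tau> t)) = max_drawdown_until \<tau> x"
proof (rule antisym)
  show "max_drawdown (\<lambda>t. x (clip \<tau> t)) \<le> max_drawdown_until \<tau> x"
    unfolding max_drawdown_le_iff
  proof (intro allI impI)
    fix s t :: real assume st: "0 \<le> s" "s \<le> t"
    then have "x (clip \<tau> s) - x (clip \<tau> t) \<le> drawdown x (clip \<tau> t)"
      using running_sup_ge[OF x, of "clip \<tau> s" "clip \<tau> t"] clip_bounds[OF \<tau>, of s] clip_mono[OF \<tau>, of s t]
      by (simp add: drawdown_eq)
    moreover have "ereal (drawdown x (clip \<tau> t)) \<le> max_drawdown_until \<tau> x"
      unfolding max_drawdown_until_def using clip_bounds[OF \<tau>, of t] st by (intro SUP_upper) auto
    ultimately show "ereal (x (clip \<tau> s) - x (clip \<tau> t)) \<le> max_drawdown_until \<tau> x"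
      by (meson ereal_less_eq(3) order_trans)
  qed
  show "max_drawdown_until \<tau> x \<le> max_drawdown (\<lambda>t. x (clip \<tau> t))"
    unfolding max_drawdown_until_def
  proof (rule SUP_least, clarify)
    fix s assume s: "0 \<le> s" "ereal s \<le> \<tau>"
    obtain u where u: "0 \<le> u" "u \<le> s" "running_sup x s = x u" using running_sup_attained[OF x s(1)] by blast
    have "ereal u \<le> \<tau>" using u(2) s(2) by (meson ereal_less_eq(3) order_trans)
    then have "ereal (drawdown x s) = ereal (x (clip \<tau> u) - x (clip \<tau> s))"
      using u(3) s(2) by (simp add: drawdown_eq clip_below)
    also have "\<dots> \<le> max_drawdown (\<lambda>t. x (clip \<tau> t))" by (rule max_drawdown_ge[OF u(1,2)])
    finally show "ereal (drawdown x s) \<le> max_drawdown (\<lambda>t. x (clip \<tau> t))" .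
  qed
qed

lemma max_drawdown_ge_running_sup:
  assumes x: "continuous_on {0..} x" and h: "0 \<le> h"
  shows "ereal (running_sup (drawdown x) h) \<le> max_drawdown x"
proof -
  obtain v where v: "0 \<le> v" "v \<le> h" "running_sup (drawdown x) h = drawdown x v"
    using running_sup_attained[OF continuous_on_drawdown[OF x] h] by blast
  obtain u where u: "0 \<le> u" "u \<le> v" "running_sup x v = x u"
    using running_sup_attained[OF x v(1)] by blast
  then show ?thesis using max_drawdown_ge[OF u(1,2)] v by (simp add: drawdown_eq)
qed

section \<open>Stopping as a limit of martingale transforms\<close>

text \<open>The integrand is the indicator that \<open>\<tau>\<close> exceeds the left endpoint. For
  a stopping time it is known at that endpoint.\<close>

definition stopped_sum :: "(real \<Rightarrow> real) \<Rightarrow> ereal \<Rightarrow> real \<Rightarrow> real \<Rightarrow> nat \<Rightarrow> real" where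
  "stopped_sum x \<tau> s t N = (\<Sum>k<Suc N. if \<tau> \<le> ereal (s + (t - s) * real k / real (Suc N)) then 0
     else x (s + (t - s) * real (Suc k) / real (Suc N)) - x (s + (t - s) * real k / real (Suc N)))"

text \<open>Only the interval containing \<open>\<tau>\<close> contributes to the difference.\<close>

lemma stopped_sum_approx:
  assumes \<tau>: "0 \<le> \<tau>" and st: "0 \<le> s" "s \<le> t"
    and w: "\<And>u v. s \<le> u \<Longrightarrow> u \<le> t \<Longrightarrow> s \<le> v \<Longrightarrow> v \<le> t \<Longrightarrow> \<bar>u - v\<bar> \<le> (t - s) / real (Suc N) \<Longrightarrow> \<bar>x u - x v\<bar> \<le> w"
  shows "\<bar>stopped_sum x \<tau> s t N - (x (clip \<tau> t) - x (clip \<tau> s))\<bar> \<le> w"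
proof -
  define g where "g k = s + (t - s) * real k / real (Suc N)" for k
  have g0: "g 0 = s" and gN: "g (Suc N) = t" by (auto simp: g_def)
  have gd: "g (Suc k) - g k = (t - s) / real (Suc N)" for k
    unfolding g_def by (simp add: diff_divide_distrib[symmetric] right_diff_distrib[symmetric])
  have gS: "g k \<le> g (Suc k)" for k using gd[of k] st by (smt (verit) divide_nonneg_nonneg of_nat_0_le_iff)
  have gs: "s \<le> g k" for k by (induction k) (use g0 gS in \<open>auto intro: order_trans\<close>)
  have gt: "g k \<le> t" if "k \<le> Suc N" for k
    using that by (induction rule: inc_induct) (use gN gS in \<open>auto intro: order_trans\<close>)
  have w0: "0 \<le> w" using w[of s s] st by simp
  define E where "E n = (\<Sum>k<n. if \<tau> \<le> ereal (g k) then 0 else x (g (Suc k)) - x (g k)) - (x (clip \<tau> (g n)) - x (clip \<tau> s))" for n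
  have "\<bar>E n\<bar> \<le> (if \<tau> < ereal (g n) then w else 0)" if "n \<le> Suc N" for n
    using that
  proof (induction n)
    case 0 then show ?case using w0 by (simp add: E_def g0)
  next
    case (Suc n)
    have IH: "\<bar>E n\<bar> \<le> (if \<tau> < ereal (g n) then w else 0)" using Suc by simp
    have ES: "E (Suc n) = E n + (if \<tau> \<le> ereal (g n) then 0 else x (g (Suc n)) - x (g n))
        - (x (clip \<tau> (g (Suc n))) - x (clip \<tau> (g n)))" by (simp add: E_def)
    consider "\<tau> \<le> ereal (g n)" | "ereal (g n) < \<tau>" "\<tau> < ereal (g (Suc n))" | "ereal (g (Suc n)) \<le> \<tau>"
      by (meson leI)
    then show ?case
    proof cases
      case 1
      then have "\<tau> \<le> ereal (g (Suc n))" using gS[of n] by (meson ereal_less_eq(3) order_trans)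
      then have "clip \<tau> (g (Suc n)) = clip \<tau> (g n)"
        using 1 clip_above[OF \<tau>] by (metis ereal.inject)
      moreover have "\<tau> < ereal (g n) \<Longrightarrow> \<tau> < ereal (g (Suc n))"
        using gS[of n] by (meson ereal_less_eq(3) less_le_trans)
      ultimately show ?thesis using 1 IH ES w0 by (auto split: if_splits)
    next
      case 2
      let ?r = "clip \<tau> (g (Suc n))"
      have r: "ereal ?r = \<tau>" using clip_above[OF \<tau>] 2 by (simp add: less_imp_le)
      then have r': "g n \<le> ?r" "?r \<le> g (Suc n)" using 2 by (metis ereal_less_eq(3) less_imp_le)+
      have "\<not> \<tau> < ereal (g n)" using 2(1) by (simp add: not_less less_imp_le)
      then have "E n = 0" using IH by simp
      moreover have "clip \<tau> (g n) = g n" using 2 by (simp add: clip_below less_imp_le)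
      ultimately have "E (Suc n) = x (g (Suc n)) - x ?r" using ES 2(1)[folded not_le] by simp
      also have "\<bar>\<dots>\<bar> \<le> w"
        using r' gs[of n] gt[OF Suc.prems] gd[of n] by (intro w) linarith+
      finally show ?thesis using 2 by simp
    next
      case 3
      then have "ereal (g n) \<le> \<tau>" using gS[of n] by (meson ereal_less_eq(3) order_trans)
      then have cl: "clip \<tau> (g n) = g n" "clip \<tau> (g (Suc n)) = g (Suc n)" using 3 by (auto simp: clip_below)
      have "E n = 0" using IH \<open>ereal (g n) \<le> \<tau>\<close> by (auto split: if_splits)
      moreover have "g (Suc n) = g n" if "\<tau> \<le> ereal (g n)"
      proof -
        have "ereal (g (Suc n)) \<le> ereal (g n)" using 3 that by (rule order_trans)
        then show ?thesis using gS[of n] by simp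
      qed
      ultimately have "E (Suc n) = 0" using ES cl by auto
      then show ?thesis using w0 by simp
    qed
  qed
  from this[of "Suc N"] have "\<bar>E (Suc N)\<bar> \<le> w" using w0 by (auto split: if_splits)
  then show ?thesis unfolding E_def stopped_sum_def gN g_def[symmetric] .
qed

lemma stopped_sum_tendsto:
  assumes \<tau>: "0 \<le> \<tau>" and st: "0 \<le> s" "s \<le> t" and x: "continuous_on {0..} x"
  shows "stopped_sum x \<tau> s t \<longlonglongrightarrow> x (clip \<tau> t) - x (clip \<tau> s)"
proof (rule LIMSEQ_I)
  fix r :: real assume r: "0 < r"
  have "uniformly_continuous_on {0..t} x"
    by (intro compact_uniformly_continuous continuous_on_subset[OF x]) auto
  then have "\<exists>\<delta>>0. \<forall>u\<in>{0..t}. \<forall>v\<in>{0..t}. dist v u < \<delta> \<longrightarrow> dist (x v) (x u) < r / 2"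
    using half_gt_zero[OF r] unfolding uniformly_continuous_on_def by (elim allE[of _ "r / 2"]) simp
  then obtain \<delta> where \<delta>: "0 < \<delta>" "\<And>u v. u \<in> {0..t} \<Longrightarrow> v \<in> {0..t} \<Longrightarrow> dist u v < \<delta> \<Longrightarrow> dist (x u) (x v) < r / 2"
    by blast
  have "(\<lambda>N. (t - s) * (1 / real (Suc N))) \<longlonglongrightarrow> (t - s) * 0"
    by (intro tendsto_mult tendsto_const LIMSEQ_Suc[OF lim_1_over_n])
  then have "\<forall>\<^sub>F N in sequentially. (t - s) * (1 / real (Suc N)) < \<delta>"
    using order_tendstoD(2)[of _ "(t - s) * 0" sequentially \<delta>] \<delta>(1) by simp
  then obtain N0 where N0: "\<And>N. N0 \<le> N \<Longrightarrow> (t - s) / real (Suc N) < \<delta>"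
    unfolding eventually_sequentially by auto
  have "norm (stopped_sum x \<tau> s t N - (x (clip \<tau> t) - x (clip \<tau> s))) < r" if "N0 \<le> N" for N
  proof -
    have "\<bar>stopped_sum x \<tau> s t N - (x (clip \<tau> t) - x (clip \<tau> s))\<bar> \<le> r / 2"
    proof (rule stopped_sum_approx[OF \<tau> st])
      fix u v assume "s \<le> u" "u \<le> t" "s \<le> v" "v \<le> t" "\<bar>u - v\<bar> \<le> (t - s) / real (Suc N)"
      then have "dist (x u) (x v) < r / 2" using N0[OF that] st by (intro \<delta>(2)) (auto simp: dist_real_def)
      then show "\<bar>x u - x v\<bar> \<le> r / 2" by (simp add: dist_real_def)
    qed
    then show ?thesis using r by simp
  qed
  then show "\<exists>N0. \<forall>N\<ge>N0. norm (stopped_sum x \<tau> s t N - (x (clip \<tau> t) - x (clip \<tau> s))) < r" by blast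
qed

lemma stopped_sum_bound:
  assumes \<tau>: "0 \<le> \<tau>" and st: "0 \<le> s" "s \<le> t" and S: "\<And>u. 0 \<le> u \<Longrightarrow> u \<le> t \<Longrightarrow> \<bar>x u\<bar> \<le> S"
  shows "\<bar>stopped_sum x \<tau> s t N\<bar> \<le> 4 * S"
proof -
  have "\<bar>stopped_sum x \<tau> s t N - (x (clip \<tau> t) - x (clip \<tau> s))\<bar> \<le> 2 * S"
  proof (rule stopped_sum_approx[OF \<tau> st])
    fix u v assume "s \<le> u" "u \<le> t" "s \<le> v" "v \<le> t"
    then show "\<bar>x u - x v\<bar> \<le> 2 * S" using S[of u] S[of v] st by linarith
  qed
  moreover have "\<bar>x (clip \<tau> t)\<bar> \<le> S" "\<bar>x (clip \<tau> s)\<bar> \<le> S"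
    using clip_bounds[OF \<tau>, of t] clip_bounds[OF \<tau>, of s] st by (auto intro!: S)
  ultimately show ?thesis by linarith
qed

context continuous_martingale begin

text \<open>Increments of the stopped process are pathwise limits of \<open>stopped_sum\<close>.
  After multiplication with the indicator of an event of \<open>F s\<close> these remain martingale
  transforms of mean zero, dominated by \<open>4 * sup_abs t\<close>. Adaptedness comes from the
  same limit started at 0.\<close>

lemma optional_stopping:
  assumes \<tau>0: "\<And>\<omega>. 0 \<le> \<tau> \<omega>"
    and \<tau>F: "\<And>s. 0 \<le> s \<Longrightarrow> {\<omega>\<in>space M. \<tau> \<omega> \<le> ereal s} \<in> sets (F s)"
  shows "continuous_martingale M F (stopped_process X \<tau>)"
proof -
  define Y where "Y = stopped_process X \<tau>"
  have Y: "Y t \<omega> = X (clip (\<tau> \<omega>) t) \<omega>" for t \<omega> by (simp add: Y_def stopped_process_eq)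
  have Y0: "Y 0 \<omega> = 0" if "\<omega> \<in> space M" for \<omega>
  proof -
    have "clip (\<tau> \<omega>) 0 = 0" using clip_bounds(1,2)[OF \<tau>0[of \<omega>] order_refl] by linarith
    then show ?thesis using zero[OF that] by (simp add: Y)
  qed
  define W where "W s t N \<omega> = stopped_sum (\<lambda>u. X u \<omega>) (\<tau> \<omega>) s t N" for s t N \<omega>
  have lim: "(\<lambda>N. W s t N \<omega>) \<longlonglongrightarrow> Y t \<omega> - Y s \<omega>" if "\<omega> \<in> space M" "0 \<le> s" "s \<le> t" for s t \<omega>
    unfolding W_def Y by (rule stopped_sum_tendsto[OF \<tau>0 that(2,3) continuous[OF that(1)]])
  define g where "g s t N k = s + (t - s) * real k / real (Suc N)" for s t :: real and N k
  define H where "H s t N k \<omega> = (if \<tau> \<omega> \<le> ereal (g s t N k) then 0 else 1 :: real)" for s t N k \<omega>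
  have W_eq: "W s t N \<omega> = (\<Sum>k<Suc N. H s t N k \<omega> * (X (g s t N (Suc k)) \<omega> - X (g s t N k) \<omega>))" for s t N \<omega>
    unfolding W_def stopped_sum_def H_def g_def by (intro sum.cong) auto
  have g: "s \<le> g s t N k" "g s t N k \<le> g s t N (Suc k)" if "0 \<le> s" "s \<le> t" for s t N k
    unfolding g_def using that by (auto intro!: add_left_mono divide_right_mono mult_left_mono)
  have gt: "g s t N k \<le> t" if "0 \<le> s" "s \<le> t" "k \<le> Suc N" for s t N k
  proof -
    have "(t - s) * real k \<le> (t - s) * real (Suc N)" using that by (intro mult_left_mono) auto
    then have "(t - s) * real k / real (Suc N) \<le> t - s" by (simp add: divide_le_eq)
    then show ?thesis unfolding g_def by linarith
  qed
  have HF: "H s t N k \<in> borel_measurable (F (g s t N k))" if "0 \<le> s" "s \<le> t" for s t N k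
  proof -
    have g0: "0 \<le> g s t N k" using g(1)[OF that] that(1) order_trans by blast
    have "{\<omega>\<in>space (F (g s t N k)). \<tau> \<omega> \<le> ereal (g s t N k)} \<in> sets (F (g s t N k))"
      using \<tau>F[OF g0] space_F[OF g0] by simp
    then show ?thesis unfolding H_def[abs_def] by (intro measurable_If) auto
  qed
  have F_mono: "f \<in> borel_measurable (F t)" if "f \<in> borel_measurable (F s)" "0 \<le> s" "s \<le> t"
    for f :: "'a \<Rightarrow> real" and s t
  proof -
    have "sets (F s) \<subseteq> sets (F t)" "space (F s) = space (F t)"
      using mart that space_F[of s] space_F[of t] unfolding martingale_def by auto
    then show ?thesis using that(1) by (intro measurable_from_subalg[of "F t" "F s"]) (auto simp: subalgebra_def)
  qed
  have WF: "W 0 t N \<in> borel_measurable (F t)" if t: "0 \<le> t" for t N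
    unfolding W_eq[abs_def]
  proof (intro borel_measurable_sum borel_measurable_times borel_measurable_diff)
    fix k assume "k \<in> {..<Suc N}"
    then have k: "k \<le> Suc N" "Suc k \<le> Suc N" by auto
    have g0: "0 \<le> g 0 t N j" for j using g(1)[OF order_refl t] .
    show "H 0 t N k \<in> borel_measurable (F t)"
      by (rule F_mono[OF HF[OF order_refl t] g0 gt[OF order_refl t k(1)]])
    show "X (g 0 t N (Suc k)) \<in> borel_measurable (F t)" "X (g 0 t N k) \<in> borel_measurable (F t)"
      by (intro adapted g0 gt[OF order_refl t] k)+
  qed
  have YF: "Y t \<in> borel_measurable (F t)" if t: "0 \<le> t" for t
  proof (rule borel_measurable_LIMSEQ_real[OF _ WF[OF t]])
    fix \<omega> assume "\<omega> \<in> space (F t)"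
    then have w: "\<omega> \<in> space M" using space_F[OF t] by simp
    show "(\<lambda>N. W 0 t N \<omega>) \<longlonglongrightarrow> Y t \<omega>" using lim[OF w order_refl t] Y0[OF w] by simp
  qed
  have Yb: "\<bar>Y t \<omega>\<bar> \<le> sup_abs t \<omega>" if "\<omega> \<in> space M" "0 \<le> t" for t \<omega>
    unfolding Y using clip_bounds[OF \<tau>0 that(2)] by (intro abs_le_sup_abs that) auto
  have Ysq: "integrable M (\<lambda>\<omega>. (Y t \<omega>)\<^sup>2)" if t: "0 \<le> t" for t
  proof (rule Bochner_Integration.integrable_bound[OF sup_abs_L2(2)[OF t]])
    show "(\<lambda>\<omega>. (Y t \<omega>)\<^sup>2) \<in> borel_measurable M" using from_F[OF t YF[OF t]] by simp
    show "AE \<omega> in M. norm ((Y t \<omega>)\<^sup>2) \<le> norm ((sup_abs t \<omega>)\<^sup>2)"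
    proof (intro AE_I2)
      fix \<omega> assume w: "\<omega> \<in> space M"
      have "(Y t \<omega>)\<^sup>2 \<le> (sup_abs t \<omega>)\<^sup>2"
        using Yb[OF w t] by (metis abs_le_square_iff abs_ge_self order_trans)
      then show "norm ((Y t \<omega>)\<^sup>2) \<le> norm ((sup_abs t \<omega>)\<^sup>2)" by simp
    qed
  qed
  have Yi: "integrable M (Y t)" if t: "0 \<le> t" for t
    by (rule square_integrable_imp_integrable[OF from_F[OF t YF[OF t]] Ysq[OF t]])
  have "martingale M F Y"
  proof (rule martingaleI)
    show "subalgebra M (F t)" if "0 \<le> t" for t by (rule subalg[OF that])
    show "sets (F s) \<subseteq> sets (F t)" if "0 \<le> s" "s \<le> t" for s t
      using mart that unfolding martingale_def by auto
    fix s t A assume st: "0 \<le> s" "s \<le> t" and A: "A \<in> sets (F s)"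
    then have t: "0 \<le> t" by simp
    have AM[measurable]: "A \<in> sets M" using A subalg[OF st(1)] by (auto simp: subalgebra_def)
    have gst: "0 \<le> g s t N k" for N k using g(1)[OF st] st(1) order_trans by blast
    define K where "K N k \<omega> = indicator A \<omega> * H s t N k \<omega>" for N k \<omega>
    have KF: "K N k \<in> borel_measurable (F (g s t N k))" for N k
    proof -
      have "(indicator A :: 'a \<Rightarrow> real) \<in> borel_measurable (F (g s t N k))"
        by (rule F_mono[OF borel_measurable_indicator[OF A] st(1) g(1)[OF st]])
      then show ?thesis unfolding K_def[abs_def] using HF[OF st] by (intro borel_measurable_times) auto
    qed
    have Ksq: "integrable M (\<lambda>\<omega>. (K N k \<omega>)\<^sup>2)" for N k
    proof (rule integrable_const_bound[where B = 1])
      show "(\<lambda>\<omega>. (K N k \<omega>)\<^sup>2) \<in> borel_measurable M" using from_F[OF gst KF] by simp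
    qed (auto simp: K_def H_def indicator_def)
    note o = orthogonal_incr[OF gst g(2)[OF st] KF Ksq]
    have Wm: "W s t N \<in> borel_measurable M" for N
      unfolding W_eq[abs_def]
      by (intro borel_measurable_sum borel_measurable_times borel_measurable_diff meas gst from_F[OF gst HF[OF st]])
    have W0: "(\<integral>\<omega>. indicator A \<omega> * W s t N \<omega> \<partial>M) = 0" for N
    proof -
      have "(\<integral>\<omega>. indicator A \<omega> * W s t N \<omega> \<partial>M)
          = (\<integral>\<omega>. (\<Sum>k<Suc N. K N k \<omega> * (X (g s t N (Suc k)) \<omega> - X (g s t N k) \<omega>)) \<partial>M)"
        unfolding W_eq K_def by (simp add: sum_distrib_left mult.assoc del: sum.lessThan_Suc)
      also have "\<dots> = (\<Sum>k<Suc N. \<integral>\<omega>. K N k \<omega> * (X (g s t N (Suc k)) \<omega> - X (g s t N k) \<omega>) \<partial>M)"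
        by (intro Bochner_Integration.integral_sum o(1))
      also have "\<dots> = 0" by (intro sum.neutral ballI o(2))
      finally show ?thesis .
    qed
    have "(\<lambda>N. \<integral>\<omega>. indicator A \<omega> * W s t N \<omega> \<partial>M) \<longlonglongrightarrow> (\<integral>\<omega>. indicator A \<omega> * (Y t \<omega> - Y s \<omega>) \<partial>M)"
    proof (rule integral_dominated_convergence[where w = "\<lambda>\<omega>. 4 * sup_abs t \<omega>"])
      show "integrable M (\<lambda>\<omega>. 4 * sup_abs t \<omega>)"
        using square_integrable_imp_integrable[OF sup_abs_L2[OF t]] by simp
      show "AE \<omega> in M. (\<lambda>N. indicator A \<omega> * W s t N \<omega>) \<longlonglongrightarrow> indicator A \<omega> * (Y t \<omega> - Y s \<omega>)"
        by (intro AE_I2 tendsto_mult tendsto_const lim st)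
      show "AE \<omega> in M. norm (indicator A \<omega> * W s t N \<omega>) \<le> 4 * sup_abs t \<omega>" for N
      proof (intro AE_I2)
        fix \<omega> assume w: "\<omega> \<in> space M"
        have "\<bar>W s t N \<omega>\<bar> \<le> 4 * sup_abs t \<omega>"
          unfolding W_def by (rule stopped_sum_bound[OF \<tau>0 st]) (rule abs_le_sup_abs[OF w])
        then show "norm (indicator A \<omega> * W s t N \<omega>) \<le> 4 * sup_abs t \<omega>"
          by (auto simp: indicator_def)
      qed
      show "(\<lambda>\<omega>. indicator A \<omega> * (Y t \<omega> - Y s \<omega>)) \<in> borel_measurable M"
        using from_F[OF t YF[OF t]] from_F[OF st(1) YF[OF st(1)]] by simp
      show "(\<lambda>\<omega>. indicator A \<omega> * W s t N \<omega>) \<in> borel_measurable M" for N using Wm by simp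
    qed
    then show "(\<integral>\<omega>. indicator A \<omega> * (Y t \<omega> - Y s \<omega>) \<partial>M) = 0" unfolding W0 by (simp add: LIMSEQ_const_iff)
  qed (use YF Yi in auto)
  moreover have "continuous_on {0..} (\<lambda>t. Y t \<omega>)" if "\<omega> \<in> space M" for \<omega>
    unfolding Y
    by (rule continuous_on_compose2[OF continuous[OF that] continuous_on_clip[OF \<tau>0]])
       (use clip_bounds(1)[OF \<tau>0] in auto)
  ultimately show ?thesis
    unfolding Y_def[symmetric] by unfold_locales (use Ysq Y0 in auto)
qed

end

section \<open>Brownian motion stopped at the fall time of its drawdown\<close>

lemma drawdown_fall_time_eq:
  "drawdown_fall_time d x = (INF t\<in>{t. 0 \<le> t \<and> d \<le> drawdown (drawdown x) t}. ereal t)"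
  unfolding drawdown_fall_time_def drawdown_def[of "drawdown x"] ..

lemma drawdown_fall_time_nonneg: "0 \<le> drawdown_fall_time d x"
  unfolding drawdown_fall_time_eq by (intro INF_greatest) auto

context
  fixes x :: "real \<Rightarrow> real" and d :: real
  assumes x: "continuous_on {0..} x" and d: "0 < d"
begin

lemma continuous_on_fall: "continuous_on {0..} (drawdown (drawdown x))"
  by (intro continuous_on_drawdown x)

text \<open>Continuity makes the fall time the first time of reaching a closed set, so the event is
  decided by the path up to \<open>s\<close>. Hence it is a stopping time of the natural filtration
  itself, without completion or right limits.\<close>

lemma drawdown_fall_time_le_iff:
  assumes s: "0 \<le> s"
  shows "drawdown_fall_time d x \<le> ereal s \<longleftrightarrow> d \<le> running_sup (drawdown (drawdown x)) s"
proof
  let ?G = "running_sup (drawdown (drawdown x))"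
  assume le: "drawdown_fall_time d x \<le> ereal s"
  show "d \<le> ?G s"
  proof (rule ccontr)
    assume "\<not> d \<le> ?G s"
    then have "0 < d - ?G s" by simp
    then have "\<exists>\<delta>>0. \<forall>r\<in>{0..}. dist r s < \<delta> \<longrightarrow> dist (?G r) (?G s) < d - ?G s"
      using continuous_on_running_sup[OF continuous_on_fall] s unfolding continuous_on_iff by simp
    then obtain \<delta> where \<delta>: "0 < \<delta>" "\<And>r. 0 \<le> r \<Longrightarrow> \<bar>r - s\<bar> < \<delta> \<Longrightarrow> \<bar>?G r - ?G s\<bar> < d - ?G s"
      by (auto simp: dist_real_def)
    have lt: "?G (s + \<delta> / 2) < d" using \<delta>(2)[of "s + \<delta> / 2"] \<delta>(1) s by simp
    have "ereal (s + \<delta> / 2) \<le> drawdown_fall_time d x"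
      unfolding drawdown_fall_time_eq
    proof (intro INF_greatest, clarify)
      fix t assume t: "0 \<le> t" "d \<le> drawdown (drawdown x) t"
      then have "\<not> t \<le> s + \<delta> / 2"
        using running_sup_ge[OF continuous_on_fall, of t "s + \<delta> / 2"] lt by auto
      then show "ereal (s + \<delta> / 2) \<le> ereal t" by simp
    qed
    then have "ereal (s + \<delta> / 2) \<le> ereal s" using le by (rule order_trans)
    then show False using \<delta>(1) by simp
  qed
next
  assume a: "d \<le> running_sup (drawdown (drawdown x)) s"
  obtain t where t: "0 \<le> t" "t \<le> s" "running_sup (drawdown (drawdown x)) s = drawdown (drawdown x) t"
    using running_sup_attained[OF continuous_on_fall s] by blast
  then have "drawdown_fall_time d x \<le> ereal t"
    unfolding drawdown_fall_time_eq using a by (intro INF_lower) auto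
  then show "drawdown_fall_time d x \<le> ereal s" using t(2) by (meson ereal_less_eq(3) order_trans)
qed

text \<open>Strictly before the fall time this holds by definition of the infimum; the fall time
  itself is reached from below by continuity.\<close>

lemma fall_before: 
  assumes r: "0 \<le> r" "ereal r \<le> drawdown_fall_time d x"
  shows "drawdown (drawdown x) r \<le> d"
proof (cases "r = 0")
  case True
  then show ?thesis using drawdown_0[OF continuous_on_drawdown[OF x]] d by simp
next
  case False
  have "(\<lambda>n. r * (1 - 1 / real (Suc n))) \<longlonglongrightarrow> r * (1 - 0)"
    by (intro tendsto_intros LIMSEQ_Suc[OF lim_1_over_n])
  then have l: "(\<lambda>n. r * (1 - 1 / real (Suc n))) \<longlonglongrightarrow> r" by simp
  have nn: "0 \<le> r * (1 - 1 / real (Suc n))" for n using r(1) by (intro mult_nonneg_nonneg) auto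
  have "drawdown (drawdown x) (r * (1 - 1 / real (Suc n))) \<le> d" for n
  proof -
    have "r * (1 - 1 / real (Suc n)) < r * 1" using r(1) False by (intro mult_strict_left_mono) auto
    then have "\<not> drawdown_fall_time d x \<le> ereal (r * (1 - 1 / real (Suc n)))"
      using r(2) by (metis ereal_less(2) ereal_less_eq(3) leD mult.right_neutral order_trans)
    then show ?thesis
      using drawdown_fall_time_le_iff[OF nn[of n]] running_sup_ge[OF continuous_on_fall nn[of n] order_refl]
      by linarith
  qed
  then show ?thesis
    using continuous_on_tendsto_compose[OF continuous_on_fall l] nn r(1)
    by (intro LIMSEQ_le_const2[where X = "\<lambda>n. drawdown (drawdown x) (r * (1 - 1 / real (Suc n)))"]) auto
qed

lemma fall_at:
  assumes "drawdown_fall_time d x = ereal r"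
  shows "drawdown (drawdown x) r = d"
proof -
  have r: "0 \<le> r" using drawdown_fall_time_nonneg[of d x] assms by simp
  have "d \<le> running_sup (drawdown (drawdown x)) r" using drawdown_fall_time_le_iff[OF r] assms by simp
  then obtain t where t: "0 \<le> t" "t \<le> r" "d \<le> drawdown (drawdown x) t"
    using running_sup_attained[OF continuous_on_fall r] by metis
  then have "d \<le> running_sup (drawdown (drawdown x)) t"
    using running_sup_ge[OF continuous_on_fall, of t t] by simp
  then have "r \<le> t" using drawdown_fall_time_le_iff[OF t(1)] assms by simp
  then show ?thesis using t fall_before[OF r] assms by auto
qed

end

context brownian_motion begin

sublocale continuous_martingale M \<F> B
  by unfold_locales (auto intro: continuous_paths start_zero)

end

locale brownian_drawdown_stopping = brownian_motion +
  fixes d :: real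
  assumes d: "0 < d"
begin

definition "T \<omega> = drawdown_fall_time d (\<lambda>t. B t \<omega>)"
definition "X = stopped_process B T"

lemma X_eq: "X t \<omega> = B (clip (T \<omega>) t) \<omega>"
  by (simp add: X_def stopped_process_eq)

lemma T_nonneg: "0 \<le> T \<omega>"
  unfolding T_def by (rule drawdown_fall_time_nonneg)

lemma measurable_T:
  assumes s: "0 \<le> s" shows "{\<omega>\<in>space M. T \<omega> \<le> ereal s} \<in> sets (\<F> s)"
proof -
  have "(\<lambda>\<omega>. running_sup (drawdown (drawdown (\<lambda>u. B u \<omega>))) s) \<in> borel_measurable (\<F> s)"
    using s
    by (intro measurable_running_sup continuous_on_fall[OF continuous_paths d])
       (auto simp: drawdown_eq[of "drawdown _"] intro!: borel_measurable_diff measurable_max_drawdown_F measurable_drawdown_F)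
  then have "{\<omega>\<in>space (\<F> s). d \<le> running_sup (drawdown (drawdown (\<lambda>u. B u \<omega>))) s} \<in> sets (\<F> s)" by measurable
  moreover have "{\<omega>\<in>space M. T \<omega> \<le> ereal s} = {\<omega>\<in>space M. d \<le> running_sup (drawdown (drawdown (\<lambda>u. B u \<omega>))) s}"
    unfolding T_def using drawdown_fall_time_le_iff[OF continuous_paths d s] by blast
  ultimately show ?thesis by simp
qed

sublocale X: continuous_martingale M \<F> X
  unfolding X_def by (rule optional_stopping[OF T_nonneg measurable_T])

lemma drawdown_X: "0 \<le> t \<Longrightarrow> drawdown (\<lambda>u. X u \<omega>) t = drawdown (\<lambda>u. B u \<omega>) (clip (T \<omega>) t)"
  unfolding X_eq by (rule drawdown_clip[OF T_nonneg])

lemma max_drawdown_X_until: "0 \<le> t \<Longrightarrow> running_sup (drawdown (\<lambda>u. X u \<omega>)) t = running_sup (drawdown (\<lambda>u. B u \<omega>)) (clip (T \<omega>) t)"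
  unfolding X_eq by (rule running_sup_drawdown_clip[OF T_nonneg])

lemma fall_X:
  assumes "\<omega> \<in> space M" "0 \<le> t" shows "drawdown (drawdown (\<lambda>u. X u \<omega>)) t \<le> d"
  using fall_before[OF continuous_paths[OF assms(1)] d, of "clip (T \<omega>) t"] clip_bounds[OF T_nonneg assms(2)]
  unfolding drawdown_eq[of "drawdown _"] drawdown_X[OF assms(2)] max_drawdown_X_until[OF assms(2)]
  by (simp add: T_def)

section \<open>Excess, gap and second moments of the stopped motion\<close>

definition "excess h \<omega> = drawdown_excess d (\<lambda>u. X u \<omega>) h"
text \<open>Its square is the error in the proportionality of the second moment to the expected
  excess. It stays within \<open>{0..d}\<close> and vanishes once the fall time is reached.\<close>

definition "gap h \<omega> = drawdown (\<lambda>u. X u \<omega>) h - excess h \<omega>"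

lemma excess_X:
  assumes "0 \<le> h"
  shows "integrable M (excess h)"
    "(\<integral>\<omega>. (X h \<omega>)\<^sup>2 \<partial>M) = 2 * d * (\<integral>\<omega>. excess h \<omega> \<partial>M) + (\<integral>\<omega>. (gap h \<omega>)\<^sup>2 \<partial>M)"
  using X.excess_identity[OF d assms fall_X] unfolding excess_def[abs_def] gap_def by auto

lemma gap_X_bounds:
  assumes "\<omega> \<in> space M" "0 \<le> h" shows "0 \<le> gap h \<omega>" "gap h \<omega> \<le> d"
proof -
  interpret P: fall_path "\<lambda>u. X u \<omega>" d h
    using assms X.continuous X.zero d fall_X by unfold_locales auto
  show "0 \<le> gap h \<omega>" "gap h \<omega> \<le> d" unfolding gap_def excess_def using P.gap_bounds[OF assms(2) order_refl] by auto
qed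

lemma measurable_gap: "0 \<le> h \<Longrightarrow> gap h \<in> borel_measurable M"
  unfolding gap_def[abs_def]
  by (intro borel_measurable_diff borel_measurable_integrable[OF excess_X(1)] from_F[OF _ X.measurable_drawdown_F[OF _ order_refl]])

lemma gap_sq_le: "0 \<le> h \<Longrightarrow> (\<integral>\<omega>. (gap h \<omega>)\<^sup>2 \<partial>M) \<le> d\<^sup>2"
  "0 \<le> h \<Longrightarrow> \<omega> \<in> space M \<Longrightarrow> (gap h \<omega>)\<^sup>2 \<le> d\<^sup>2"
proof -
  show le: "(gap h \<omega>)\<^sup>2 \<le> d\<^sup>2" if "0 \<le> h" "\<omega> \<in> space M" for h \<omega>
    using gap_X_bounds[OF that(2,1)] by (intro power_mono) auto
  show "(\<integral>\<omega>. (gap h \<omega>)\<^sup>2 \<partial>M) \<le> d\<^sup>2" if h: "0 \<le> h"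
  proof (rule integral_le_const)
    show "integrable M (\<lambda>\<omega>. (gap h \<omega>)\<^sup>2)"
      using measurable_gap[OF h] le[OF h] by (intro integrable_const_bound[where B = "d\<^sup>2"] AE_I2) auto
  qed (use le[OF h] in auto)
qed

text \<open>The excess identity bounds the second moment by the expected maximal drawdown, which the
  drawdown bound in turn estimates by the second moment. This closes on itself if the resulting
  coefficient is below 1; the moment is finite beforehand at each fixed time.\<close>

lemma second_moment_bound:
  assumes h: "0 \<le> h" shows "(\<integral>\<omega>. (X h \<omega>)\<^sup>2 \<partial>M) \<le> 10 * d\<^sup>2"
proof -
  let ?v = "\<integral>\<omega>. (X h \<omega>)\<^sup>2 \<partial>M"
  have v: "0 \<le> ?v" by simp
  have b0: "0 \<le> excess h \<omega>" for \<omega> by (simp add: excess_def drawdown_excess_def)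
  have "ennreal (\<integral>\<omega>. excess h \<omega> \<partial>M) = (\<integral>\<^sup>+\<omega>. ennreal (excess h \<omega>) \<partial>M)"
    using excess_X(1)[OF h] b0 by (simp add: nn_integral_eq_integral)
  also have "\<dots> \<le> (\<integral>\<^sup>+\<omega>. ennreal (running_sup (drawdown (\<lambda>u. X u \<omega>)) h) \<partial>M)"
  proof (intro nn_integral_mono ennreal_leI)
    fix \<omega> assume "\<omega> \<in> space M"
    then have "0 \<le> running_sup (drawdown (\<lambda>u. X u \<omega>)) h"
      using running_sup_ge[OF continuous_on_drawdown[OF X.continuous], of \<omega> 0 h]
        drawdown_0[OF X.continuous, of \<omega>] h by simp
    then show "excess h \<omega> \<le> running_sup (drawdown (\<lambda>u. X u \<omega>)) h" using d by (simp add: excess_def drawdown_excess_def)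
  qed
  \<comment> \<open>The parameter \<open>e = 2 * d\<close> gives the coefficient
    \<open>1 / 2\<close>; the natural choice \<open>e = d\<close> would give 1 and no
    information.\<close>
  also have "\<dots> \<le> ennreal (2 * d + ?v / (2 * (2 * d)))"
    by (rule X.expectation_max_drawdown_until[OF h]) (use d in simp)
  finally have "(\<integral>\<omega>. excess h \<omega> \<partial>M) \<le> 2 * d + ?v / (2 * (2 * d))"
    using d v by (subst (asm) ennreal_le_iff) auto
  then have "2 * d * (\<integral>\<omega>. excess h \<omega> \<partial>M) \<le> 2 * d * (2 * d + ?v / (2 * (2 * d)))"
    using d by (intro mult_left_mono) auto
  also have "\<dots> = 4 * d\<^sup>2 + ?v / 2" using d by (simp add: field_simps power2_eq_square)
  finally show ?thesis using excess_X(2)[OF h] gap_sq_le(1)[OF h] by linarith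
qed

lemma right_continuous_X: "right_continuous_paths M X"
  unfolding right_continuous_paths_def
proof (intro ballI allI impI)
  fix \<omega> t assume "\<omega> \<in> space M" "0 \<le> (t::real)"
  then have "continuous (at t within {0..}) (\<lambda>s. X s \<omega>)"
    using X.continuous[of \<omega>] by (auto simp: continuous_on_eq_continuous_within)
  then show "continuous (at_right t) (\<lambda>s. X s \<omega>)"
    by (rule continuous_within_subset) (use \<open>0 \<le> t\<close> in auto)
qed

lemma L2_bounded_X: "L2_bounded M X"
proof -
  have "(SUP t\<in>{0..}. \<integral>\<^sup>+ \<omega>. ennreal ((X t \<omega>)\<^sup>2) \<partial>M) \<le> ennreal (10 * d\<^sup>2)"
  proof (rule SUP_least)
    fix t :: real assume "t \<in> {0..}"
    then have t: "0 \<le> t" by simp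
    show "(\<integral>\<^sup>+ \<omega>. ennreal ((X t \<omega>)\<^sup>2) \<partial>M) \<le> ennreal (10 * d\<^sup>2)"
      using X.integrable_sq[OF t] second_moment_bound[OF t] by (simp add: nn_integral_eq_integral ennreal_leI)
  qed
  then show ?thesis unfolding L2_bounded_def by (simp add: order.strict_trans1)
qed

sublocale X: L2_martingale M \<F> X
  by unfold_locales (fact X.mart right_continuous_X L2_bounded_X)+

section \<open>Passage to the fall time\<close>

text \<open>If the fall time is infinite, the stopped path is the Brownian path, and the convergence
  of the former contradicts the divergence of the latter.\<close>

lemma AE_T_finite: "AE \<omega> in M. T \<omega> < \<infinity>"
  using X.AE_tendsto_last_term AE_not_convergent
proof eventually_elim
  case (elim \<omega>)
  show ?case
  proof (rule ccontr)
    assume "\<not> T \<omega> < \<infinity>"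
    then have "X t \<omega> = B t \<omega>" for t by (simp add: X_eq clip_below)
    then show False using elim by auto
  qed
qed

lemma max_drawdown_X:
  "\<omega> \<in> space M \<Longrightarrow> max_drawdown (\<lambda>t. X t \<omega>) = max_drawdown_until (T \<omega>) (\<lambda>t. B t \<omega>)"
  unfolding X_eq by (rule max_drawdown_clip[OF T_nonneg continuous_paths])

lemma X_eventually:
  assumes "T \<omega> < \<infinity>"
  shows "\<forall>\<^sub>F n in sequentially. X (real n) \<omega> = value_at_time B T \<omega>"
    and "\<forall>\<^sub>F n in sequentially. clip (T \<omega>) (real n) = real_of_ereal (T \<omega>)"
proof -
  obtain r where r: "T \<omega> = ereal r" using assms T_nonneg[of \<omega>] by (cases "T \<omega>") auto
  obtain n0 where n0: "r \<le> real n0" using real_arch_simple by blast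
  have *: "clip (T \<omega>) (real n) = real_of_ereal (T \<omega>)" if "n0 \<le> n" for n
    using that n0 r by (simp add: clip_def min_def)
  then show "\<forall>\<^sub>F n in sequentially. clip (T \<omega>) (real n) = real_of_ereal (T \<omega>)"
    by (rule eventually_sequentiallyI)
  show "\<forall>\<^sub>F n in sequentially. X (real n) \<omega> = value_at_time B T \<omega>"
    by (rule eventually_sequentiallyI[of n0]) (simp add: X_eq * value_at_time_def)
qed

lemma value_at_time_measurable: "value_at_time B T \<in> borel_measurable M"
proof (rule borel_measurable_LIMSEQ_real)
  fix n :: nat
  have "{\<omega>\<in>space M. T \<omega> \<le> ereal (real n)} \<in> sets M"
    using measurable_T[of "real n"] subalg[of "real n"] by (auto simp: subalgebra_def)
  then show "(\<lambda>\<omega>. if T \<omega> \<le> ereal (real n) then X (real n) \<omega> else 0) \<in> borel_measurable M"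
    using X.meas[of "real n"] by (intro measurable_If) auto
next
  fix \<omega> assume w: "\<omega> \<in> space M"
  show "(\<lambda>n. if T \<omega> \<le> ereal (real n) then X (real n) \<omega> else 0) \<longlonglongrightarrow> value_at_time B T \<omega>"
  proof (cases "T \<omega> < \<infinity>")
    case True
    obtain r where r: "T \<omega> = ereal r" using True T_nonneg[of \<omega>] by (cases "T \<omega>") auto
    obtain n0 where n0: "r \<le> real n0" using real_arch_simple by blast
    have "\<forall>\<^sub>F n in sequentially. T \<omega> \<le> ereal (real n)"
      by (rule eventually_sequentiallyI[of n0]) (use r n0 in simp)
    with X_eventually(1)[OF True] have "\<forall>\<^sub>F n in sequentially. (if T \<omega> \<le> ereal (real n) then X (real n) \<omega> else 0) = value_at_time B T \<omega>"
      by eventually_elim simp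
    then show ?thesis by (rule tendsto_eventually)
  next
    case False
    \<comment> \<open>\<open>real_of_ereal\<close> sends \<open>\<infinity>\<close> to 0, so the
      default value is \<open>B 0 = 0\<close>, in agreement with the \<open>else\<close>
      branch.\<close>
    then show ?thesis using start_zero[OF w] by (simp add: value_at_time_def)
  qed
qed

lemma AE_last_term: "AE \<omega> in M. last_term X \<omega> = value_at_time B T \<omega>"
  using X.AE_LIMSEQ_last_term AE_T_finite
proof eventually_elim
  case (elim \<omega>)
  then show ?case using tendsto_eventually[OF X_eventually(1)] LIMSEQ_unique by blast
qed

lemma variance_value: "variance (last_term X) = variance (value_at_time B T)"
proof -
  note [measurable] = value_at_time_measurable X.measurable_last_term
  have e: "expectation (last_term X) = expectation (value_at_time B T)"
    by (rule integral_cong_AE) (use AE_last_term in auto)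
  show ?thesis unfolding e
  proof (rule integral_cong_AE)
    show "AE \<omega> in M. (last_term X \<omega> - expectation (value_at_time B T))\<^sup>2
        = (value_at_time B T \<omega> - expectation (value_at_time B T))\<^sup>2"
      using AE_last_term by eventually_elim simp
  qed auto
qed

text \<open>At the fall time the drawdown equals its running maximum minus \<open>d\<close>. Being
  nonnegative, it then equals the excess, so the gap is 0 from there on; before, it is at most
  \<open>d\<close>.\<close>

lemma gap_tendsto: "(\<lambda>n. \<integral>\<omega>. (gap (real n) \<omega>)\<^sup>2 \<partial>M) \<longlonglongrightarrow> 0"
proof -
  have "(\<lambda>n. \<integral>\<omega>. (gap (real n) \<omega>)\<^sup>2 \<partial>M) \<longlonglongrightarrow> (\<integral>\<omega>. 0 \<partial>M)"
  proof (rule integral_dominated_convergence[where w = "\<lambda>_. d\<^sup>2"])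
    show "(\<lambda>\<omega>. (gap (real n) \<omega>)\<^sup>2) \<in> borel_measurable M" for n using measurable_gap[of "real n"] by simp
    show "AE \<omega> in M. norm ((gap (real n) \<omega>)\<^sup>2) \<le> d\<^sup>2" for n using gap_sq_le(2)[of "real n"] by auto
    show "AE \<omega> in M. (\<lambda>n. (gap (real n) \<omega>)\<^sup>2) \<longlonglongrightarrow> 0"
      using AE_T_finite AE_space
    proof eventually_elim
      case (elim \<omega>)
      let ?B = "\<lambda>u. B u \<omega>" and ?r = "real_of_ereal (T \<omega>)"
      have r: "T \<omega> = ereal ?r" using elim T_nonneg[of \<omega>] by (cases "T \<omega>") auto
      have r0: "0 \<le> ?r" using T_nonneg[of \<omega>] by (rule real_of_ereal_pos)
      have "drawdown (drawdown ?B) ?r = d"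
        using fall_at[OF continuous_paths[OF elim(2)] d] r unfolding T_def by simp
      then have A: "drawdown ?B ?r = running_sup (drawdown ?B) ?r - d" by (simp add: drawdown_eq[of "drawdown ?B"])
      moreover have "0 \<le> drawdown ?B ?r" by (rule drawdown_nonneg[OF continuous_paths[OF elim(2)] r0])
      ultimately have z: "drawdown ?B ?r - max 0 (running_sup (drawdown ?B) ?r - d) = 0" by simp
      have "\<forall>\<^sub>F n in sequentially. (gap (real n) \<omega>)\<^sup>2 = 0"
        using X_eventually(2)[OF elim(1)]
      proof eventually_elim
        case (elim n)
        then show ?case using z
          by (simp add: gap_def excess_def drawdown_excess_def drawdown_X max_drawdown_X_until)
      qed
      then show ?case by (rule tendsto_eventually)
    qed
  qed simp_all
  then show ?thesis by simp
qed

text \<open>The left side is the larger of \<open>d\<close> and the maximal drawdown up to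
  \<open>h\<close>. The level \<open>d\<close> is always reached: at the fall time a nonnegative
  drawdown lies \<open>d\<close> below its running maximum.\<close>

lemma excess_le_max_drawdown:
  "AE \<omega> in M. ereal (excess h \<omega> + d) \<le> max_drawdown (\<lambda>t. X t \<omega>)" if h: "0 \<le> h"
  using AE_T_finite AE_space
proof eventually_elim
  case (elim \<omega>)
  let ?X = "\<lambda>u. X u \<omega>" and ?r = "real_of_ereal (T \<omega>)"
  note c = X.continuous[OF elim(2)] continuous_paths[OF elim(2)]
  have r: "T \<omega> = ereal ?r" using elim T_nonneg[of \<omega>] by (cases "T \<omega>") auto
  have r0: "0 \<le> ?r" using T_nonneg[of \<omega>] by (rule real_of_ereal_pos)
  have cl: "clip (T \<omega>) ?r = ?r" by (rule clip_below) (simp add: r[symmetric])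
  have "drawdown (drawdown (\<lambda>u. B u \<omega>)) ?r = d"
    using fall_at[OF c(2) d] r unfolding T_def by simp
  then have "d \<le> running_sup (drawdown ?X) ?r"
    using drawdown_nonneg[OF c(2) r0] unfolding max_drawdown_X_until[OF r0] cl
    by (simp add: drawdown_eq[of "drawdown _"])
  then have "ereal d \<le> max_drawdown ?X"
    using max_drawdown_ge_running_sup[OF c(1) r0] by (meson ereal_less_eq(3) order_trans)
  moreover have "ereal (running_sup (drawdown ?X) h) \<le> max_drawdown ?X"
    by (rule max_drawdown_ge_running_sup[OF c(1) h])
  ultimately show ?case by (simp add: excess_def drawdown_excess_def max_def)
qed

section \<open>Attainment of the constant\<close>

lemma expectation_max_drawdown_X:
  "(\<integral>\<^sup>+ \<omega>. e2ennreal (max_drawdown (\<lambda>t. X t \<omega>)) \<partial>M) = ennreal (sqrt 2 * sqrt (variance (last_term X)))"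
proof (rule antisym[OF X.expectation_max_drawdown_le])
  let ?I = "\<integral>\<^sup>+ \<omega>. e2ennreal (max_drawdown (\<lambda>t. X t \<omega>)) \<partial>M"
  let ?V = "variance (last_term X)"
  have V0: "0 \<le> ?V" by simp
  have "?I < \<infinity>" using X.expectation_max_drawdown_le by (rule order.strict_trans1) simp
  then obtain i where i: "?I = ennreal i" "0 \<le> i" by (cases ?I) auto
  have "expectation (X 0) = 0"
    using X.zero by (subst Bochner_Integration.integral_cong[of M M _ "\<lambda>_. 0"]) auto
  then have V: "?V = (\<integral>\<omega>. (last_term X \<omega>)\<^sup>2 \<partial>M)"
    by (simp add: X.expectation_last_term)
  have bn: "(\<integral>\<omega>. excess h \<omega> \<partial>M) + d \<le> i" if h: "0 \<le> h" for h
  proof -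
    have b0: "0 \<le> excess h \<omega> + d" for \<omega> using d by (simp add: excess_def drawdown_excess_def)
    have "ennreal ((\<integral>\<omega>. excess h \<omega> \<partial>M) + d) = (\<integral>\<^sup>+\<omega>. ennreal (excess h \<omega> + d) \<partial>M)"
      using excess_X(1)[OF h] b0 by (subst nn_integral_eq_integral) (auto simp: prob_space)
    also have "\<dots> \<le> ?I"
    proof (rule nn_integral_mono_AE)
      show "AE \<omega> in M. ennreal (excess h \<omega> + d) \<le> e2ennreal (max_drawdown (\<lambda>t. X t \<omega>))"
        using excess_le_max_drawdown[OF h]
        by eventually_elim (metis e2ennreal_ereal e2ennreal_mono)
    qed
    finally show ?thesis using i by simp
  qed
  \<comment> \<open>The excess identity with the expected excess replaced by its bound
    \<open>i - d\<close>; the gap term tends to 0, so Fatou bounds the variance of the last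
    term.\<close>
  have Xn: "(\<integral>\<omega>. (X (real n) \<omega>)\<^sup>2 \<partial>M) \<le> 2 * d * (i - d) + (\<integral>\<omega>. (gap (real n) \<omega>)\<^sup>2 \<partial>M)" for n
  proof -
    have "2 * d * (\<integral>\<omega>. excess (real n) \<omega> \<partial>M) \<le> 2 * d * (i - d)"
      using bn[of "real n"] d by (intro mult_left_mono) auto
    then show ?thesis using excess_X(2)[of "real n"] by simp
  qed
  have "ennreal ?V = (\<integral>\<^sup>+\<omega>. ennreal ((last_term X \<omega>)\<^sup>2) \<partial>M)"
    unfolding V using X.integrable_last_term_sq by (simp add: nn_integral_eq_integral)
  also have "\<dots> = (\<integral>\<^sup>+\<omega>. liminf (\<lambda>n. ennreal ((X (real n) \<omega>)\<^sup>2)) \<partial>M)"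
  proof (rule nn_integral_cong_AE)
    show "AE \<omega> in M. ennreal ((last_term X \<omega>)\<^sup>2) = liminf (\<lambda>n. ennreal ((X (real n) \<omega>)\<^sup>2))"
      using X.AE_LIMSEQ_last_term
      by eventually_elim
         (rule lim_imp_Liminf[OF sequentially_bot, symmetric], intro tendsto_ennrealI tendsto_power)
  qed
  also have "\<dots> \<le> liminf (\<lambda>n. \<integral>\<^sup>+\<omega>. ennreal ((X (real n) \<omega>)\<^sup>2) \<partial>M)"
    using X.meas by (intro nn_integral_liminf measurable_compose[OF _ measurable_ennreal] borel_measurable_power) auto
  also have "\<dots> \<le> liminf (\<lambda>n. ennreal (2 * d * (i - d) + (\<integral>\<omega>. (gap (real n) \<omega>)\<^sup>2 \<partial>M)))"
    using Xn X.integrable_sq by (intro Liminf_mono always_eventually allI) (simp add: nn_integral_eq_integral ennreal_leI)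
  also have "\<dots> = ennreal (2 * d * (i - d) + 0)"
    by (intro lim_imp_Liminf[OF sequentially_bot] tendsto_ennrealI tendsto_add tendsto_const gap_tendsto)
  finally have "ennreal ?V \<le> ennreal (2 * d * (i - d))" by simp
  moreover have "0 \<le> 2 * d * (i - d)" 
  proof -
    have "0 \<le> (\<integral>\<omega>. excess 0 \<omega> \<partial>M)" by (simp add: excess_def drawdown_excess_def)
    then show ?thesis using bn[of 0] d by simp
  qed
  ultimately have le: "?V \<le> 2 * d * (i - d)" by simp
  define \<sigma> where "\<sigma> = sqrt ?V"
  \<comment> \<open>The arithmetic-geometric mean inequality for \<open>d\<close> and
    \<open>\<sigma>^2 / (2 * d)\<close>, cleared of denominators. With the general upper bound it
    forces equality, so the variance need not be computed.\<close>
  have "0 \<le> (\<sigma> - sqrt 2 * d)\<^sup>2" by simp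
  also have "(\<sigma> - sqrt 2 * d)\<^sup>2 = ?V - 2 * d * (sqrt 2 * \<sigma>) + 2 * d\<^sup>2"
    using V0 by (simp add: power2_diff \<sigma>_def power_mult_distrib)
  finally have "2 * d * (sqrt 2 * \<sigma>) \<le> 2 * d * i"
    using le by (simp add: right_diff_distrib power2_eq_square)
  then have "sqrt 2 * \<sigma> \<le> i" using d by simp
  then show "ennreal (sqrt 2 * sqrt ?V) \<le> ?I" unfolding i \<sigma>_def by (rule ennreal_leI)
qed

end

theorem corollary2:
  shows
   "(\<forall>(M :: 'a measure) F X.
       prob_space M \<and> martingale M F X \<and> right_continuous_paths M X \<and> L2_bounded M X \<longrightarrow>
       (\<lambda>\<omega>. max_drawdown (\<lambda>t. X t \<omega>)) \<in> borel_measurable M \<and>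
       (\<integral>\<^sup>+ \<omega>. e2ennreal (max_drawdown (\<lambda>t. X t \<omega>)) \<partial>M)
         \<le> ennreal (sqrt 2 * sqrt (prob_space.variance M (last_term X)))) \<and>
    (\<forall>(N :: 'b measure) B (d :: real).
       brownian_motion N B \<and> d > 0 \<longrightarrow>
       (let T = (\<lambda>\<omega>. drawdown_fall_time d (\<lambda>t. B t \<omega>));
            X = stopped_process B T;
            S = (\<lambda>\<omega>. max_drawdown_until (T \<omega>) (\<lambda>t. B t \<omega>))
        in (AE \<omega> in N. T \<omega> < \<infinity>) \<and>
           martingale N (natural_filtration N B) X \<and> right_continuous_paths N X \<and>
           L2_bounded N X \<and>
           (\<forall>\<omega>\<in>space N. max_drawdown (\<lambda>t. X t \<omega>) = S \<omega>) \<and>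
           S \<in> borel_measurable N \<and>
           (\<integral>\<^sup>+ \<omega>. e2ennreal (S \<omega>) \<partial>N)
             = ennreal (sqrt 2 * sqrt (prob_space.variance N (value_at_time B T)))))"
proof (intro conjI allI impI)
  fix M :: "'a measure" and F and X :: "real \<Rightarrow> 'a \<Rightarrow> real"
  assume a: "prob_space M \<and> martingale M F X \<and> right_continuous_paths M X \<and> L2_bounded M X"
  then interpret prob_space M by simp
  interpret L2_martingale M F X by unfold_locales (use a in auto)
  show "(\<lambda>\<omega>. max_drawdown (\<lambda>t. X t \<omega>)) \<in> borel_measurable M"
    by (rule max_drawdown_measurable)
  show "(\<integral>\<^sup>+ \<omega>. e2ennreal (max_drawdown (\<lambda>t. X t \<omega>)) \<partial>M)
      \<le> ennreal (sqrt 2 * sqrt (variance (last_term X)))"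
    by (rule expectation_max_drawdown_le)
next
  fix N :: "'b measure" and B and d :: real
  assume a: "brownian_motion N B \<and> d > 0"
  interpret bm: brownian_motion N B using a by simp
  interpret W: brownian_drawdown_stopping N B d by unfold_locales (use a in simp)
  have T: "(\<lambda>\<omega>. drawdown_fall_time d (\<lambda>t. B t \<omega>)) = W.T" by (simp add: W.T_def fun_eq_iff)
  have S: "(\<lambda>\<omega>. max_drawdown_until (W.T \<omega>) (\<lambda>t. B t \<omega>)) \<in> borel_measurable N"
    using W.X.max_drawdown_measurable by (subst measurable_cong[OF W.max_drawdown_X[symmetric]])
  have E: "(\<integral>\<^sup>+ \<omega>. e2ennreal (max_drawdown_until (W.T \<omega>) (\<lambda>t. B t \<omega>)) \<partial>N)
      = ennreal (sqrt 2 * sqrt (bm.variance (value_at_time B W.T)))"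
    using W.expectation_max_drawdown_X unfolding W.variance_value
    by (subst nn_integral_cong[of N _ "\<lambda>\<omega>. e2ennreal (max_drawdown (\<lambda>t. W.X t \<omega>))"])
       (auto simp: W.max_drawdown_X)
  show "let T = (\<lambda>\<omega>. drawdown_fall_time d (\<lambda>t. B t \<omega>));
            X = stopped_process B T;
            S = (\<lambda>\<omega>. max_drawdown_until (T \<omega>) (\<lambda>t. B t \<omega>))
        in (AE \<omega> in N. T \<omega> < \<infinity>) \<and>
           martingale N (natural_filtration N B) X \<and> right_continuous_paths N X \<and>
           L2_bounded N X \<and>
           (\<forall>\<omega>\<in>space N. max_drawdown (\<lambda>t. X t \<omega>) = S \<omega>) \<and>
           S \<in> borel_measurable N \<and>
           (\<integral>\<^sup>+ \<omega>. e2ennreal (S \<omega>) \<partial>N)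
             = ennreal (sqrt 2 * sqrt (prob_space.variance N (value_at_time B T)))"
    unfolding Let_def T W.X_def[symmetric]
    using W.AE_T_finite W.X.mart W.right_continuous_X W.L2_bounded_X W.max_drawdown_X S E by blast
qed

end
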